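(* Let $k$ be a field, let $A$ be a free abelian group of finite rank, and let $G$ be a finite group acting faithfully by automorphisms on $A$, where $\operatorname{char} k$ does not divide $|G|$. Let $R=k[A]^G$ be the algebra of $G$-invariants in the group algebra $k[A]$. If $G$ acts fixed point freely on $\overline{A}=A/A^G$ and $\operatorname{rank}(\overline{A})\ge 2$, then $R$ is not a semigroup algebra over $k$.
   Context: The action of $G$ on $A$ is extended $k$-linearly to the group algebra $k[A]$. $A^G$ is the subgroup of $G$-fixed elements of $A$; the quotient $\overline{A}=A/A^G$ is again free abelian of finite rank, with induced $G$-action. $G$ acts fixed point freely on a lattice $L$ if, for every $1\ne g\in G$, the subgroup of $g$-fixed elements of $L$ is trivial. A semigroup algebra over $k$ is a $k$-algebra isomorphic to the monoid algebra $k[M]$ of some commutative monoid $M$. *)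

theory Defs
  imports "HOL-Algebra.Algebra" "HOL-Library.Poly_Mapping"
begin

section \<open>Free abelian groups and their rank\<close>

definition free_abelian_of_rank :: "('a, 'b) monoid_scheme \<Rightarrow> nat \<Rightarrow> bool"
  where "free_abelian_of_rank L n \<longleftrightarrow> L \<cong> free_Abelian_group {..<n}"

text \<open>Meaningful only for free abelian groups of finite rank.\<close>

definition free_rank :: "('a, 'b) monoid_scheme \<Rightarrow> nat"
  where "free_rank L = (THE n. free_abelian_of_rank L n)"

lemma free_rank_eq:
  assumes "group L" "free_abelian_of_rank L n"
  shows "free_rank L = n"
proof -
  have "m = n" if "free_abelian_of_rank L m" for m
  proof -
    have "free_Abelian_group {..<m} \<cong> free_Abelian_group {..<n}"
      using assms that unfolding free_abelian_of_rank_def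
      by (meson group.iso_sym iso_trans)
    then have "{..<m} \<approx> {..<n}"
      by (simp add: isomorphic_free_Abelian_groups)
    then show ?thesis
      by (simp add: eqpoll_iff_card)
  qed
  then show ?thesis
    using assms(2) unfolding free_rank_def by blast
qed


section \<open>Group actions\<close>

definition fixed_subgroup ::
    "('g, 'c) monoid_scheme \<Rightarrow> ('a, 'b) monoid_scheme \<Rightarrow> ('g \<Rightarrow> 'a \<Rightarrow> 'a) \<Rightarrow> 'a set"
  where "fixed_subgroup G A \<phi> = {a \<in> carrier A. \<forall>g\<in>carrier G. \<phi> g a = a}"

definition fixed_point_free ::
    "('g, 'c) monoid_scheme \<Rightarrow> ('l, 'b) monoid_scheme \<Rightarrow> ('g \<Rightarrow> 'l \<Rightarrow> 'l) \<Rightarrow> bool"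
  where "fixed_point_free G L \<psi> \<longleftrightarrow>
    (\<forall>g\<in>carrier G - {\<one>\<^bsub>G\<^esub>}. {x \<in> carrier L. \<psi> g x = x} = {\<one>\<^bsub>L\<^esub>})"

text \<open>The action induced on a quotient \<open>A Mod H\<close>, whose elements are cosets.\<close>

definition coset_action :: "('g \<Rightarrow> 'a \<Rightarrow> 'a) \<Rightarrow> 'g \<Rightarrow> 'a set \<Rightarrow> 'a set"
  where "coset_action \<phi> g C = \<phi> g ` C"


section \<open>Monoid algebras\<close>

text \<open>
  As in \<open>free_Abelian_group\<close>, the elements are the finitely supported functions whose support
  lies in the carrier; \<open>Poly_Mapping.single x c\<close> is the monomial \<open>c x\<close>.
\<close>

definition monoid_algebra :: "('m, 'b) monoid_scheme \<Rightarrow> ('k::field, 'm \<Rightarrow>\<^sub>0 'k) module"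
  where "monoid_algebra M =
    \<lparr>carrier = {f. Poly_Mapping.keys f \<subseteq> carrier M},
     monoid.mult = (\<lambda>f h. \<Sum>x\<in>Poly_Mapping.keys f. \<Sum>y\<in>Poly_Mapping.keys h.
       Poly_Mapping.single (x \<otimes>\<^bsub>M\<^esub> y) (Poly_Mapping.lookup f x * Poly_Mapping.lookup h y)),
     monoid.one = Poly_Mapping.single \<one>\<^bsub>M\<^esub> 1,
     ring.zero = 0,
     ring.add = (+),
     module.smult = (\<lambda>c f. Poly_Mapping.map ((*) c) f)\<rparr>"

lemma monoid_algebra_mult_eq_times:
  fixes f h :: "'m::comm_monoid_add \<Rightarrow>\<^sub>0 'k::field"
  shows "f \<otimes>\<^bsub>monoid_algebra \<lparr>carrier = UNIV, monoid.mult = (+), one = 0\<rparr>\<^esub> h = f * h"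
proof -
  have expand: "p = (\<Sum>x\<in>Poly_Mapping.keys p. Poly_Mapping.single x (Poly_Mapping.lookup p x))"
    for p :: "'m \<Rightarrow>\<^sub>0 'k"
    by (rule poly_mapping_eqI)
      (auto simp: lookup_sum lookup_single when_def in_keys_iff)
  have "f * h = (\<Sum>x\<in>Poly_Mapping.keys f. Poly_Mapping.single x (Poly_Mapping.lookup f x))
      * (\<Sum>y\<in>Poly_Mapping.keys h. Poly_Mapping.single y (Poly_Mapping.lookup h y))"
    using expand[of f] expand[of h] by simp
  also have "\<dots> = f \<otimes>\<^bsub>monoid_algebra \<lparr>carrier = UNIV, monoid.mult = (+), one = 0\<rparr>\<^esub> h"
    by (simp add: sum_product mult_single monoid_algebra_def)
  finally show ?thesis ..
qed

definition algebra_iso :: "('k, 'r) module \<Rightarrow> ('k, 's) module \<Rightarrow> ('r \<Rightarrow> 's) set"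
  where "algebra_iso R S = {h \<in> ring_iso R S.
    \<forall>c. \<forall>x\<in>carrier R. h (c \<odot>\<^bsub>R\<^esub> x) = c \<odot>\<^bsub>S\<^esub> h x}"

text \<open>
  HOL cannot quantify over types inside a formula, so the type in which the monoid lives is a
  parameter; a theorem with a free type variable \<open>'m\<close> here covers all commutative monoids.
\<close>

definition semigroup_algebra :: "'m itself \<Rightarrow> ('k::field, 'r) module \<Rightarrow> bool"
  where "semigroup_algebra (_ :: 'm itself) R \<longleftrightarrow>
    (\<exists>M :: 'm monoid. comm_monoid M \<and> algebra_iso R (monoid_algebra M) \<noteq> {})"


section \<open>Multiplicative invariants\<close>

definition linear_extension :: "('a \<Rightarrow> 'a) \<Rightarrow> ('a \<Rightarrow>\<^sub>0 'k) \<Rightarrow> ('a \<Rightarrow>\<^sub>0 'k::field)"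
  where "linear_extension s f =
    (\<Sum>a\<in>Poly_Mapping.keys f. Poly_Mapping.single (s a) (Poly_Mapping.lookup f a))"

definition invariant_algebra ::
    "('g, 'c) monoid_scheme \<Rightarrow> ('a, 'b) monoid_scheme \<Rightarrow> ('g \<Rightarrow> 'a \<Rightarrow> 'a) \<Rightarrow>
      ('k::field, 'a \<Rightarrow>\<^sub>0 'k) module"
  where "invariant_algebra G A \<phi> = (monoid_algebra A)
    \<lparr>carrier := {f \<in> carrier (monoid_algebra A). \<forall>g\<in>carrier G. linear_extension (\<phi> g) f = f}\<rparr>"

end

theory Submission
  imports
    "HOL-Computational_Algebra.Formal_Power_Series"
    "HOL-Computational_Algebra.Polynomial_Factorial"
    Defs
begin

text \<open>
  Write \<open>S = k[A]\<close> and suppose that the invariant ring \<open>R\<close> has a \<open>k\<close>-basis closed under multiplication.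
  A linear weight on \<open>A\<close> that vanishes on \<open>A\<^sup>G\<close> gives a grading of \<open>R\<close> by the naturals, in which a basis
  element has the degree of its top term. Scaling the degree \<open>d\<close> part by \<open>(1 + X) ^ d\<close> is a ring
  homomorphism \<open>\<Phi>\<close> from \<open>R\<close> to \<open>S[[X]]\<close>. Since \<open>G\<close> acts fixed point freely on \<open>A/A\<^sup>G\<close>, of rank at least
  two, \<open>S\<close> is unramified over \<open>R\<close> in codimension one, so \<open>\<Phi>\<close> lifts to \<open>S\<close>: Hensel's lemma gives a lift
  over the fraction field, and the denominators cancel.

  Let \<open>g\<close> in \<open>G\<close> have prime order \<open>q\<close>. By uniqueness the lift is equivariant, so modulo
  \<open>B = A\<^sup>G + (g - 1)A\<close> it scales each \<open>a\<close> in \<open>A\<close> by a unit power series with constant term \<open>1\<close> that depends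
  only on the class of \<open>a\<close> in \<open>A/B\<close>. As \<open>A/B\<close> has exponent \<open>q\<close>, which is invertible in \<open>k\<close>, these power
  series are all \<open>1\<close>. Hence every basis element of positive degree vanishes in \<open>k[A/B]\<close>. Varying the
  weight, the image of \<open>R\<close> in \<open>k[A/B]\<close> is \<open>k\<close>; as \<open>S\<close> is integral over \<open>R\<close> and \<open>k[A/B]\<close> is reduced,
  this forces \<open>A = B\<close>, which is impossible for an automorphism of order \<open>q\<close>.
\<close>

section \<open>Ring homomorphisms on subrings\<close>

text \<open>In rank one the statement fails: for A infinite cyclic and G of order two acting by
  inversion, R is the polynomial ring in x + x^-1, a semigroup algebra. Rank two provides a second
  direction. The lift of \<open>gmon b\<close> has denominators built from the binomials
  \<open>1 - gmon (h b - b)\<close>. In rank one all these exponents are multiples of one vector; in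
  rank two a generic \<open>c\<close> makes the denominators for \<open>c\<close> and
  \<open>b + c\<close> coprime to those for \<open>b\<close>, and multiplicativity of the lift ties
  the three together.

  The choice of 1 + X serves two ends. At X = 0 the map \<Phi> is the inclusion of R, which gives
  Hensel's lemma its approximate root. The coefficient of X^d in (1 + X)^d is 1, so a basis element
  of degree d reappears as a coefficient of its own image; if that coefficient dies in k[A/B], so
  does the basis element.

  The power series attached to a is 1 for the following reason: the sum of a over the powers of g
  lies in A^G and is congruent to q a modulo B, so the q-th power of the series is 1, while its
  constant term is 1 and q is invertible.\<close>

locale subring_hom =
  fixes D :: "'a::comm_ring_1 set" and h :: "'a \<Rightarrow> 'b::comm_ring_1"
  assumes one_mem: "1 \<in> D"
    and add_mem: "x \<in> D \<Longrightarrow> y \<in> D \<Longrightarrow> x + y \<in> D"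
    and mult_mem: "x \<in> D \<Longrightarrow> y \<in> D \<Longrightarrow> x * y \<in> D"
    and uminus_mem: "x \<in> D \<Longrightarrow> - x \<in> D"
    and hom_one: "h 1 = 1"
    and hom_add: "x \<in> D \<Longrightarrow> y \<in> D \<Longrightarrow> h (x + y) = h x + h y"
    and hom_mult: "x \<in> D \<Longrightarrow> y \<in> D \<Longrightarrow> h (x * y) = h x * h y"
begin

lemma zero_mem: "0 \<in> D"
  using add_mem[OF one_mem uminus_mem[OF one_mem]] by simp

lemma diff_mem: "x \<in> D \<Longrightarrow> y \<in> D \<Longrightarrow> x - y \<in> D"
  using add_mem[of x "- y"] uminus_mem[of y] by simp

lemma sum_mem: "(\<And>i. i \<in> I \<Longrightarrow> f i \<in> D) \<Longrightarrow> sum f I \<in> D"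
  by (induction I rule: infinite_finite_induct) (auto simp: zero_mem add_mem)

lemma power_mem: "x \<in> D \<Longrightarrow> x ^ n \<in> D"
  by (induction n) (auto simp: one_mem mult_mem)

lemma hom_zero: "h 0 = 0"
  using hom_add[OF zero_mem zero_mem] by simp

lemma hom_uminus: "x \<in> D \<Longrightarrow> h (- x) = - h x"
  using hom_add[of x "- x"] uminus_mem[of x] hom_zero by (simp add: eq_neg_iff_add_eq_0 add.commute)

lemma hom_diff: "x \<in> D \<Longrightarrow> y \<in> D \<Longrightarrow> h (x - y) = h x - h y"
  using hom_add[of x "- y"] uminus_mem[of y] hom_uminus[of y] by simp

lemma hom_sum: "(\<And>i. i \<in> I \<Longrightarrow> f i \<in> D) \<Longrightarrow> h (sum f I) = (\<Sum>i\<in>I. h (f i))"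
  by (induction I rule: infinite_finite_induct) (auto simp: hom_zero hom_add sum_mem)

lemma hom_power: "x \<in> D \<Longrightarrow> h (x ^ n) = h x ^ n"
  by (induction n) (auto simp: hom_one hom_mult power_mem)

definition polys :: "'a poly set"
  where "polys = {P. \<forall>i. poly.coeff P i \<in> D}"

lemma coeff_mem: "P \<in> polys \<Longrightarrow> poly.coeff P i \<in> D"
  by (simp add: polys_def)

lemma polys_diff: "P \<in> polys \<Longrightarrow> Q \<in> polys \<Longrightarrow> P - Q \<in> polys"
  by (simp add: polys_def diff_mem)

lemma polys_mult: "P \<in> polys \<Longrightarrow> Q \<in> polys \<Longrightarrow> P * Q \<in> polys"
  by (simp add: polys_def coeff_mult sum_mem mult_mem)

lemma map_poly_add: "P \<in> polys \<Longrightarrow> Q \<in> polys \<Longrightarrow> map_poly h (P + Q) = map_poly h P + map_poly h Q"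
  by (rule poly_eqI) (simp add: coeff_map_poly hom_zero hom_add coeff_mem)

lemma map_poly_diff: "P \<in> polys \<Longrightarrow> Q \<in> polys \<Longrightarrow> map_poly h (P - Q) = map_poly h P - map_poly h Q"
  by (rule poly_eqI) (simp add: coeff_map_poly hom_zero hom_diff coeff_mem)

lemma map_poly_mult: "P \<in> polys \<Longrightarrow> Q \<in> polys \<Longrightarrow> map_poly h (P * Q) = map_poly h P * map_poly h Q"
  by (rule poly_eqI) (simp add: coeff_map_poly hom_zero coeff_mult hom_sum hom_mult coeff_mem mult_mem)

lemma map_poly_smult: "c \<in> D \<Longrightarrow> P \<in> polys \<Longrightarrow> map_poly h (Polynomial.smult c P) = Polynomial.smult (h c) (map_poly h P)"
  by (rule poly_eqI) (simp add: coeff_map_poly hom_zero hom_mult coeff_mem)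

lemma hom_poly:
  assumes "P \<in> polys" "x \<in> D"
  shows "h (poly P x) = poly (map_poly h P) (h x)"
proof -
  have deg: "Polynomial.degree (map_poly h P) \<le> Polynomial.degree P"
    by (rule degree_le) (simp add: coeff_map_poly hom_zero coeff_eq_0)
  have "h (poly P x) = (\<Sum>i\<le>Polynomial.degree P. h (poly.coeff P i) * h x ^ i)"
    using assms by (simp add: poly_altdef hom_sum hom_mult hom_power mult_mem power_mem coeff_mem)
  also have "\<dots> = (\<Sum>i\<le>Polynomial.degree P. poly.coeff (map_poly h P) i * h x ^ i)"
    by (simp add: coeff_map_poly hom_zero)
  also have "\<dots> = poly (map_poly h P) (h x)"
    unfolding poly_altdef
    by (rule sum.mono_neutral_right) (use deg in \<open>auto simp: coeff_eq_0\<close>)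
  finally show ?thesis .
qed

end

locale total_hom = subring_hom UNIV h for h :: "'a::comm_ring_1 \<Rightarrow> 'b::comm_ring_1"
begin

lemma hom_prod: "h (prod f I) = (\<Prod>i\<in>I. h (f i))"
  by (induction I rule: infinite_finite_induct) (auto simp: hom_one hom_mult)

lemma map_poly_hom: "total_hom (map_poly h)"
  by unfold_locales (auto simp: map_poly_add map_poly_mult polys_def hom_one map_poly_1')

end

lemma total_homI:
  assumes "h 1 = 1" "\<And>x y. h (x + y) = h x + h y" "\<And>x y. h (x * y) = h x * h y"
  shows "total_hom h"
  by unfold_locales (use assms in auto)

definition fps_map :: "('a::zero \<Rightarrow> 'b::zero) \<Rightarrow> 'a fps \<Rightarrow> 'b fps"
  where "fps_map h F = Abs_fps (\<lambda>i. h (fps_nth F i))"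

lemma fps_map_nth [simp]: "fps_nth (fps_map h F) i = h (fps_nth F i)"
  by (simp add: fps_map_def)

lemma (in total_hom) fps_map_hom: "total_hom (fps_map h)"
  by (rule total_homI; rule fps_ext)
     (auto simp: hom_one hom_zero hom_add fps_mult_nth hom_sum hom_mult)

section \<open>Newton iteration\<close>

text \<open>The second order term is left existential, so no factorial is divided by and the
  expansion holds in every characteristic. It drives both existence and uniqueness of power series
  roots.\<close>

lemma poly_taylor:
  fixes P :: "'a::idom poly"
  shows "\<exists>q. poly P (y + z) = poly P y + poly (pderiv P) y * z + q * z ^ 2"
proof (induction P)
  case 0
  then show ?case by auto
next
  case (pCons a P)
  then obtain q where q: "poly P (y + z) = poly P y + poly (pderiv P) y * z + q * z ^ 2"
    by blast
  have "poly (pCons a P) (y + z) = poly (pCons a P) y + poly (pderiv (pCons a P)) y * z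
      + (q * (y + z) + poly (pderiv P) y) * z ^ 2"
    by (simp add: q pderiv_pCons algebra_simps power2_eq_square power3_eq_cube)
  then show ?case by blast
qed

lemma fps_mult_nth_low:
  fixes f z :: "'a::idom fps"
  assumes "\<And>j. j < n \<Longrightarrow> fps_nth z j = 0"
  shows "fps_nth (f * z) n = fps_nth f 0 * fps_nth z n"
    and "m < n \<Longrightarrow> fps_nth (f * z) m = 0"
proof -
  have "fps_nth (f * z) n = (\<Sum>i\<in>{0..n}. if i = 0 then fps_nth f 0 * fps_nth z n else 0)"
    unfolding fps_mult_nth by (rule sum.cong) (use assms in auto)
  then show "fps_nth (f * z) n = fps_nth f 0 * fps_nth z n" by simp
  show "m < n \<Longrightarrow> fps_nth (f * z) m = 0"
    unfolding fps_mult_nth by (rule sum.neutral) (use assms in auto)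
qed

text \<open>In \<open>(poly (pderiv P) y + q * z) * z\<close> the first factor has the constant term
  of \<open>poly (pderiv P) y\<close>, because \<open>z\<close> has none. As \<open>z\<close> starts
  in degree \<open>n\<close>, the first coefficient that moves does so linearly.\<close>

lemma poly_perturb_nth:
  fixes P :: "'a::idom fps poly"
  assumes n: "n > 0" and z: "\<And>j. j < n \<Longrightarrow> fps_nth z j = 0"
  shows "fps_nth (poly P (y + z)) n = fps_nth (poly P y) n + fps_nth (poly (pderiv P) y) 0 * fps_nth z n"
    and "m < n \<Longrightarrow> fps_nth (poly P (y + z)) m = fps_nth (poly P y) m"
proof -
  obtain q where q: "poly P (y + z) = poly P y + (poly (pderiv P) y + q * z) * z"
    using poly_taylor[of P y z] by (auto simp: algebra_simps power2_eq_square)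
  have "fps_nth (q * z) 0 = 0" using n z[of 0] by simp
  then show "fps_nth (poly P (y + z)) n = fps_nth (poly P y) n + fps_nth (poly (pderiv P) y) 0 * fps_nth z n"
    unfolding q by (simp only: fps_add_nth fps_mult_nth_low(1)[OF z]) simp
  show "m < n \<Longrightarrow> fps_nth (poly P (y + z)) m = fps_nth (poly P y) m"
    unfolding q by (simp only: fps_add_nth fps_mult_nth_low(2)[OF z]) simp
qed

text \<open>The Taylor formula at \<open>x\<close> gives a vanishing product of \<open>y - x\<close>
  with a series whose constant term is that of the derivative, hence nonzero. Power series over a
  domain form a domain, so \<open>y - x\<close> is zero.\<close>

lemma fps_root_unique:
  fixes P :: "'a::idom fps poly"
  assumes "poly P x = 0" "poly P y = 0" "fps_nth x 0 = fps_nth y 0"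
    and "fps_nth (poly (pderiv P) x) 0 \<noteq> 0"
  shows "x = y"
proof -
  obtain q where q: "poly P (x + (y - x)) = poly P x + poly (pderiv P) x * (y - x) + q * (y - x) ^ 2"
    using poly_taylor by blast
  then have "(poly (pderiv P) x + q * (y - x)) * (y - x) = 0"
    using assms by (simp add: algebra_simps power2_eq_square)
  moreover have "fps_nth (poly (pderiv P) x + q * (y - x)) 0 \<noteq> 0"
    using assms by simp
  then have "poly (pderiv P) x + q * (y - x) \<noteq> 0" by (metis fps_zero_nth)
  ultimately show ?thesis by simp
qed

text \<open>Hensel's lemma: each stage corrects one coefficient, dividing by the constant term of
  the derivative, which all approximations share because they agree modulo X.\<close>

lemma fps_root_exists:
  fixes P :: "'a::field fps poly"
  assumes P0: "fps_nth (poly P (fps_const a)) 0 = 0"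
    and d: "fps_nth (poly (pderiv P) (fps_const a)) 0 \<noteq> 0"
  shows "\<exists>x. poly P x = 0 \<and> fps_nth x 0 = a"
proof -
  define d where "d = fps_nth (poly (pderiv P) (fps_const a)) 0"
  \<comment> \<open>By \<open>poly_perturb_nth\<close>, adding c X^(n+1) changes the coefficient of
    X^(n+1) in \<open>poly P y\<close> by \<open>d * c\<close> and no lower one, so this correction
    makes it zero.\<close>
  define y where "y = rec_nat (fps_const a)
    (\<lambda>n y. y - fps_const (fps_nth (poly P y) (Suc n) / d) * fps_X ^ Suc n)"
  have y0: "y 0 = fps_const a" by (simp add: y_def)
  have yS: "y (Suc n) = y n - fps_const (fps_nth (poly P (y n)) (Suc n) / d) * fps_X ^ Suc n" for n
    by (simp add: y_def)
  have const0: "fps_nth (poly Q x) 0 = fps_nth (poly Q x') 0" if "fps_nth x 0 = fps_nth x' 0"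
    for Q :: "'a fps poly" and x x'
    using that by (induction Q) auto
  have step: "y (Suc n) = y n + (- fps_const (fps_nth (poly P (y n)) (Suc n) / d) * fps_X ^ Suc n)" for n
    by (simp only: yS mult_minus_left diff_conv_add_uminus)
  have yn0: "fps_nth (y n) 0 = a" for n
    by (induction n) (auto simp: y0 yS)
  have zlow: "fps_nth (- fps_const c * fps_X ^ Suc n) j = 0" if "j < Suc n" for c :: 'a and n j
    using that by (simp only: fps_X_power_nth fps_const_neg fps_mult_left_const_nth) auto
  have root: "\<forall>j\<le>n. fps_nth (poly P (y n)) j = 0" for n
  proof (induction n)
    case 0
    then show ?case using P0 by (simp add: y0)
  next
    case (Suc n)
    have "fps_nth (poly P (y (Suc n))) (Suc n) = 0"
      unfolding step
      by (subst poly_perturb_nth(1)[OF _ zlow])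
         (use d const0[of "y n" "fps_const a" "pderiv P"] yn0[of n] in
           \<open>auto simp: fps_X_power_nth d_def[symmetric] simp del: power_Suc\<close>)
    moreover have "fps_nth (poly P (y (Suc n))) j = fps_nth (poly P (y n)) j" if "j < Suc n" for j
      unfolding step by (rule poly_perturb_nth(2)[OF _ zlow that]) auto
    ultimately show ?case using Suc by (auto simp: le_Suc_eq)
  qed
  have stable: "fps_nth (y (n + k)) j = fps_nth (y n) j" if "j \<le> n" for n k j
    using that by (induction k) (auto simp: yS fps_X_power_nth simp del: power_Suc)
  \<comment> \<open>The diagonal is the limit of the \<open>y n\<close>: later corrections leave the
    coefficients of \<open>y n\<close> up to degree \<open>n\<close> alone.\<close>
  define x where "x = Abs_fps (\<lambda>n. fps_nth (y n) n)"
  have "fps_nth (poly P x) n = 0" for n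
  proof -
    have "fps_nth (x - y n) j = 0" if "j < Suc n" for j
      using stable[of j j "n - j"] that by (simp add: x_def)
    from poly_perturb_nth(2)[OF _ this, of "Suc n" n P "y n"]
    have "fps_nth (poly P x) n = fps_nth (poly P (y n)) n" by simp
    then show ?thesis using root by auto
  qed
  then have "poly P x = 0" by (intro fps_ext) simp
  moreover have "fps_nth x 0 = a" by (simp add: x_def y0)
  ultimately show ?thesis by blast
qed

section \<open>Group algebras as polynomial mappings\<close>

definition gmon :: "'v \<Rightarrow> ('v \<Rightarrow>\<^sub>0 'k::field)"
  where "gmon a = Poly_Mapping.single a 1"

definition cst :: "'k \<Rightarrow> ('v::zero \<Rightarrow>\<^sub>0 'k::field)"
  where "cst c = Poly_Mapping.single 0 c"

text \<open>Additivity asks nothing of \<open>F\<close>, so \<open>F\<close> may be an indicator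
  function or a basis; when \<open>F\<close> turns sums into products, the evaluation is a ring
  homomorphism. Linear extensions, gradings, the augmentation, coset sums and basis expansions are
  all instances.\<close>

definition pm_eval :: "('k::field \<Rightarrow> 'q::comm_ring_1) \<Rightarrow> ('x \<Rightarrow> 'q) \<Rightarrow> ('x \<Rightarrow>\<^sub>0 'k) \<Rightarrow> 'q"
  where "pm_eval \<iota> F p = (\<Sum>x\<in>Poly_Mapping.keys p. \<iota> (Poly_Mapping.lookup p x) * F x)"

lemma pm_expand: "p = (\<Sum>x\<in>Poly_Mapping.keys p. Poly_Mapping.single x (Poly_Mapping.lookup p x))"
  by (rule poly_mapping_eqI) (auto simp: lookup_sum lookup_single when_def in_keys_iff)

lemma gmon_add: "gmon (a + b) = (gmon a * gmon b :: 'v::comm_monoid_add \<Rightarrow>\<^sub>0 'k::field)"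
  by (simp add: gmon_def mult_single)

lemma gmon_zero [simp]: "gmon 0 = 1"
  by (simp add: gmon_def)

lemma gmon_eq_iff [simp]: "gmon a = (gmon b :: 'v \<Rightarrow>\<^sub>0 'k::field) \<longleftrightarrow> a = b"
proof
  assume "gmon a = (gmon b :: 'v \<Rightarrow>\<^sub>0 'k)"
  then have "Poly_Mapping.keys (gmon a :: 'v \<Rightarrow>\<^sub>0 'k) = Poly_Mapping.keys (gmon b :: 'v \<Rightarrow>\<^sub>0 'k)" by simp
  then show "a = b" by (simp add: gmon_def)
qed simp

lemma gmon_uminus [simp]: "gmon a * gmon (- a) = (1 :: 'v::ab_group_add \<Rightarrow>\<^sub>0 'k::field)"
  by (simp add: gmon_add[symmetric])

lemma cst_hom: "total_hom (cst :: 'k::field \<Rightarrow> ('v::comm_monoid_add \<Rightarrow>\<^sub>0 'k))"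
  by (rule total_homI) (auto simp: cst_def single_add mult_single)

lemma single_eq_cst_mon: "Poly_Mapping.single a c = (cst c * gmon a :: 'v::comm_monoid_add \<Rightarrow>\<^sub>0 'k::field)"
  by (simp add: gmon_def cst_def mult_single)

lemma lookup_cst_mult [simp]:
  "Poly_Mapping.lookup (cst c * p) a = c * Poly_Mapping.lookup (p :: 'v::comm_monoid_add \<Rightarrow>\<^sub>0 'k::field) a"
  unfolding cst_def mult_map_scale_conv_mult[symmetric]
  by transfer (auto simp: when_def)

lemma lookup_mon_mult [simp]:
  "Poly_Mapping.lookup (gmon v * p) a = Poly_Mapping.lookup (p :: 'v::ab_group_add \<Rightarrow>\<^sub>0 'k::field) (a - v)"
proof -
  have "gmon v * p = (\<Sum>x\<in>Poly_Mapping.keys p. Poly_Mapping.single (v + x) (Poly_Mapping.lookup p x))"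
    by (subst pm_expand[of p]) (simp add: gmon_def sum_distrib_left mult_single)
  moreover have "v + x = a \<longleftrightarrow> x = a - v" for x
    by (auto simp: algebra_simps)
  ultimately have "Poly_Mapping.lookup (gmon v * p) a
      = (\<Sum>x\<in>Poly_Mapping.keys p. if x = a - v then Poly_Mapping.lookup p x else 0)"
    by (simp add: lookup_sum lookup_single when_def)
  then show ?thesis by (simp add: in_keys_iff)
qed

context
  fixes \<iota> :: "'k::field \<Rightarrow> 'q::comm_ring_1"
  assumes \<iota>: "total_hom \<iota>"
begin

interpretation \<iota>: total_hom \<iota> by (rule \<iota>)

lemma pm_eval_superset:
  assumes "finite A" "Poly_Mapping.keys p \<subseteq> A"
  shows "pm_eval \<iota> F p = (\<Sum>x\<in>A. \<iota> (Poly_Mapping.lookup p x) * F x)"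
  unfolding pm_eval_def
  by (rule sum.mono_neutral_left) (use assms in \<open>auto simp: in_keys_iff \<iota>.hom_zero\<close>)

lemma pm_eval_zero [simp]: "pm_eval \<iota> F 0 = 0"
  by (simp add: pm_eval_def)

lemma pm_eval_add: "pm_eval \<iota> F (p + q) = pm_eval \<iota> F p + pm_eval \<iota> F q"
proof -
  let ?A = "Poly_Mapping.keys p \<union> Poly_Mapping.keys q"
  have "pm_eval \<iota> F (p + q) = (\<Sum>x\<in>?A. \<iota> (Poly_Mapping.lookup (p + q) x) * F x)"
    by (rule pm_eval_superset) (use keys_add[of p q] in auto)
  moreover have "pm_eval \<iota> F p = (\<Sum>x\<in>?A. \<iota> (Poly_Mapping.lookup p x) * F x)"
    by (rule pm_eval_superset) auto
  moreover have "pm_eval \<iota> F q = (\<Sum>x\<in>?A. \<iota> (Poly_Mapping.lookup q x) * F x)"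
    by (rule pm_eval_superset) auto
  ultimately show ?thesis
    by (simp add: lookup_add \<iota>.hom_add sum.distrib distrib_right)
qed

lemma pm_eval_sum: "pm_eval \<iota> F (sum p I) = (\<Sum>i\<in>I. pm_eval \<iota> F (p i))"
  by (induction I rule: infinite_finite_induct) (auto simp: pm_eval_add)

lemma pm_eval_single: "pm_eval \<iota> F (Poly_Mapping.single x c) = \<iota> c * F x"
  by (subst pm_eval_superset[of "{x}"]) (auto split: if_splits)

lemma pm_eval_mon: "pm_eval \<iota> F (gmon x) = F x"
  by (simp add: gmon_def pm_eval_single \<iota>.hom_one)

lemma pm_eval_hom:
  fixes F :: "'v::comm_monoid_add \<Rightarrow> 'q"
  assumes F0: "F 0 = 1" and F: "\<And>a b. F (a + b) = F a * F b"
  shows "total_hom (pm_eval \<iota> F)"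
proof (rule total_homI)
  show "pm_eval \<iota> F 1 = 1"
    using pm_eval_mon[of F 0] by (simp add: F0)
  show "pm_eval \<iota> F (x * y) = pm_eval \<iota> F x * pm_eval \<iota> F y" for x y
  proof -
    have "x * y = (\<Sum>a\<in>Poly_Mapping.keys x. \<Sum>b\<in>Poly_Mapping.keys y.
       Poly_Mapping.single (a + b) (Poly_Mapping.lookup x a * Poly_Mapping.lookup y b))"
      by (subst pm_expand[of x], subst pm_expand[of y]) (simp add: sum_product mult_single)
    then have "pm_eval \<iota> F (x * y) = (\<Sum>a\<in>Poly_Mapping.keys x. \<Sum>b\<in>Poly_Mapping.keys y.
       (\<iota> (Poly_Mapping.lookup x a) * F a) * (\<iota> (Poly_Mapping.lookup y b) * F b))"
      by (simp add: pm_eval_sum pm_eval_single F \<iota>.hom_mult mult_ac)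
    then show ?thesis by (simp add: pm_eval_def sum_product)
  qed
qed (rule pm_eval_add)

end

lemma linear_extension_eq_pm_eval:
  "linear_extension s f = pm_eval cst (\<lambda>a. gmon (s a)) (f :: 'v::comm_monoid_add \<Rightarrow>\<^sub>0 'k::field)"
  by (simp add: linear_extension_def pm_eval_def single_eq_cst_mon)

lemma linear_extension_mon [simp]:
  "linear_extension s (gmon a) = (gmon (s a) :: 'v::comm_monoid_add \<Rightarrow>\<^sub>0 'k::field)"
  by (simp add: linear_extension_eq_pm_eval pm_eval_mon cst_hom)

lemma linear_extension_single [simp]:
  "linear_extension s (Poly_Mapping.single a c) = (Poly_Mapping.single (s a) c :: 'v::comm_monoid_add \<Rightarrow>\<^sub>0 'k::field)"
  by (simp add: linear_extension_eq_pm_eval pm_eval_single cst_hom single_eq_cst_mon[symmetric])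

lemma linear_extension_hom:
  fixes s :: "'v::ab_group_add \<Rightarrow> 'v"
  assumes "\<And>a b. s (a + b) = s a + s b"
  shows "total_hom (linear_extension s :: ('v \<Rightarrow>\<^sub>0 'k::field) \<Rightarrow> _)"
proof -
  have "s 0 = 0" using assms[of 0 0] by simp
  then have "total_hom (pm_eval cst (\<lambda>a. gmon (s a)) :: ('v \<Rightarrow>\<^sub>0 'k) \<Rightarrow> ('v \<Rightarrow>\<^sub>0 'k))"
    by (intro pm_eval_hom cst_hom) (auto simp: assms gmon_add)
  then show ?thesis by (simp add: linear_extension_eq_pm_eval[abs_def])
qed

lemma linear_extension_comp:
  "linear_extension s (linear_extension t f) = linear_extension (\<lambda>a. s (t a)) (f :: 'v::comm_monoid_add \<Rightarrow>\<^sub>0 'k::field)"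
  unfolding linear_extension_def[of t] linear_extension_def[of "\<lambda>a. s (t a)"]
  by (simp add: linear_extension_eq_pm_eval pm_eval_sum pm_eval_single cst_hom single_eq_cst_mon[symmetric])

lemma linear_extension_id [simp]: "linear_extension (\<lambda>a. a) f = f"
  using pm_expand[of f] by (simp add: linear_extension_def)

lemma lookup_linear_extension_inj:
  assumes "inj s"
  shows "Poly_Mapping.lookup (linear_extension s f) (s a) = Poly_Mapping.lookup f a"
  using assms by (auto simp: linear_extension_def lookup_sum lookup_single when_def in_keys_iff inj_eq)

subsection \<open>Top degrees\<close>

text \<open>The sum of the two largest keys is attained by no other pair of keys, so its coefficient
  is a product of two nonzero elements of a domain.\<close>

lemma pm_mult_top:
  fixes p q :: "'v::linordered_ab_group_add \<Rightarrow>\<^sub>0 'k::idom"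
  assumes "p \<noteq> 0" "q \<noteq> 0"
  shows "Max (Poly_Mapping.keys (p * q)) = Max (Poly_Mapping.keys p) + Max (Poly_Mapping.keys q)"
proof -
  let ?M = "Max (Poly_Mapping.keys p)" and ?N = "Max (Poly_Mapping.keys q)"
  have M: "?M \<in> Poly_Mapping.keys p" "?N \<in> Poly_Mapping.keys q"
    using assms by (auto intro!: Max_in)
  have "p * q = (\<Sum>a\<in>Poly_Mapping.keys p. \<Sum>b\<in>Poly_Mapping.keys q.
       Poly_Mapping.single (a + b) (Poly_Mapping.lookup p a * Poly_Mapping.lookup q b))"
    by (subst pm_expand[of p], subst pm_expand[of q]) (simp add: sum_product mult_single)
  then have "Poly_Mapping.lookup (p * q) (?M + ?N) =
     (\<Sum>a\<in>Poly_Mapping.keys p. \<Sum>b\<in>Poly_Mapping.keys q.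
       (Poly_Mapping.lookup p a * Poly_Mapping.lookup q b when a + b = ?M + ?N))"
    by (simp add: lookup_sum lookup_single)
  also have "\<dots> = (\<Sum>a\<in>Poly_Mapping.keys p. \<Sum>b\<in>Poly_Mapping.keys q.
       if b = ?N then (if a = ?M then Poly_Mapping.lookup p a * Poly_Mapping.lookup q b else 0) else 0)"
  proof (intro sum.cong refl)
    fix a b assume "a \<in> Poly_Mapping.keys p" "b \<in> Poly_Mapping.keys q"
    then have "a \<le> ?M" "b \<le> ?N" by auto
    then have "a + b = ?M + ?N \<longleftrightarrow> a = ?M \<and> b = ?N"
      using add_less_le_mono[of a ?M b ?N] add_le_less_mono[of a ?M b ?N] by force
    then show "(Poly_Mapping.lookup p a * Poly_Mapping.lookup q b when a + b = ?M + ?N) =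
      (if b = ?N then (if a = ?M then Poly_Mapping.lookup p a * Poly_Mapping.lookup q b else 0) else 0)"
      by (auto simp: when_def)
  qed
  also have "\<dots> = Poly_Mapping.lookup p ?M * Poly_Mapping.lookup q ?N"
    using M by simp
  finally have "?M + ?N \<in> Poly_Mapping.keys (p * q)"
    using M by (simp add: in_keys_iff)
  moreover have "c \<le> ?M + ?N" if c: "c \<in> Poly_Mapping.keys (p * q)" for c
  proof -
    obtain a b where "a \<in> Poly_Mapping.keys p" "b \<in> Poly_Mapping.keys q" "c = a + b"
      using c keys_mult[of p q] by blast
    then show ?thesis by (simp add: add_mono)
  qed
  ultimately show ?thesis
    by (intro Max_eqI) auto
qed

text \<open>Different keys may have the same weight, so the leading part of \<open>f\<close> for
  \<open>w\<close> is an element of the group algebra and not a scalar. Collecting it into one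
  coefficient turns \<open>f\<close> into a Laurent polynomial over a domain, to which
  \<open>pm_mult_top\<close> applies.\<close>

definition grading :: "('v \<Rightarrow> int) \<Rightarrow> ('v \<Rightarrow>\<^sub>0 'k) \<Rightarrow> (int \<Rightarrow>\<^sub>0 ('v::linordered_ab_group_add \<Rightarrow>\<^sub>0 'k::field))"
  where "grading w = pm_eval (\<lambda>c. Poly_Mapping.single 0 (cst c)) (\<lambda>a. Poly_Mapping.single (w a) (gmon a))"

lemma grading_hom:
  assumes "\<And>a b. w (a + b) = w a + w b"
  shows "total_hom (grading w :: ('v::linordered_ab_group_add \<Rightarrow>\<^sub>0 'k::field) \<Rightarrow> _)"
proof -
  interpret c: total_hom "cst :: 'k \<Rightarrow> 'v \<Rightarrow>\<^sub>0 'k" by (rule cst_hom)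
  have "w 0 = 0" using assms[of 0 0] by simp
  moreover have "total_hom (\<lambda>c. Poly_Mapping.single (0::int) (cst c :: 'v \<Rightarrow>\<^sub>0 'k))"
    by (rule total_homI) (auto simp: c.hom_one c.hom_add c.hom_mult single_add mult_single)
  ultimately show ?thesis
    unfolding grading_def by (intro pm_eval_hom) (auto simp: assms gmon_add mult_single)
qed

lemma lookup_grading:
  fixes f :: "'v::linordered_ab_group_add \<Rightarrow>\<^sub>0 'k::field"
  shows
  "Poly_Mapping.lookup (Poly_Mapping.lookup (grading w f) d) a = (Poly_Mapping.lookup f a when w a = d)"
proof -
  have "grading w f = (\<Sum>x\<in>Poly_Mapping.keys f.
      Poly_Mapping.single (w x) (Poly_Mapping.single x (Poly_Mapping.lookup f x)))"
    by (simp add: grading_def pm_eval_def mult_single single_eq_cst_mon)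
  moreover have "Poly_Mapping.lookup (Poly_Mapping.lookup (Poly_Mapping.single (w x) (Poly_Mapping.single x c)) d) a
      = (if x = a then (c when w a = d) else 0)" for x and c :: 'k
    by (auto simp: lookup_single when_def)
  ultimately show ?thesis
    by (simp add: lookup_sum in_keys_iff)
qed

lemma keys_grading:
  fixes f :: "'v::linordered_ab_group_add \<Rightarrow>\<^sub>0 'k::field"
  shows "Poly_Mapping.keys (grading w f) = w ` Poly_Mapping.keys f"
proof (rule Set.set_eqI)
  fix d
  have "Poly_Mapping.lookup (grading w f) d = 0 \<longleftrightarrow> (\<forall>a. w a = d \<longrightarrow> Poly_Mapping.lookup f a = 0)"
    by (simp add: poly_mapping_eq_iff fun_eq_iff lookup_grading when_def)
  then show "(d \<in> Poly_Mapping.keys (grading w f)) \<longleftrightarrow> d \<in> w ` Poly_Mapping.keys f"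
    by (auto simp: in_keys_iff)
qed

definition top_deg :: "('v \<Rightarrow> int) \<Rightarrow> ('v \<Rightarrow>\<^sub>0 'k::zero) \<Rightarrow> int"
  where "top_deg w f = Max (w ` Poly_Mapping.keys f)"

lemma top_deg_mult:
  fixes f h :: "'v::linordered_ab_group_add \<Rightarrow>\<^sub>0 'k::field"
  assumes w: "\<And>a b. w (a + b) = w a + w b" and "f \<noteq> 0" "h \<noteq> 0"
  shows "top_deg w (f * h) = top_deg w f + top_deg w h"
proof -
  interpret g: total_hom "grading w :: ('v \<Rightarrow>\<^sub>0 'k) \<Rightarrow> _" by (rule grading_hom[OF w])
  have "grading w f \<noteq> 0" if "f \<noteq> 0" for f :: "'v \<Rightarrow>\<^sub>0 'k"
    using that keys_grading[of w f] by (metis image_is_empty keys_eq_empty)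
  then show ?thesis
    using assms pm_mult_top[of "grading w f" "grading w h"]
    by (simp add: top_deg_def keys_grading[symmetric] g.hom_mult)
qed

text \<open>Of infinite rank, so that one fixed type contains a copy of every free abelian group of
  finite rank.\<close>

type_synonym lattice = "nat \<Rightarrow>\<^sub>0 int"

section \<open>Coprimality of binomials\<close>

lemma frag_cmul_Suc: "frag_cmul (int (Suc n)) v = v + frag_cmul (int n) v"
  by (simp add: frag_cmul_distrib add.commute)

lemma gmon_multiple: "gmon (frag_cmul (int n) v) = (gmon v ^ n :: lattice \<Rightarrow>\<^sub>0 'k::field)"
  by (induction n) (simp_all only: frag_cmul_Suc gmon_add, simp_all)

definition restrict_keys :: "'v set \<Rightarrow> ('v \<Rightarrow>\<^sub>0 'k::zero) \<Rightarrow> ('v \<Rightarrow>\<^sub>0 'k)"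
  where "restrict_keys A f = Abs_poly_mapping (\<lambda>x. Poly_Mapping.lookup f x when x \<in> A)"

lemma lookup_restrict_keys [simp]:
  "Poly_Mapping.lookup (restrict_keys A f) x = (Poly_Mapping.lookup f x when x \<in> A)"
proof -
  have "finite {x. (Poly_Mapping.lookup f x when x \<in> A) \<noteq> 0}"
    by (rule finite_subset[OF _ finite_lookup[of f]]) (auto simp: when_def)
  then show ?thesis by (simp add: restrict_keys_def)
qed

lemma restrict_keys_diff:
  "restrict_keys A (f - h) = restrict_keys A f - restrict_keys A (h :: 'v \<Rightarrow>\<^sub>0 'k::ab_group_add)"
  by (rule poly_mapping_eqI) (simp add: lookup_minus when_def)

lemma restrict_keys_mon_mult:
  fixes f :: "'v::ab_group_add \<Rightarrow>\<^sub>0 'k::field"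
  assumes "\<And>a. a - v \<in> A \<longleftrightarrow> a \<in> A"
  shows "restrict_keys A (gmon v * f) = gmon v * restrict_keys A f"
  by (rule poly_mapping_eqI) (simp add: when_def assms)

text \<open>The idea is to replace \<open>1 - gmon w\<close> by its multiple
  \<open>1 - gmon w ^ N\<close>, where \<open>N\<close> is such that the support of \<open>y\<close>
  and its translate by \<open>N\<close> times \<open>w\<close> meet no common coset of the multiples
  of \<open>v\<close>. Multiplication by \<open>1 - gmon v\<close> respects these cosets, so
  restricting the equation to the cosets that meet the support of \<open>y\<close> leaves
  \<open>y\<close> alone on one side.\<close>

lemma binomial_dvd_cancel:
  fixes y z :: "lattice \<Rightarrow>\<^sub>0 'k::field"
  assumes eq: "(1 - gmon w) * y = (1 - gmon v) * z"
    and indep: "\<And>m n. frag_cmul n w = frag_cmul m v \<Longrightarrow> n = 0"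
  shows "(1 - gmon v) dvd y"
proof -
  \<comment> \<open>These \<open>N\<close> are the multiples of \<open>w\<close> that carry
    \<open>b\<close> into the coset of \<open>a\<close>. The difference of two of them would violate
    independence, so there is at most one.\<close>
  define bad where "bad a b = {N::nat. \<exists>m. frag_cmul (int N) w = (a - b) + frag_cmul m v}" for a b
  have "finite (bad a b)" for a b
  proof (cases "\<exists>N. N \<in> bad a b")
    case True
    then obtain N m where N: "frag_cmul (int N) w = (a - b) + frag_cmul m v"
      by (auto simp: bad_def)
    have "N' = N" if N': "N' \<in> bad a b" for N'
    proof -
      obtain m' where "frag_cmul (int N') w = (a - b) + frag_cmul m' v"
        using N' by (auto simp: bad_def)
      then have "frag_cmul (int N' - int N) w = frag_cmul (m' - m) v"
        by (simp add: frag_cmul_diff_distrib N)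
      then show ?thesis using indep by fastforce
    qed
    then have "bad a b \<subseteq> {N}" by blast
    then show ?thesis by (rule finite_subset) simp
  qed auto
  then have "finite (\<Union>a\<in>Poly_Mapping.keys y. \<Union>b\<in>Poly_Mapping.keys y. bad a b)"
    by auto
  then obtain N where N: "N \<notin> (\<Union>a\<in>Poly_Mapping.keys y. \<Union>b\<in>Poly_Mapping.keys y. bad a b)"
    using ex_new_if_finite infinite_UNIV_nat by blast
  define A where "A = {c. \<exists>a\<in>Poly_Mapping.keys y. \<exists>m. c = a + frag_cmul m v}"
  have "c + v \<in> A" if "c \<in> A" for c
  proof -
    obtain a m where "a \<in> Poly_Mapping.keys y" "c = a + frag_cmul m v"
      using \<open>c \<in> A\<close> by (auto simp: A_def)
    then have "a \<in> Poly_Mapping.keys y" "c + v = a + frag_cmul (m + 1) v"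
      by (auto simp: frag_cmul_distrib)
    then show ?thesis unfolding A_def by blast
  qed
  moreover have "c - v \<in> A" if "c \<in> A" for c
  proof -
    obtain a m where "a \<in> Poly_Mapping.keys y" "c = a + frag_cmul m v"
      using \<open>c \<in> A\<close> by (auto simp: A_def)
    then have "a \<in> Poly_Mapping.keys y" "c - v = a + frag_cmul (m - 1) v"
      by (auto simp: frag_cmul_diff_distrib)
    then show ?thesis unfolding A_def by blast
  qed
  ultimately have stable: "c - v \<in> A \<longleftrightarrow> c \<in> A" for c
    by (metis diff_add_cancel)
  have keys: "a \<in> A" if "a \<in> Poly_Mapping.keys y" for a
    unfolding A_def using that by (auto intro!: bexI[of _ a] exI[of _ 0])
  have y: "restrict_keys A y = y"
    by (rule poly_mapping_eqI) (use keys in \<open>auto simp: when_def in_keys_iff\<close>)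
  have shifted: "restrict_keys A (gmon (frag_cmul (int N) w) * y) = 0"
  proof (rule poly_mapping_eqI)
    fix c
    have "Poly_Mapping.lookup y (c - frag_cmul (int N) w) = 0" if c: "c \<in> A"
    proof (rule ccontr)
      assume "Poly_Mapping.lookup y (c - frag_cmul (int N) w) \<noteq> 0"
      then have b: "c - frag_cmul (int N) w \<in> Poly_Mapping.keys y" by (simp add: in_keys_iff)
      obtain a m where a: "a \<in> Poly_Mapping.keys y" "c = a + frag_cmul m v"
        using c by (auto simp: A_def)
      then have "frag_cmul (int N) w = (a - (c - frag_cmul (int N) w)) + frag_cmul m v"
        by (simp del: minus_frag_cmul)
      then have "N \<in> bad a (c - frag_cmul (int N) w)" unfolding bad_def by blast
      then show False using N a b by blast
    qed
    then show "Poly_Mapping.lookup (restrict_keys A (gmon (frag_cmul (int N) w) * y)) c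
      = Poly_Mapping.lookup 0 c" by (simp add: when_def)
  qed
  have "1 - gmon w dvd 1 - (gmon w ^ N :: lattice \<Rightarrow>\<^sub>0 'k)"
    using one_diff_power_eq[of "gmon w :: lattice \<Rightarrow>\<^sub>0 'k" N] by auto
  then obtain s :: "lattice \<Rightarrow>\<^sub>0 'k" where "1 - gmon w ^ N = (1 - gmon w) * s" by (auto simp: dvd_def)
  have "y - gmon (frag_cmul (int N) w) * y = (1 - gmon w ^ N) * y"
    by (simp add: gmon_multiple left_diff_distrib)
  also have "\<dots> = s * ((1 - gmon w) * y)"
    by (simp only: \<open>1 - gmon w ^ N = (1 - gmon w) * s\<close> mult_ac)
  also have "\<dots> = (1 - gmon v) * (z * s)"
    unfolding eq by (simp only: mult_ac)
  finally have "y - gmon (frag_cmul (int N) w) * y = z * s - gmon v * (z * s)"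
    by (simp add: left_diff_distrib)
  then have "restrict_keys A (y - gmon (frag_cmul (int N) w) * y) = restrict_keys A (z * s - gmon v * (z * s))"
    by simp
  then have "y = restrict_keys A (z * s) - gmon v * restrict_keys A (z * s)"
    by (simp add: restrict_keys_diff y shifted restrict_keys_mon_mult stable)
  then have "y = (1 - gmon v) * restrict_keys A (z * s)" by (simp only: left_diff_distrib mult_1_left)
  then show ?thesis by (rule dvdI)
qed

text \<open>Pairwise coprimality suffices because factors can be moved one at a time:
  \<open>one\<close> treats two binomials by cross multiplication, \<open>inner\<close> one binomial
  against a product, and the outer induction two products. Each induction absorbs a factor into
  \<open>\<kappa>\<close>.\<close>

lemma binomial_denominators:
  fixes \<kappa> :: "(lattice \<Rightarrow>\<^sub>0 'k::field) fract"
  assumes "finite I" "finite J"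
    and "to_fract (\<Prod>i\<in>I. 1 - gmon (v i)) * \<kappa> \<in> range to_fract"
    and "to_fract (\<Prod>j\<in>J. 1 - gmon (w j)) * \<kappa> \<in> range to_fract"
    and v0: "\<And>i. i \<in> I \<Longrightarrow> v i \<noteq> 0"
    and indep: "\<And>i j m n. i \<in> I \<Longrightarrow> j \<in> J \<Longrightarrow> frag_cmul n (w j) = frag_cmul m (v i) \<Longrightarrow> n = 0"
  shows "\<kappa> \<in> range to_fract"
proof -
  have one: "\<kappa> \<in> range to_fract"
    if v: "to_fract (1 - gmon v) * \<kappa> \<in> range to_fract" and w: "to_fract (1 - gmon w) * \<kappa> \<in> range to_fract"
      and v0: "v \<noteq> 0" and indep: "\<And>m n. frag_cmul n w = frag_cmul m v \<Longrightarrow> n = 0"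
    for v w and \<kappa> :: "(lattice \<Rightarrow>\<^sub>0 'k) fract"
  proof -
    obtain y where y: "to_fract (1 - gmon v) * \<kappa> = to_fract y" using v by blast
    obtain z where z: "to_fract (1 - gmon w) * \<kappa> = to_fract z" using w by blast
    have "to_fract ((1 - gmon w) * y) = to_fract ((1 - gmon v) * z)"
      unfolding to_fract_mult y[symmetric] z[symmetric] by (simp only: mult_ac)
    then have "(1 - gmon w) * y = (1 - gmon v) * z" by (simp only: to_fract_eq_iff)
    then obtain s where s: "y = (1 - gmon v) * s"
      using binomial_dvd_cancel[of w y v z] indep unfolding dvd_def by blast
    have "(1 - gmon v :: lattice \<Rightarrow>\<^sub>0 'k) \<noteq> 0"
      using v0 gmon_eq_iff[of 0 v, where 'k = 'k] by simp
    then have "to_fract (1 - gmon v :: lattice \<Rightarrow>\<^sub>0 'k) \<noteq> 0" by (simp only: to_fract_eq_0_iff not_False_eq_True)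
    moreover have "to_fract (1 - gmon v) * \<kappa> = to_fract (1 - gmon v) * to_fract s"
      unfolding y s to_fract_mult ..
    ultimately show ?thesis by simp
  qed
  have inner: "\<kappa> \<in> range to_fract"
    if "finite J" "to_fract (1 - gmon v) * \<kappa> \<in> range to_fract"
      and "to_fract (\<Prod>j\<in>J. 1 - gmon (w j)) * \<kappa> \<in> range to_fract"
      and v0: "v \<noteq> 0" and "\<And>j m n. j \<in> J \<Longrightarrow> frag_cmul n (w j) = frag_cmul m v \<Longrightarrow> n = 0"
    for v J and \<kappa> :: "(lattice \<Rightarrow>\<^sub>0 'k) fract"
    using that
  proof (induction J arbitrary: \<kappa> rule: finite_induct)
    case empty
    then show ?case by simp
  next
    case (insert j J)
    have "to_fract (1 - gmon (w j)) * \<kappa> \<in> range to_fract"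
    proof (rule insert.IH)
      obtain y where y: "to_fract (1 - gmon v) * \<kappa> = to_fract y" using insert.prems by blast
      have "to_fract (1 - gmon v) * (to_fract (1 - gmon (w j)) * \<kappa>) = to_fract ((1 - gmon (w j)) * y)"
        unfolding to_fract_mult y[symmetric] by (simp only: mult_ac)
      then show "to_fract (1 - gmon v) * (to_fract (1 - gmon (w j)) * \<kappa>) \<in> range to_fract"
        by (simp only: rangeI)
      show "to_fract (\<Prod>j\<in>J. 1 - gmon (w j)) * (to_fract (1 - gmon (w j)) * \<kappa>) \<in> range to_fract"
        using insert.prems(2) unfolding prod.insert[OF insert.hyps(1,2)] by (simp only: to_fract_mult mult_ac)
    qed (use insert.prems in auto)
    then show ?case using insert.prems by (intro one[of v \<kappa> "w j"]) auto
  qed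
  show ?thesis
    using assms
  proof (induction I arbitrary: \<kappa> rule: finite_induct)
    case empty
    then show ?case by simp
  next
    case (insert i I)
    have "to_fract (1 - gmon (v i)) * \<kappa> \<in> range to_fract"
    proof (rule insert.IH)
      obtain y where y: "to_fract (\<Prod>j\<in>J. 1 - gmon (w j)) * \<kappa> = to_fract y" using insert.prems by blast
      have "to_fract (\<Prod>j\<in>J. 1 - gmon (w j)) * (to_fract (1 - gmon (v i)) * \<kappa>) = to_fract ((1 - gmon (v i)) * y)"
        unfolding to_fract_mult y[symmetric] by (simp only: mult_ac)
      then show "to_fract (\<Prod>j\<in>J. 1 - gmon (w j)) * (to_fract (1 - gmon (v i)) * \<kappa>) \<in> range to_fract"
        by (simp only: rangeI)
      show "to_fract (\<Prod>i\<in>I. 1 - gmon (v i)) * (to_fract (1 - gmon (v i)) * \<kappa>) \<in> range to_fract"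
        using insert.prems(2) unfolding prod.insert[OF insert.hyps(1,2)] by (simp only: to_fract_mult mult_ac)
    qed (use insert.prems(1,4,5) in blast)+
    then show ?case
      by (intro inner[of J "v i" \<kappa>]) (use insert.prems in blast)+
  qed
qed

section \<open>The kernel of the reduction modulo a subgroup\<close>

definition augmentation :: "('v \<Rightarrow>\<^sub>0 'k::field) \<Rightarrow> 'k"
  where "augmentation = pm_eval (\<lambda>c. c) (\<lambda>_. 1)"

lemma augmentation_hom: "total_hom (augmentation :: ('v::ab_group_add \<Rightarrow>\<^sub>0 'k::field) \<Rightarrow> 'k)"
  unfolding augmentation_def by (intro pm_eval_hom total_homI) auto

lemma augmentation_mon [simp]: "augmentation (gmon a) = 1"
  by (simp add: augmentation_def gmon_def pm_eval_def)

locale lattice_subgroup =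
  fixes B :: "'v::ab_group_add set" and type_k :: "'k::field itself"
  assumes zero_B: "0 \<in> B" and add_B: "a \<in> B \<Longrightarrow> b \<in> B \<Longrightarrow> a + b \<in> B"
    and uminus_B: "a \<in> B \<Longrightarrow> - a \<in> B"
begin

text \<open>The coefficient at the coset of \<open>a\<close> of the image in the group algebra of
  the quotient by \<open>B\<close>. Testing all these sums describes the kernel of the reduction
  without forming the quotient.\<close>

definition coset_sum :: "'v \<Rightarrow> ('v \<Rightarrow>\<^sub>0 'k) \<Rightarrow> 'k"
  where "coset_sum a = pm_eval (\<lambda>c. c) (\<lambda>x. of_bool (x - a \<in> B))"

definition ker :: "('v \<Rightarrow>\<^sub>0 'k) set"
  where "ker = {f. \<forall>a. coset_sum a f = 0}"

lemma id_hom: "total_hom (\<lambda>c::'k. c)"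
  by (rule total_homI) auto

lemma coset_sum_add: "coset_sum a (f + h) = coset_sum a f + coset_sum a h"
  by (simp add: coset_sum_def pm_eval_add[OF id_hom])

lemma coset_sum_single: "coset_sum a (Poly_Mapping.single x c) = c * of_bool (x - a \<in> B)"
  by (simp add: coset_sum_def pm_eval_single[OF id_hom])

text \<open>Multiplication by a monomial permutes the cosets, which is what makes \<open>ker\<close>
  an ideal.\<close>

lemma coset_sum_shift: "coset_sum a (Poly_Mapping.single v c * f) = c * coset_sum (a - v) f"
proof -
  have "Poly_Mapping.single v c * f
      = (\<Sum>x\<in>Poly_Mapping.keys f. Poly_Mapping.single (v + x) (c * Poly_Mapping.lookup f x))"
    by (subst (1) pm_expand[of f]) (simp add: sum_distrib_left mult_single)
  then have "coset_sum a (Poly_Mapping.single v c * f)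
      = (\<Sum>x\<in>Poly_Mapping.keys f. c * Poly_Mapping.lookup f x * of_bool (v + x - a \<in> B))"
    by (simp add: coset_sum_def pm_eval_sum[OF id_hom] pm_eval_single[OF id_hom])
  also have "\<dots> = c * coset_sum (a - v) f"
    unfolding coset_sum_def pm_eval_def sum_distrib_left
    by (rule sum.cong[OF refl]) (simp add: mult.assoc diff_diff_eq2 add.commute)
  finally show ?thesis .
qed

lemma ker_zero: "0 \<in> ker"
  by (simp add: ker_def coset_sum_def pm_eval_def)

lemma ker_add: "f \<in> ker \<Longrightarrow> h \<in> ker \<Longrightarrow> f + h \<in> ker"
  by (simp add: ker_def coset_sum_add)

lemma ker_sum: "(\<And>i. i \<in> I \<Longrightarrow> f i \<in> ker) \<Longrightarrow> sum f I \<in> ker"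
  by (induction I rule: infinite_finite_induct) (auto simp: ker_zero ker_add)

lemma ker_mult: "f \<in> ker \<Longrightarrow> s * f \<in> ker"
proof -
  assume f: "f \<in> ker"
  have "(\<Sum>x\<in>Poly_Mapping.keys s. Poly_Mapping.single x (Poly_Mapping.lookup s x) * f) \<in> ker"
    by (rule ker_sum) (use f in \<open>simp add: ker_def coset_sum_shift\<close>)
  then show "s * f \<in> ker"
    unfolding sum_distrib_right[symmetric] pm_expand[symmetric] .
qed

lemma ker_mult': "f \<in> ker \<Longrightarrow> f * s \<in> ker"
  using ker_mult[of f s] by (simp add: mult.commute)

lemma ker_uminus: "f \<in> ker \<Longrightarrow> - f \<in> ker"
  using ker_mult[of f "- 1"] by simp

lemma ker_diff: "f \<in> ker \<Longrightarrow> h \<in> ker \<Longrightarrow> f - h \<in> ker"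
  using ker_add[of f "- h"] ker_uminus[of h] by simp

lemma gmon_diff_mem_ker: "gmon a - gmon b \<in> ker \<longleftrightarrow> a - b \<in> B"
proof
  have eq: "coset_sum c (gmon a - gmon b) = of_bool (a - c \<in> B) - of_bool (b - c \<in> B)" for c
  proof -
    have "gmon a - gmon b = Poly_Mapping.single a 1 + Poly_Mapping.single b (- 1 :: 'k)"
      by (simp add: gmon_def single_uminus)
    then show ?thesis by (simp only: coset_sum_add coset_sum_single) simp
  qed
  show "a - b \<in> B" if "gmon a - gmon b \<in> ker"
  proof (rule ccontr)
    assume "a - b \<notin> B"
    then have "coset_sum b (gmon a - gmon b) = - 1"
      using zero_B by (simp add: eq)
    then show False using that by (simp add: ker_def)
  qed
  show "gmon a - gmon b \<in> ker" if "a - b \<in> B"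
  proof -
    have "a - c \<in> B \<longleftrightarrow> b - c \<in> B" for c
    proof
      assume "a - c \<in> B"
      then have "(a - c) + - (a - b) \<in> B" using that by (intro add_B uminus_B)
      then show "b - c \<in> B" by simp
    next
      assume "b - c \<in> B"
      then have "(a - b) + (b - c) \<in> B" using that by (intro add_B)
      then show "a - c \<in> B" by simp
    qed
    then show ?thesis by (simp add: ker_def eq)
  qed
qed

text \<open>The sum of all coefficients is the sum of the coset sums, taken over one representative
  of each coset that meets the support.\<close>

lemma augmentation_ker:
  assumes "f \<in> ker"
  shows "augmentation f = 0"
proof -
  \<comment> \<open>The choice predicate depends only on the coset of \<open>x\<close>, so
    \<open>rep\<close> is constant on cosets.\<close>
  define rep where "rep x = (SOME y. y - x \<in> B)" for x
  have "rep x - x \<in> B" for x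
    unfolding rep_def by (rule someI[of _ x]) (simp add: zero_B)
  moreover have "rep x = rep y" if "x - y \<in> B" for x y
  proof -
    have "z - x \<in> B \<longleftrightarrow> z - y \<in> B" for z
      using add_B[OF _ that, of "z - x"] add_B[OF _ uminus_B[OF that], of "z - y"] by auto
    then show ?thesis by (simp add: rep_def)
  qed
  ultimately have rep: "rep x = r \<longleftrightarrow> x - r \<in> B" if "r \<in> range rep" for x r
    using that uminus_B by (metis add_B diff_add_cancel minus_diff_eq rangeE add_diff_eq)
  have "augmentation f = (\<Sum>x\<in>Poly_Mapping.keys f. Poly_Mapping.lookup f x)"
    by (simp add: augmentation_def pm_eval_def)
  also have "\<dots> = (\<Sum>r\<in>rep ` Poly_Mapping.keys f. \<Sum>x | x \<in> Poly_Mapping.keys f \<and> rep x = r. Poly_Mapping.lookup f x)"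
    by (rule sum.image_gen) simp
  also have "\<dots> = (\<Sum>r\<in>rep ` Poly_Mapping.keys f. coset_sum r f)"
  proof (rule sum.cong[OF refl])
    fix r assume "r \<in> rep ` Poly_Mapping.keys f"
    then have r: "r \<in> range rep" by blast
    have "coset_sum r f = (\<Sum>x\<in>Poly_Mapping.keys f. if rep x = r then Poly_Mapping.lookup f x else 0)"
      unfolding coset_sum_def pm_eval_def rep[OF r] by (rule sum.cong) auto
    then show "(\<Sum>x | x \<in> Poly_Mapping.keys f \<and> rep x = r. Poly_Mapping.lookup f x) = coset_sum r f"
      by (simp add: sum.If_cases Int_def)
  qed
  also have "\<dots> = 0" using assms by (simp add: ker_def)
  finally show ?thesis .
qed

end

context
  fixes s :: "'a::ab_group_add \<Rightarrow> 'b::ab_group_add"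
  assumes add: "\<And>a b. s (a + b) = s a + s b"
begin

lemma additive_zero: "s 0 = 0"
  using add[of 0 0] by simp

lemma additive_uminus: "s (- a) = - s a"
  using add[of a "- a"] additive_zero by (simp add: eq_neg_iff_add_eq_0 add.commute)

lemma additive_diff: "s (a - c) = s a - s c"
  using add[of a "- c"] additive_uminus by simp

end

lemma additive_frag_cmul:
  fixes s :: "lattice \<Rightarrow> lattice"
  assumes "\<And>a b. s (a + b) = s a + s b"
  shows "s (frag_cmul n a) = frag_cmul n (s a)"
proof -
  have nat: "s (frag_cmul (int m) a) = frag_cmul (int m) (s a)" for m
    by (induction m) (simp_all only: frag_cmul_Suc assms, simp_all add: additive_zero[of s] assms)
  show ?thesis
  proof (cases "n \<ge> 0")
    case True
    then show ?thesis using nat[of "nat n"] by simp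
  next
    case False
    then have "frag_cmul n x = - frag_cmul (int (nat (- n))) x" for x :: lattice by simp
    then show ?thesis using nat[of "nat (- n)"] assms by (simp only: additive_uminus)
  qed
qed

lemma map_poly_pderiv:
  fixes h :: "'a::idom \<Rightarrow> 'b::idom"
  assumes "total_hom h"
  shows "map_poly h (pderiv P) = pderiv (map_poly h P)"
proof -
  interpret total_hom h by (rule assms)
  have "h (of_nat n) = of_nat n" for n
    by (induction n) (auto simp: hom_zero hom_one hom_add)
  then show ?thesis
    by (intro poly_eqI) (simp add: coeff_map_poly hom_zero coeff_pderiv hom_mult hom_add hom_one)
qed

lemma prod_linear_dvd:
  fixes P :: "'a::idom poly"
  assumes "finite I" "inj_on x I" "\<And>i. i \<in> I \<Longrightarrow> poly P (x i) = 0"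
  shows "(\<Prod>i\<in>I. [:- x i, 1:]) dvd P"
  using assms
proof (induction I arbitrary: P rule: finite_induct)
  case (insert i I)
  obtain Q where Q: "P = [:- x i, 1:] * Q"
    using insert.prems(2)[of i] by (auto simp: poly_eq_0_iff_dvd dvd_def)
  have "poly Q (x j) = 0" if "j \<in> I" for j
  proof -
    have "x j \<noteq> x i" using insert.prems(1) insert.hyps that by (auto simp: inj_on_def)
    then show ?thesis using insert.prems(2)[of j] that by (simp add: Q)
  qed
  then have "(\<Prod>i\<in>I. [:- x i, 1:]) dvd Q" using insert.prems by (intro insert.IH) auto
  then show ?case using insert.hyps Q by (simp add: mult_dvd_mono del: mult_pCons_left)
qed simp

section \<open>Actions that are fixed point free modulo the invariants\<close>

text \<open>The group \<open>A\<close> is the image of the projection \<open>pr\<close>. The action is extended, trivially on the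
  complement, to the whole type \<open>lattice\<close>: this type is a linearly ordered group, which makes the
  group algebra an integral domain by type class.\<close>

locale lattice_action =
  fixes Gs :: "(lattice \<Rightarrow> lattice) set" and pr :: "lattice \<Rightarrow> lattice" and type_k :: "'k::field itself"
  assumes finite_Gs: "finite Gs" and id_Gs: "id \<in> Gs"
    and Gs_add: "g \<in> Gs \<Longrightarrow> g (a + b) = g a + g b"
    and Gs_comp: "g \<in> Gs \<Longrightarrow> h \<in> Gs \<Longrightarrow> g \<circ> h \<in> Gs"
    and Gs_inv: "g \<in> Gs \<Longrightarrow> \<exists>h\<in>Gs. h \<circ> g = id \<and> g \<circ> h = id"
    and pr_add: "pr (a + b) = pr a + pr b" and pr_pr: "pr (pr a) = pr a"
    and Gs_pr: "g \<in> Gs \<Longrightarrow> g (pr a) = pr (g a)"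
    and Gs_compl: "g \<in> Gs \<Longrightarrow> g (a - pr a) = a - pr a"
begin

definition Fix :: "lattice set"
  where "Fix = {a. \<forall>g\<in>Gs. g a = a}"

abbreviation act :: "(lattice \<Rightarrow> lattice) \<Rightarrow> (lattice \<Rightarrow>\<^sub>0 'k) \<Rightarrow> (lattice \<Rightarrow>\<^sub>0 'k)"
  where "act \<equiv> linear_extension"

text \<open>This is the group algebra of A inside that of the whole lattice: \<open>pr\<close> is
  idempotent, so the elements fixed by \<open>act pr\<close> are those with support in its
  image.\<close>

definition SL :: "(lattice \<Rightarrow>\<^sub>0 'k) set"
  where "SL = {s. act pr s = s}"

definition R :: "(lattice \<Rightarrow>\<^sub>0 'k) set"
  where "R = {r. act pr r = r \<and> (\<forall>g\<in>Gs. act g r = r)}"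

lemma Gs_zero: "g \<in> Gs \<Longrightarrow> g 0 = 0"
  by (rule additive_zero) (rule Gs_add)

lemma Gs_uminus: "g \<in> Gs \<Longrightarrow> g (- a) = - g a"
  by (rule additive_uminus) (rule Gs_add)

lemma Gs_diff: "g \<in> Gs \<Longrightarrow> g (a - b) = g a - g b"
  by (rule additive_diff) (rule Gs_add)

lemma Gs_cmul: "g \<in> Gs \<Longrightarrow> g (frag_cmul n a) = frag_cmul n (g a)"
  by (rule additive_frag_cmul) (rule Gs_add)

lemma Gs_bij: "g \<in> Gs \<Longrightarrow> bij g"
  using Gs_inv[of g] by (auto intro: o_bij)

lemma Gs_inj: "g \<in> Gs \<Longrightarrow> inj g"
  using Gs_bij by (rule bij_is_inj)

lemma Fix_zero: "0 \<in> Fix"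
  by (simp add: Fix_def Gs_zero)

lemma Fix_add: "a \<in> Fix \<Longrightarrow> b \<in> Fix \<Longrightarrow> a + b \<in> Fix"
  by (auto simp: Fix_def Gs_add)

lemma Fix_uminus: "a \<in> Fix \<Longrightarrow> - a \<in> Fix"
  by (auto simp: Fix_def Gs_uminus)

lemma Fix_diff: "a \<in> Fix \<Longrightarrow> b \<in> Fix \<Longrightarrow> a - b \<in> Fix"
  by (auto simp: Fix_def Gs_diff)

text \<open>Coordinates are integers, so a nonzero factor cancels; the quotient by
  \<open>Fix\<close> is torsion free.\<close>

lemma Fix_cmul: "n \<noteq> 0 \<Longrightarrow> frag_cmul n a \<in> Fix \<longleftrightarrow> a \<in> Fix"
proof -
  assume n: "n \<noteq> 0"
  have "frag_cmul n (g a) = frag_cmul n a \<longleftrightarrow> g a = a" for g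
    using n by (auto simp: poly_mapping_eq_iff fun_eq_iff)
  then show ?thesis by (simp add: Fix_def Gs_cmul)
qed

lemma pr_diff_Fix: "a - pr a \<in> Fix"
  by (simp add: Fix_def Gs_compl)

lemma Fix_pr: "pr a \<in> Fix \<longleftrightarrow> a \<in> Fix"
  using Fix_add[OF pr_diff_Fix[of a], of "pr a"] Fix_diff[OF _ pr_diff_Fix[of a], of a] by auto

lemma Gs_comp_bij: "g \<in> Gs \<Longrightarrow> bij_betw (\<lambda>h. g \<circ> h) Gs Gs"
proof -
  assume g: "g \<in> Gs"
  then obtain k where k: "k \<in> Gs" "k \<circ> g = id" "g \<circ> k = id" using Gs_inv by blast
  show ?thesis
    by (rule bij_betw_byWitness[where f' = "\<lambda>h. k \<circ> h"])
       (use k g Gs_comp in \<open>auto simp: o_assoc\<close>)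
qed

lemma act_hom: "g \<in> insert pr Gs \<Longrightarrow> total_hom (act g)"
  by (rule linear_extension_hom) (auto simp: Gs_add pr_add)

text \<open>With the identity as homomorphism the locale says that \<open>R\<close> is a subring,
  and supplies the closure lemmas.\<close>

lemma R_subring: "subring_hom R (\<lambda>x. x)"
proof -
  interpret pr: total_hom "act pr" by (rule act_hom) simp
  have *: "total_hom (act g)" if "g \<in> Gs" for g using act_hom that by simp
  show ?thesis
    by unfold_locales
      (auto simp: R_def pr.hom_one pr.hom_add pr.hom_mult pr.hom_uminus
        subring_hom.hom_one[OF total_hom.axioms[OF *]] subring_hom.hom_add[OF total_hom.axioms[OF *]]
        subring_hom.hom_mult[OF total_hom.axioms[OF *]] subring_hom.hom_uminus[OF total_hom.axioms[OF *]])
qed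

lemma SL_subring: "subring_hom SL (\<lambda>x. x)"
proof -
  interpret pr: total_hom "act pr" by (rule act_hom) simp
  show ?thesis
    by unfold_locales (auto simp: SL_def pr.hom_one pr.hom_add pr.hom_mult pr.hom_uminus)
qed

lemma R_SL: "r \<in> R \<Longrightarrow> r \<in> SL"
  by (simp add: R_def SL_def)

lemma keys_R:
  assumes r: "r \<in> R" and that: "x \<in> Poly_Mapping.keys r"
  shows "pr x = x"
proof -
  have "act pr r = r" using r by (simp add: R_def)
  then have "Poly_Mapping.lookup (act pr r) x \<noteq> 0" using that by (simp only: in_keys_iff not_False_eq_True)
  moreover have "Poly_Mapping.lookup (act pr r) x = 0" if "\<forall>a\<in>Poly_Mapping.keys r. pr a \<noteq> x"
    unfolding linear_extension_def lookup_sum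
    by (rule sum.neutral) (use that in \<open>auto simp: lookup_single when_def\<close>)
  ultimately have "\<exists>a\<in>Poly_Mapping.keys r. pr a = x" by blast
  then obtain a where "pr a = x" by blast
  then show ?thesis using pr_pr[of a] by simp
qed

lemma cst_R: "cst c \<in> R"
  by (auto simp: R_def cst_def Gs_zero additive_zero[of pr] pr_add)

lemma gmon_SL: "pr b = b \<Longrightarrow> gmon b \<in> SL"
  by (simp add: SL_def)

lemma polys_R_iff:
  "(\<forall>i. poly.coeff P i \<in> R) \<longleftrightarrow> (\<forall>g\<in>insert pr Gs. map_poly (act g) P = P)"
proof -
  have "act g 0 = 0" for g by (simp add: linear_extension_def)
  then have "map_poly (act g) P = P \<longleftrightarrow> (\<forall>i. act g (poly.coeff P i) = poly.coeff P i)" for g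
    by (simp add: poly_eq_iff coeff_map_poly)
  then show ?thesis by (auto simp: R_def)
qed

text \<open>The product runs over the group and not over the orbit, so the degree is always the
  group order. Under fixed point freeness, elements outside \<open>Fix\<close> have trivial
  stabilizer and then the roots are distinct.\<close>

definition orbit_poly :: "lattice \<Rightarrow> (lattice \<Rightarrow>\<^sub>0 'k) poly"
  where "orbit_poly b = (\<Prod>h\<in>Gs. [:- gmon (h b), 1:])"

text \<open>Dividing the value of \<open>interpolant a s\<close> at \<open>gmon a\<close> by that of \<open>interpolant a 1\<close>,
  the derivative of \<open>orbit_poly a\<close>, gives \<open>s\<close>. All coefficients are invariant, so this expresses \<open>s\<close> through
  invariants and the single element \<open>gmon a\<close>.\<close>

definition interpolant :: "lattice \<Rightarrow> (lattice \<Rightarrow>\<^sub>0 'k) \<Rightarrow> (lattice \<Rightarrow>\<^sub>0 'k) poly"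
  where "interpolant a s = (\<Sum>h\<in>Gs. Polynomial.smult (act h s) (\<Prod>h'\<in>Gs - {h}. [:- gmon (h' a), 1:]))"

lemma act_comp: "act g (act h s) = act (g \<circ> h) s"
  by (simp add: linear_extension_comp o_def)

lemma map_poly_linear: "g \<in> insert pr Gs \<Longrightarrow> map_poly (act g) [:- gmon b, 1:] = [:- gmon (g b), 1:]"
proof -
  assume "g \<in> insert pr Gs"
  then interpret total_hom "act g" by (rule act_hom)
  show ?thesis by (simp add: map_poly_pCons hom_zero hom_one hom_uminus)
qed

lemma orbit_poly_coeffs:
  assumes "pr b = b"
  shows "\<forall>i. poly.coeff (orbit_poly b) i \<in> R"
  unfolding polys_R_iff
proof
  fix g assume g: "g \<in> insert pr Gs"
  interpret total_hom "map_poly (act g)" by (rule total_hom.map_poly_hom[OF act_hom[OF g]])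
  have *: "map_poly (act g) (orbit_poly b) = (\<Prod>h\<in>Gs. [:- gmon (g (h b)), 1:])"
    unfolding orbit_poly_def by (simp add: hom_prod map_poly_linear[OF g])
  show "map_poly (act g) (orbit_poly b) = orbit_poly b"
  proof (cases "g = pr")
    case True
    then show ?thesis unfolding * by (simp add: orbit_poly_def Gs_pr[symmetric] assms)
  next
    case False
    then have "g \<in> Gs" using g by simp
    then show ?thesis unfolding * unfolding orbit_poly_def
      by (intro prod.reindex_bij_betw[OF Gs_comp_bij, of g "\<lambda>h. [:- gmon (h b), 1:]", unfolded o_apply])
  qed
qed

text \<open>Acting by a group element \<open>g\<close> sends the summand of \<open>h\<close> to that
  of \<open>g \<circ> h\<close>; \<open>pr\<close> fixes each summand because it commutes with the
  group.\<close>

lemma interpolant_coeffs: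
  assumes "pr a = a" "s \<in> SL"
  shows "\<forall>i. poly.coeff (interpolant a s) i \<in> R"
  unfolding polys_R_iff
proof
  fix g assume g: "g \<in> insert pr Gs"
  interpret g: total_hom "act g" by (rule act_hom[OF g])
  interpret total_hom "map_poly (act g)" by (rule total_hom.map_poly_hom[OF act_hom[OF g]])
  have sm: "map_poly (act g) (Polynomial.smult c P) = Polynomial.smult (act g c) (map_poly (act g) P)" for c P
    by (rule g.map_poly_smult) (auto simp: g.polys_def)
  have *: "map_poly (act g) (interpolant a s)
     = (\<Sum>h\<in>Gs. Polynomial.smult (act (g \<circ> h) s) (\<Prod>h'\<in>Gs - {h}. [:- gmon (g (h' a)), 1:]))"
    unfolding interpolant_def by (simp add: hom_sum sm hom_prod map_poly_linear[OF g] act_comp)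
  show "map_poly (act g) (interpolant a s) = interpolant a s"
  proof (cases "g = pr")
    case True
    have "act (pr \<circ> h) s = act h s" if "h \<in> Gs" for h
    proof -
      have "pr \<circ> h = h \<circ> pr" using Gs_pr[OF that] by auto
      then show ?thesis using assms by (simp add: act_comp[symmetric] SL_def)
    qed
    moreover have "pr (h a) = h a" if "h \<in> Gs" for h
      using Gs_pr[OF that, of a] assms by simp
    ultimately show ?thesis unfolding * unfolding interpolant_def using True
      by (intro sum.cong refl arg_cong2[where f = Polynomial.smult] prod.cong) auto
  next
    case False
    then have gG: "g \<in> Gs" using g by simp
    have "(\<Prod>h'\<in>Gs - {h}. [:- gmon (g (h' a)), 1:])
        = (\<Prod>h'\<in>Gs - {g \<circ> h}. [:- gmon (h' a), 1:] :: (lattice \<Rightarrow>\<^sub>0 'k) poly)"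
      if "h \<in> Gs" for h
    proof -
      have "bij_betw (\<lambda>h. g \<circ> h) (Gs - {h}) (Gs - {g \<circ> h})"
        using bij_betw_DiffI[OF Gs_comp_bij[OF gG], of "{h}" "{g \<circ> h}"] that Gs_comp[OF gG that]
        by (simp add: bij_betw_def)
      from prod.reindex_bij_betw[OF this, of "\<lambda>h. [:- gmon (h a), 1:]"] show ?thesis by simp
    qed
    then have "map_poly (act g) (interpolant a s)
       = (\<Sum>h\<in>Gs. Polynomial.smult (act (g \<circ> h) s) (\<Prod>h'\<in>Gs - {g \<circ> h}. [:- gmon (h' a), 1:]))"
      unfolding * by (intro sum.cong) auto
    also have "\<dots> = interpolant a s" unfolding interpolant_def
      by (rule sum.reindex_bij_betw[OF Gs_comp_bij[OF gG]])
    finally show ?thesis .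
  qed
qed

text \<open>Lagrange interpolation: every summand but that of \<open>g\<close> contains the factor
  that vanishes at \<open>gmon (g a)\<close>.\<close>

lemma poly_interpolant:
  assumes "g \<in> Gs"
  shows "poly (interpolant a s) (gmon (g a)) = act g s * (\<Prod>h\<in>Gs - {g}. gmon (g a) - gmon (h a))"
proof -
  have "poly (interpolant a s) (gmon (g a))
    = (\<Sum>h\<in>Gs. act h s * (\<Prod>h'\<in>Gs - {h}. gmon (g a) - gmon (h' a)))"
    by (simp add: interpolant_def poly_sum poly_prod algebra_simps)
  also have "\<dots> = (\<Sum>h\<in>Gs. if h = g then act g s * (\<Prod>h\<in>Gs - {g}. gmon (g a) - gmon (h a)) else 0)"
  proof (intro sum.cong refl)
    fix h assume "h \<in> Gs"
    show "act h s * (\<Prod>h'\<in>Gs - {h}. gmon (g a) - gmon (h' a))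
      = (if h = g then act g s * (\<Prod>h\<in>Gs - {g}. gmon (g a) - gmon (h a)) else 0)"
    proof (cases "h = g")
      case False
      then have "(\<Prod>h'\<in>Gs - {h}. gmon (g a) - (gmon (h' a) :: lattice \<Rightarrow>\<^sub>0 'k)) = 0"
        using assms finite_Gs by (intro prod_zero) auto
      then show ?thesis using False by simp
    qed simp
  qed
  finally show ?thesis using assms finite_Gs by simp
qed

lemma interpolant_add: "interpolant a (s + t) = interpolant a s + interpolant a t"
proof -
  have "act h (s + t) = act h s + act h t" if "h \<in> Gs" for h
    using subring_hom.hom_add[OF total_hom.axioms[OF act_hom]] that by simp
  then show ?thesis by (simp add: interpolant_def smult_add_left sum.distrib)
qed

lemma interpolant_one: "interpolant a 1 = pderiv (orbit_poly a)"
proof -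
  have "act h 1 = 1" if "h \<in> Gs" for h
    using subring_hom.hom_one[OF total_hom.axioms[OF act_hom]] that by simp
  then show ?thesis by (simp add: interpolant_def orbit_poly_def pderiv_prod pderiv_pCons)
qed

lemma interpolant_R: "r \<in> R \<Longrightarrow> interpolant a r = Polynomial.smult r (interpolant a 1)"
proof -
  assume "r \<in> R"
  moreover have "act h 1 = 1" if "h \<in> Gs" for h
    using subring_hom.hom_one[OF total_hom.axioms[OF act_hom]] that by simp
  moreover have "Polynomial.smult r (sum F A) = (\<Sum>x\<in>A. Polynomial.smult r (F x))"
    for F :: "(lattice \<Rightarrow> lattice) \<Rightarrow> (lattice \<Rightarrow>\<^sub>0 'k) poly" and A
    by (induction A rule: infinite_finite_induct) (auto simp: smult_add_right)
  ultimately show ?thesis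
    by (simp add: interpolant_def R_def)
qed

lemma orbit_poly_root: "poly (orbit_poly b) (gmon b) = 0"
  unfolding orbit_poly_def poly_prod
  by (rule prod_zero) (use id_Gs finite_Gs in \<open>auto intro!: bexI[of _ id]\<close>)

lemma orbit_poly_Gs: "g \<in> Gs \<Longrightarrow> orbit_poly (g b) = orbit_poly b"
proof -
  assume g: "g \<in> Gs"
  have "bij_betw (\<lambda>h. h \<circ> g) Gs Gs"
  proof -
    obtain k where k: "k \<in> Gs" "k \<circ> g = id" "g \<circ> k = id" using Gs_inv g by blast
    show ?thesis
      by (rule bij_betw_byWitness[where f' = "\<lambda>h. h \<circ> k"])
         (use k g Gs_comp in \<open>auto simp: o_assoc[symmetric]\<close>)
  qed
  from prod.reindex_bij_betw[OF this, of "\<lambda>h. [:- gmon (h b), 1 :: lattice \<Rightarrow>\<^sub>0 'k:]"]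
  show ?thesis by (simp add: orbit_poly_def)
qed

lemma pderiv_orbit_poly:
  "poly (pderiv (orbit_poly b)) (gmon b) = (\<Prod>h\<in>Gs - {id}. gmon b - gmon (h b))"
proof -
  have "act id 1 = 1"
    using subring_hom.hom_one[OF total_hom.axioms[OF act_hom]] id_Gs by simp
  then show ?thesis
    using poly_interpolant[OF id_Gs, of b 1] by (simp add: interpolant_one)
qed

end

text \<open>\<open>indep\<close> expresses that the quotient by \<open>Fix\<close> has rank at least
  two. It is vacuous when everything is fixed, a case that \<open>nontrivial\<close>
  excludes.\<close>

locale fpf_action = lattice_action +
  assumes fpf: "g \<in> Gs \<Longrightarrow> g \<noteq> id \<Longrightarrow> g a - a \<in> Fix \<Longrightarrow> a \<in> Fix"
    and indep: "b \<notin> Fix \<Longrightarrow> \<exists>c. pr c = c \<and> (\<forall>m n. frag_cmul m c + frag_cmul n b \<in> Fix \<longrightarrow> m = 0 \<and> n = 0)"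
    and nontrivial: "\<exists>b. b \<notin> Fix"
begin

lemma Gs_distinct: "b \<notin> Fix \<Longrightarrow> inj_on (\<lambda>h. h b) Gs"
proof (rule inj_onI)
  fix g h assume b: "b \<notin> Fix" and gh: "g \<in> Gs" "h \<in> Gs" "g b = h b"
  obtain k where k: "k \<in> Gs" "k \<circ> h = id" "h \<circ> k = id" using Gs_inv gh by blast
  then have "(k \<circ> g) b = b" using gh by (metis comp_apply id_apply)
  then have "(k \<circ> g) b - b \<in> Fix" by (simp add: Fix_zero)
  then have "k \<circ> g = id" using fpf[OF Gs_comp[OF k(1) gh(1)]] b by blast
  then have "h \<circ> (k \<circ> g) = h" by simp
  then show "g = h" using k by (simp add: o_assoc)
qed

lemma orbit_poly_dvd:
  assumes "a \<notin> Fix" "\<And>h. h \<in> Gs \<Longrightarrow> poly P (gmon (h a)) = 0"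
  shows "orbit_poly a dvd P"
  unfolding orbit_poly_def
  by (rule prod_linear_dvd) (use assms finite_Gs Gs_distinct in \<open>auto simp: inj_on_def\<close>)

lemma pderiv_orbit_poly_neq_0: "b \<notin> Fix \<Longrightarrow> poly (pderiv (orbit_poly b)) (gmon b) \<noteq> 0"
  using Gs_distinct[of b] id_Gs finite_Gs
  by (force simp: pderiv_orbit_poly inj_on_def)

text \<open>The differences of \<open>c\<close> and of \<open>b + c\<close> under the group must
  avoid the directions \<open>h b - b\<close>. Along a suitable line of candidates each pair of
  group elements excludes at most one candidate, so all but finitely many work.\<close>

lemma generic_translate:
  assumes b: "b \<notin> Fix" "pr b = b"
  shows "\<exists>c. pr c = c \<and> c \<notin> Fix \<and> b + c \<notin> Fix \<and>
    (\<forall>g\<in>Gs - {id}. \<forall>h\<in>Gs - {id}. \<forall>m n.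
      (frag_cmul n (g c - c) = frag_cmul m (h b - b) \<longrightarrow> n = 0) \<and>
      (frag_cmul n (g (b + c) - (b + c)) = frag_cmul m (h b - b) \<longrightarrow> n = 0))"
proof -
  obtain e where e: "pr e = e" and ind: "\<And>m n. frag_cmul m e + frag_cmul n b \<in> Fix \<Longrightarrow> m = 0 \<and> n = 0"
    using indep[OF b(1)] by blast
  \<comment> \<open>The line has direction \<open>b\<close>, so \<open>b + c i\<close> is the next
    candidate and one finiteness argument serves both requirements.\<close>
  define c where "c i = e + frag_cmul (int i) b" for i
  have c_Fix: "c i \<notin> Fix" for i
    using ind[of 1 "int i"] by (auto simp: c_def)
  have c_pr: "pr (c i) = c i" for i
    using e b by (simp add: c_def pr_add additive_frag_cmul[of pr])
  define bad where "bad g h = {i. \<exists>n m. n \<noteq> 0 \<and> frag_cmul n (g (c i) - c i) = frag_cmul m (h b - b)}" for g h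
  have bad_unique: "i = j" if g: "g \<in> Gs - {id}" and i: "i \<in> bad g h" and j: "j \<in> bad g h" for g h i j
  proof -
    from g have gG: "g \<in> Gs" "g \<noteq> id" by auto
    obtain n m where 1: "n \<noteq> 0" "frag_cmul n (g (c i) - c i) = frag_cmul m (h b - b)"
      using i by (auto simp: bad_def)
    obtain n' m' where 2: "n' \<noteq> 0" "frag_cmul n' (g (c j) - c j) = frag_cmul m' (h b - b)"
      using j by (auto simp: bad_def)
    have diff_swap: "(p - q) - (r - s) = (p - r) - (q - s)" for p q r s :: lattice
      by (simp add: algebra_simps)
    \<comment> \<open>In this combination the two multiples of \<open>h b - b\<close> cancel, so
      \<open>g\<close> fixes \<open>x\<close>. Hence \<open>x\<close> lies in \<open>Fix\<close>,
      and independence of \<open>e\<close> and \<open>b\<close> makes both of its coefficients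
      zero.\<close>
    define x where "x = frag_cmul (m' * n) (c i) - frag_cmul (m * n') (c j)"
    have D: "g (frag_cmul k a) - frag_cmul k a = frag_cmul k (g a - a)" for k a
      by (rule poly_mapping_eqI) (simp add: Gs_cmul[OF gG(1)] lookup_minus algebra_simps)
    have "g x - x = frag_cmul (m' * n) (g (c i) - c i) - frag_cmul (m * n') (g (c j) - c j)"
      unfolding D[symmetric] x_def Gs_diff[OF gG(1)] by (rule diff_swap)
    also have "\<dots> = frag_cmul m' (frag_cmul n (g (c i) - c i)) - frag_cmul m (frag_cmul n' (g (c j) - c j))"
      by (simp only: frag_cmul_cmul)
    also have "\<dots> = 0" unfolding 1(2) 2(2) frag_cmul_cmul by (simp only: mult.commute[of m'] diff_self)
    finally have "g x - x \<in> Fix" using Fix_zero by (simp only:)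
    then have "x \<in> Fix" by (rule fpf[OF gG])
    moreover have "x = frag_cmul (m' * n - m * n') e + frag_cmul (m' * n * int i - m * n' * int j) b"
      by (rule poly_mapping_eqI) (simp add: x_def c_def lookup_minus lookup_add algebra_simps)
    ultimately have zero: "m' * n - m * n' = 0 \<and> m' * n * int i - m * n' * int j = 0"
      by (intro ind) (simp only:)
    then have "m' * n = m * n'" by linarith
    then have "m' * n * int i = m' * n * int j" using zero by (metis eq_iff_diff_eq_0)
    \<comment> \<open>Otherwise \<open>g\<close> would fix a nonzero multiple of \<open>c j\<close>,
      which would put \<open>c j\<close> into \<open>Fix\<close>.\<close>
    moreover have "m' \<noteq> 0"
    proof
      assume "m' = 0"
      then have "g (frag_cmul n' (c j)) - frag_cmul n' (c j) \<in> Fix"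
        using 2 unfolding D by (simp add: Fix_zero)
      then have "frag_cmul n' (c j) \<in> Fix" using fpf gG by blast
      then show False using c_Fix Fix_cmul 2 by blast
    qed
    ultimately show ?thesis using 1 by simp
  qed
  have "finite (bad g h)" if "g \<in> Gs - {id}" for g h
  proof (cases "bad g h = {}")
    case False
    then obtain i where "i \<in> bad g h" by blast
    then have "bad g h \<subseteq> {i}" using bad_unique[OF that] by blast
    then show ?thesis by (rule finite_subset) simp
  qed simp
  then have "finite (\<Union>g\<in>Gs - {id}. \<Union>h\<in>Gs - {id}. bad g h)"
    using finite_Gs by auto
  then obtain N where N: "\<forall>i\<in>(\<Union>g\<in>Gs - {id}. \<Union>h\<in>Gs - {id}. bad g h). i < N"
    using finite_nat_set_iff_bounded by blast
  have good: "n = 0" if "i \<ge> N" "g \<in> Gs - {id}" "h \<in> Gs - {id}" "frag_cmul n (g (c i) - c i) = frag_cmul m (h b - b)"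
    for i g h n m
  proof (rule ccontr)
    assume "n \<noteq> 0"
    then have "i \<in> bad g h" using that unfolding bad_def by blast
    then show False using N that by fastforce
  qed
  have "b + c N = c (Suc N)"
    unfolding c_def frag_cmul_Suc by (simp add: ac_simps)
  then show ?thesis
    using c_Fix c_pr good[of N] good[of "Suc N"] by (intro exI[of _ "c N"]) auto
qed

end

section \<open>Lifting a homomorphism from the invariants to the group algebra\<close>

lemma fps_nth_0_hom: "total_hom (\<lambda>F :: 'a::comm_ring_1 fps. fps_nth F 0)"
  by (rule total_homI) auto

lemma fps_const_hom: "total_hom (fps_const :: 'a::comm_ring_1 \<Rightarrow> 'a fps)"
  by (rule total_homI) auto

lemma to_fract_hom: "total_hom (to_fract :: 'a::idom \<Rightarrow> 'a fract)"
  by (rule total_homI) auto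

lemma poly_pderiv_nth_0:
  fixes P :: "'a::idom fps poly"
  shows "fps_nth (poly (pderiv P) x) 0 = poly (pderiv (map_poly (\<lambda>F. fps_nth F 0) P)) (fps_nth x 0)"
  using subring_hom.hom_poly[OF total_hom.axioms[OF fps_nth_0_hom], of "pderiv P" x]
  by (simp add: map_poly_pderiv[OF fps_nth_0_hom] subring_hom.polys_def[OF total_hom.axioms[OF fps_nth_0_hom]])

lemma poly_nth_0:
  fixes P :: "'a::idom fps poly"
  shows "fps_nth (poly P x) 0 = poly (map_poly (\<lambda>F. fps_nth F 0) P) (fps_nth x 0)"
  using subring_hom.hom_poly[OF total_hom.axioms[OF fps_nth_0_hom], of P x]
  by (simp add: subring_hom.polys_def[OF total_hom.axioms[OF fps_nth_0_hom]])

lemma (in total_hom) poly_hom: "h (poly P x) = poly (map_poly h P) (h x)"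
  by (rule hom_poly) (auto simp: polys_def)

text \<open>A ring homomorphism \<open>\<Phi>\<close> on the invariants that is the identity modulo the power series variable
  lifts to the whole group algebra, by Hensel's lemma at first with denominators. The denominators are
  products of binomials \<open>1 - gmon v\<close>, and those arising from two generic lattice points are coprime.\<close>

locale lift_action = fpf_action Gs pr type_k + subring_hom "lattice_action.R Gs pr" \<Phi>
  for Gs pr and type_k :: "'k::field itself"
    and \<Phi> :: "(lattice \<Rightarrow>\<^sub>0 'k) \<Rightarrow> (lattice \<Rightarrow>\<^sub>0 'k) fps" +
  assumes \<Phi>_0: "r \<in> R \<Longrightarrow> fps_nth (\<Phi> r) 0 = r"
    and \<Phi>_act: "r \<in> R \<Longrightarrow> g \<in> Gs \<Longrightarrow> act g (fps_nth (\<Phi> r) i) = fps_nth (\<Phi> r) i"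
    and \<Phi>_Fix: "c \<in> Fix \<Longrightarrow> pr c = c \<Longrightarrow> \<Phi> (gmon c) = fps_const (gmon c)"
    and \<Phi>_cst: "\<Phi> (cst x) = fps_const (cst x)"
begin

abbreviation \<iota> :: "(lattice \<Rightarrow>\<^sub>0 'k) fps \<Rightarrow> (lattice \<Rightarrow>\<^sub>0 'k) fract fps"
  where "\<iota> \<equiv> fps_map to_fract"

lemma \<iota>_hom: "total_hom \<iota>"
  by (rule total_hom.fps_map_hom[OF to_fract_hom])

lemma \<iota>_inj: "\<iota> F = \<iota> G \<longleftrightarrow> F = G"
  by (auto simp: fps_eq_iff)

lemma R_polys: "(\<forall>i. poly.coeff P i \<in> R) \<longleftrightarrow> P \<in> polys"
  by (simp add: polys_def)

lemma orbit_poly_polys: "pr b = b \<Longrightarrow> orbit_poly b \<in> polys"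
  using orbit_poly_coeffs by (simp add: R_polys)

lemma interpolant_polys: "pr a = a \<Longrightarrow> s \<in> SL \<Longrightarrow> interpolant a s \<in> polys"
  using interpolant_coeffs by (simp add: R_polys)

lemma Fix_R: "c \<in> Fix \<Longrightarrow> pr c = c \<Longrightarrow> gmon c \<in> R"
  by (simp add: R_def Fix_def)

definition \<Phi>K :: "(lattice \<Rightarrow>\<^sub>0 'k) \<Rightarrow> (lattice \<Rightarrow>\<^sub>0 'k) fract fps"
  where "\<Phi>K r = \<iota> (\<Phi> r)"

lemma \<Phi>K_subring_hom: "subring_hom R \<Phi>K"
proof -
  interpret \<iota>: total_hom \<iota> by (rule \<iota>_hom)
  show ?thesis
    by unfold_locales
      (auto simp: one_mem add_mem mult_mem uminus_mem \<Phi>K_def hom_one hom_add hom_mult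
        \<iota>.hom_one \<iota>.hom_add \<iota>.hom_mult)
qed

sublocale K: subring_hom R \<Phi>K
  by (rule \<Phi>K_subring_hom)

lemma \<Phi>K_0: "r \<in> R \<Longrightarrow> fps_nth (\<Phi>K r) 0 = to_fract r"
  by (simp add: \<Phi>K_def \<Phi>_0)

lemma map_poly_\<Phi>_0: "P \<in> polys \<Longrightarrow> map_poly (\<lambda>F. fps_nth F 0) (map_poly \<Phi> P) = P"
  by (rule poly_eqI) (simp add: coeff_map_poly hom_zero \<Phi>_0 coeff_mem)

lemma map_poly_\<Phi>K_0: "P \<in> polys \<Longrightarrow> map_poly (\<lambda>F. fps_nth F 0) (map_poly \<Phi>K P) = map_poly to_fract P"
  by (rule poly_eqI) (simp add: coeff_map_poly K.hom_zero \<Phi>K_0 coeff_mem)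

lemma poly_\<Phi>K_0:
  assumes "P \<in> polys" "fps_nth x 0 = to_fract y"
  shows "fps_nth (poly (map_poly \<Phi>K P) x) 0 = to_fract (poly P y)"
    and "fps_nth (poly (pderiv (map_poly \<Phi>K P)) x) 0 = to_fract (poly (pderiv P) y)"
proof -
  show "fps_nth (poly (map_poly \<Phi>K P) x) 0 = to_fract (poly P y)"
    using assms by (simp add: poly_nth_0 map_poly_\<Phi>K_0 total_hom.poly_hom[OF to_fract_hom])
  show "fps_nth (poly (pderiv (map_poly \<Phi>K P)) x) 0 = to_fract (poly (pderiv P) y)"
    using assms by (simp add: poly_pderiv_nth_0 map_poly_\<Phi>K_0 total_hom.poly_hom[OF to_fract_hom]
        map_poly_pderiv[OF to_fract_hom])
qed

definition base :: lattice
  where "base = (SOME a. pr a = a \<and> a \<notin> Fix)"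

lemma base: "pr base = base" "base \<notin> Fix"
proof -
  obtain b where "b \<notin> Fix" using nontrivial by blast
  then have "pr (pr b) = pr b \<and> pr b \<notin> Fix" by (simp add: pr_pr Fix_pr)
  then show "pr base = base" "base \<notin> Fix"
    using someI[of "\<lambda>a. pr a = a \<and> a \<notin> Fix"] unfolding base_def by blast+
qed

text \<open>The image of \<open>gmon base\<close> under a lift has to be this root. The derivative
  of the orbit polynomial at \<open>gmon base\<close> is nonzero but in general no unit of the group
  algebra, so Hensel's lemma is applied over the fraction field.\<close>

definition \<alpha> :: "(lattice \<Rightarrow>\<^sub>0 'k) fract fps"
  where "\<alpha> = (SOME x. poly (map_poly \<Phi>K (orbit_poly base)) x = 0 \<and> fps_nth x 0 = to_fract (gmon base))"

lemma \<alpha>: "poly (map_poly \<Phi>K (orbit_poly base)) \<alpha> = 0" "fps_nth \<alpha> 0 = to_fract (gmon base)"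
proof -
  have "\<exists>x. poly (map_poly \<Phi>K (orbit_poly base)) x = 0 \<and> fps_nth x 0 = to_fract (gmon base)"
    using poly_\<Phi>K_0[OF orbit_poly_polys[OF base(1)], of "fps_const (to_fract (gmon base))" "gmon base"]
      pderiv_orbit_poly_neq_0[OF base(2)]
    by (intro fps_root_exists) (simp_all add: orbit_poly_root)
  from someI_ex[OF this]
  show "poly (map_poly \<Phi>K (orbit_poly base)) \<alpha> = 0" "fps_nth \<alpha> 0 = to_fract (gmon base)"
    unfolding \<alpha>_def by blast+
qed

definition numer :: "(lattice \<Rightarrow>\<^sub>0 'k) \<Rightarrow> (lattice \<Rightarrow>\<^sub>0 'k) fract fps"
  where "numer s = poly (map_poly \<Phi>K (interpolant base s)) \<alpha>"

text \<open>Forced by the interpolation formula: its coefficients are moved by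
  \<open>\<Phi>K\<close>, and \<open>gmon base\<close> is replaced by the root
  \<open>\<alpha>\<close>. The constant term of \<open>numer 1\<close> is nonzero, so the inverse is
  a genuine one.\<close>

definition \<Psi> :: "(lattice \<Rightarrow>\<^sub>0 'k) \<Rightarrow> (lattice \<Rightarrow>\<^sub>0 'k) fract fps"
  where "\<Psi> s = numer s * inverse (numer 1)"

lemma one_SL: "1 \<in> SL"
  using subring_hom.one_mem[OF SL_subring] .

lemma act_id [simp]: "act id s = s"
  by (simp add: id_def)

lemma numer_0: "s \<in> SL \<Longrightarrow> fps_nth (numer s) 0 = to_fract s * fps_nth (numer 1) 0"
proof -
  have *: "fps_nth (numer s) 0 = to_fract (s * (\<Prod>h\<in>Gs - {id}. gmon base - gmon (h base)))" if "s \<in> SL" for s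
    unfolding numer_def
    using poly_\<Phi>K_0(1)[OF interpolant_polys[OF base(1) that] \<alpha>(2)] poly_interpolant[OF id_Gs, of base s] by simp
  assume "s \<in> SL"
  then show ?thesis using *[of s] *[OF one_SL] by simp
qed

lemma numer_1_neq_0: "fps_nth (numer 1) 0 \<noteq> 0"
  unfolding numer_def
  using poly_\<Phi>K_0(1)[OF interpolant_polys[OF base(1) one_SL] \<alpha>(2)] pderiv_orbit_poly_neq_0[OF base(2)]
  by (simp add: interpolant_one)

lemma numer_1_inverse: "numer 1 * inverse (numer 1) = 1"
  using inverse_mult_eq_1[OF numer_1_neq_0] by (simp add: mult.commute)

lemma \<Psi>_0: "s \<in> SL \<Longrightarrow> fps_nth (\<Psi> s) 0 = to_fract s"
  using numer_1_neq_0 by (simp add: \<Psi>_def numer_0)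

lemma \<Psi>_R: "r \<in> R \<Longrightarrow> \<Psi> r = \<Phi>K r"
proof -
  assume r: "r \<in> R"
  have "map_poly \<Phi>K (Polynomial.smult r (interpolant base 1)) = Polynomial.smult (\<Phi>K r) (map_poly \<Phi>K (interpolant base 1))"
    using interpolant_polys[OF base(1) one_SL] r by (intro K.map_poly_smult) auto
  then have "numer r = \<Phi>K r * numer 1" by (simp add: numer_def interpolant_R[OF r])
  then show ?thesis by (simp add: \<Psi>_def mult.assoc numer_1_inverse)
qed

lemma \<Psi>_add: "s \<in> SL \<Longrightarrow> t \<in> SL \<Longrightarrow> \<Psi> (s + t) = \<Psi> s + \<Psi> t"
  using interpolant_polys[OF base(1)]
  by (simp add: \<Psi>_def numer_def interpolant_add K.map_poly_add distrib_right)

text \<open>The group and \<open>pr\<close> fix \<open>P\<close> and \<open>orbit_poly a\<close>;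
  cancelling the latter shows that they fix the quotient.\<close>

lemma quotient_polys:
  assumes "P \<in> polys" "P = orbit_poly a * Q" "pr a = a"
  shows "Q \<in> polys"
proof -
  have "map_poly (act g) Q = Q" if g: "g \<in> insert pr Gs" for g
  proof -
    interpret m: total_hom "map_poly (act g)" by (rule total_hom.map_poly_hom[OF act_hom[OF g]])
    have fixed: "map_poly (act g) P' = P'" if "P' \<in> polys" for P'
      using that polys_R_iff[of P'] R_polys[of P'] g by blast
    have "orbit_poly a * map_poly (act g) Q = map_poly (act g) (orbit_poly a) * map_poly (act g) Q"
      by (simp only: fixed[OF orbit_poly_polys[OF assms(3)]])
    also have "\<dots> = map_poly (act g) P" unfolding assms(2) by (rule m.hom_mult[OF UNIV_I UNIV_I, symmetric])
    also have "\<dots> = orbit_poly a * Q" using fixed[OF assms(1)] assms(2) by metis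
    finally have "orbit_poly a * map_poly (act g) Q = orbit_poly a * Q" .
    moreover have "orbit_poly a \<noteq> 0" using finite_Gs by (simp add: orbit_poly_def)
    ultimately show ?thesis by simp
  qed
  then show ?thesis using polys_R_iff[of Q] R_polys[of Q] by blast
qed

text \<open>The difference of the two products of interpolants vanishes at all conjugates of
  \<open>gmon base\<close>, so it is a multiple of \<open>orbit_poly base\<close> with a quotient
  over \<open>R\<close>. Moving coefficients by \<open>\<Phi>K\<close> keeps this factorization, and
  the orbit polynomial then vanishes at \<open>\<alpha>\<close>.\<close>

lemma numer_mult: "s \<in> SL \<Longrightarrow> t \<in> SL \<Longrightarrow> numer s * numer t = numer 1 * numer (s * t)"
proof -
  assume s: "s \<in> SL" and t: "t \<in> SL"
  have st: "s * t \<in> SL" using s t subring_hom.mult_mem[OF SL_subring] by blast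
  note pol = interpolant_polys[OF base(1)]
  define P where "P = interpolant base s * interpolant base t - interpolant base 1 * interpolant base (s * t)"
  have P: "P \<in> polys" unfolding P_def by (intro polys_diff polys_mult pol s t st one_SL)
  have "poly P (gmon (g base)) = 0" if g: "g \<in> Gs" for g
  proof -
    have "total_hom (act g)" using act_hom g by simp
    then have "act g (s * t) = act g s * act g t" "act g 1 = 1"
      using subring_hom.hom_mult[OF total_hom.axioms] subring_hom.hom_one[OF total_hom.axioms] by blast+
    then show ?thesis
      by (simp add: P_def poly_interpolant[OF g] mult_ac)
  qed
  then obtain Q where Q: "P = orbit_poly base * Q"
    using orbit_poly_dvd[OF base(2)] by (auto simp: dvd_def)
  have "Q \<in> polys" by (rule quotient_polys[OF P Q base(1)])
  then have "map_poly \<Phi>K P = map_poly \<Phi>K (orbit_poly base) * map_poly \<Phi>K Q"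
    unfolding Q using orbit_poly_polys[OF base(1)] by (intro K.map_poly_mult) auto
  then have "poly (map_poly \<Phi>K P) \<alpha> = 0" by (simp add: \<alpha>)
  moreover have "map_poly \<Phi>K P = map_poly \<Phi>K (interpolant base s) * map_poly \<Phi>K (interpolant base t)
      - map_poly \<Phi>K (interpolant base 1) * map_poly \<Phi>K (interpolant base (s * t))"
    unfolding P_def using pol[OF s] pol[OF t] pol[OF one_SL] pol[OF st]
    by (simp add: K.map_poly_diff K.map_poly_mult polys_mult)
  ultimately show ?thesis by (simp add: numer_def)
qed

lemma \<Psi>_mult: "s \<in> SL \<Longrightarrow> t \<in> SL \<Longrightarrow> \<Psi> (s * t) = \<Psi> s * \<Psi> t"
proof -
  assume "s \<in> SL" "t \<in> SL"
  then have eq: "numer s * numer t = numer 1 * numer (s * t)" by (rule numer_mult)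
  have "\<Psi> s * \<Psi> t = (numer s * numer t) * inverse (numer 1) * inverse (numer 1)"
    by (simp add: \<Psi>_def mult_ac)
  also have "\<dots> = (numer 1 * inverse (numer 1)) * (numer (s * t) * inverse (numer 1))"
    unfolding eq by (simp only: mult_ac)
  finally show ?thesis by (simp only: numer_1_inverse mult_1_left \<Psi>_def)
qed

sublocale \<Psi>: subring_hom SL \<Psi>
proof (unfold_locales)
  show "\<Psi> 1 = 1" using \<Psi>_R[OF one_mem] by (simp add: K.hom_one)
qed (use SL_subring in \<open>auto simp: subring_hom_def \<Psi>_add \<Psi>_mult\<close>)

lemma \<Psi>_root:
  assumes "pr b = b"
  shows "poly (map_poly \<Phi>K (orbit_poly b)) (\<Psi> (gmon b)) = 0"
proof -
  have coeffs: "poly.coeff (orbit_poly b) i \<in> R" for i using orbit_poly_coeffs[OF assms] by blast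
  then have "orbit_poly b \<in> \<Psi>.polys" using R_SL by (simp add: \<Psi>.polys_def)
  then have "\<Psi> (poly (orbit_poly b) (gmon b)) = poly (map_poly \<Psi> (orbit_poly b)) (\<Psi> (gmon b))"
    by (rule \<Psi>.hom_poly) (rule gmon_SL[OF assms])
  moreover have "map_poly \<Psi> (orbit_poly b) = map_poly \<Phi>K (orbit_poly b)"
    by (rule poly_eqI) (simp add: coeff_map_poly \<Psi>.hom_zero K.hom_zero \<Psi>_R coeffs)
  ultimately show ?thesis by (simp add: orbit_poly_root \<Psi>.hom_zero)
qed

lemma \<Psi>_Fix: "b \<in> Fix \<Longrightarrow> pr b = b \<Longrightarrow> \<Psi> (gmon b) = \<iota> (fps_const (gmon b))"
  using \<Psi>_R[OF Fix_R] \<Phi>_Fix by (simp add: \<Phi>K_def)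

lemma fps_integral_iff: "F \<in> range \<iota> \<longleftrightarrow> (\<forall>i. fps_nth F i \<in> range to_fract)"
proof
  assume F: "\<forall>i. fps_nth F i \<in> range to_fract"
  define G where "G = Abs_fps (\<lambda>i. inv_into UNIV to_fract (fps_nth F i))"
  have "F = \<iota> G"
    by (rule fps_ext) (simp add: G_def f_inv_into_f[OF spec[OF F]])
  then show "F \<in> range \<iota>" by (rule range_eqI)
next
  assume "F \<in> range \<iota>"
  then obtain G where G: "F = \<iota> G" by (rule rangeE)
  show "\<forall>i. fps_nth F i \<in> range to_fract" unfolding G fps_map_nth by (intro allI rangeI)
qed

lemma fract_ring: "subring_hom (range (to_fract :: (lattice \<Rightarrow>\<^sub>0 'k) \<Rightarrow> _)) (\<lambda>x. x)"
proof unfold_locales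
  fix x y :: "(lattice \<Rightarrow>\<^sub>0 'k) fract"
  assume "x \<in> range to_fract" "y \<in> range to_fract"
  then obtain a b where ab: "x = to_fract a" "y = to_fract b" by blast
  have "x + y = to_fract (a + b)" "x * y = to_fract (a * b)"
    unfolding ab by simp_all
  then show "x + y \<in> range to_fract" "x * y \<in> range to_fract"
    by (simp_all only: rangeI)
next
  fix x :: "(lattice \<Rightarrow>\<^sub>0 'k) fract"
  assume "x \<in> range to_fract"
  then obtain a where "x = to_fract a" by blast
  then have "- x = to_fract (- a)" by simp
  then show "- x \<in> range to_fract" by (simp only: rangeI)
next
  show "1 \<in> range (to_fract :: (lattice \<Rightarrow>\<^sub>0 'k) \<Rightarrow> _)" using rangeI[of to_fract 1] by simp
qed (rule refl | assumption)+

text \<open>In the degree \<open>i\<close> part of the equation satisfied by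
  \<open>\<Psi> (gmon b)\<close>, the coefficient of index \<open>i\<close> occurs only multiplied
  by the derivative of the orbit polynomial at \<open>gmon b\<close>. All other contributions come
  from lower coefficients, which are integral.\<close>

lemma derivative_denominator:
  assumes b: "pr b = b" and i: "i > 0" and low: "\<And>j. j < i \<Longrightarrow> fps_nth (\<Psi> (gmon b)) j \<in> range to_fract"
  shows "to_fract (\<Prod>h\<in>Gs - {id}. 1 - gmon (h b - b)) * fps_nth (\<Psi> (gmon b)) i \<in> range to_fract"
proof -
  interpret \<iota>: total_hom \<iota> by (rule \<iota>_hom)
  let ?x = "\<Psi> (gmon b)" and ?P = "map_poly \<Phi>K (orbit_poly b)"
  \<comment> \<open>The root truncated below degree \<open>i\<close>: it is integral by hypothesis
    and differs from the root only from degree \<open>i\<close> on.\<close>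
  define y where "y = Abs_fps (\<lambda>j. if j < i then fps_nth ?x j else 0)"
  have "y \<in> range \<iota>"
    unfolding fps_integral_iff y_def using low by (auto intro!: range_eqI[of 0 to_fract 0])
  then obtain y' where y': "y = \<iota> y'" by blast
  have P: "?P = map_poly \<iota> (map_poly \<Phi> (orbit_poly b))"
    by (rule poly_eqI) (simp add: coeff_map_poly K.hom_zero hom_zero \<iota>.hom_zero \<Phi>K_def)
  have "poly ?P y = \<iota> (poly (map_poly \<Phi> (orbit_poly b)) y')"
    unfolding P y' by (rule \<iota>.poly_hom[symmetric])
  then have Py: "fps_nth (poly ?P y) i = to_fract (fps_nth (poly (map_poly \<Phi> (orbit_poly b)) y') i)"
    by simp
  have y0: "fps_nth y 0 = to_fract (gmon b)"
    using i \<Psi>_0[OF gmon_SL[OF b]] by (simp add: y_def)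
  have "fps_nth (poly ?P (y + (?x - y))) i
      = fps_nth (poly ?P y) i + fps_nth (poly (pderiv ?P) y) 0 * fps_nth (?x - y) i"
    by (rule poly_perturb_nth(1)[OF i]) (simp add: y_def)
  then have "0 = fps_nth (poly ?P y) i + to_fract (poly (pderiv (orbit_poly b)) (gmon b)) * fps_nth ?x i"
    using \<Psi>_root[OF b] poly_\<Phi>K_0(2)[OF orbit_poly_polys[OF b] y0] by (simp add: y_def)
  then have eq: "to_fract (poly (pderiv (orbit_poly b)) (gmon b)) * fps_nth ?x i
      = to_fract (- fps_nth (poly (map_poly \<Phi> (orbit_poly b)) y') i)"
    unfolding Py by (simp add: eq_neg_iff_add_eq_0 add.commute)
  \<comment> \<open>Up to a power of the unit \<open>gmon b\<close>, the derivative is the product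
    of binomials.\<close>
  have "gmon b - gmon (h b) = gmon b * (1 - (gmon (h b - b) :: lattice \<Rightarrow>\<^sub>0 'k))" for h :: "lattice \<Rightarrow> lattice"
    by (simp add: right_diff_distrib gmon_add[symmetric])
  then have "poly (pderiv (orbit_poly b)) (gmon b)
      = gmon b ^ card (Gs - {id}) * (\<Prod>h\<in>Gs - {id}. 1 - gmon (h b - b))"
    by (simp add: pderiv_orbit_poly prod.distrib)
  moreover have "gmon (- b) ^ n * gmon b ^ n = (1 :: lattice \<Rightarrow>\<^sub>0 'k)" for n
    by (simp add: power_mult_distrib[symmetric] gmon_add[symmetric])
  ultimately have "(\<Prod>h\<in>Gs - {id}. 1 - gmon (h b - b))
      = gmon (- b) ^ card (Gs - {id}) * poly (pderiv (orbit_poly b)) (gmon b)"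
    by (simp add: mult.assoc[symmetric])
  then have "to_fract (\<Prod>h\<in>Gs - {id}. 1 - gmon (h b - b)) * fps_nth ?x i
      = to_fract (gmon (- b) ^ card (Gs - {id}) * - fps_nth (poly (map_poly \<Phi> (orbit_poly b)) y') i)"
    unfolding to_fract_mult eq[symmetric] by (simp only: to_fract_mult mult.assoc)
  then show ?thesis by (metis rangeI)
qed

lemma \<Psi>_mon_add: "pr b = b \<Longrightarrow> pr c = c \<Longrightarrow> \<Psi> (gmon (b + c)) = \<Psi> (gmon b) * \<Psi> (gmon c)"
  by (simp add: gmon_add \<Psi>.hom_mult gmon_SL)

text \<open>The induction on \<open>i\<close> treats all \<open>b\<close> at once. The coefficient
  for \<open>b\<close> has the binomials of \<open>b\<close> as denominator; the relation with the
  coefficients for \<open>c\<close> and \<open>b + c\<close> also gives it the binomials of those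
  two. For generic \<open>c\<close> these denominators are coprime.\<close>

lemma \<Psi>_integral_nth:
  "pr b = b \<Longrightarrow> fps_nth (\<Psi> (gmon b)) i \<in> range to_fract"
proof (induction i arbitrary: b rule: less_induct)
  case (less i)
  interpret S: subring_hom "range (to_fract :: (lattice \<Rightarrow>\<^sub>0 'k) \<Rightarrow> _)" "\<lambda>x. x"
    by (rule fract_ring)
  show ?case
  proof (cases "b \<in> Fix \<or> i = 0")
    case True
    then show ?thesis using \<Psi>_Fix[of b] \<Psi>_0[OF gmon_SL[of b]] less.prems by auto
  next
    case False
    then have b: "b \<notin> Fix" "pr b = b" and i: "i > 0" using less.prems by auto
    obtain c where c: "pr c = c" "c \<notin> Fix" "b + c \<notin> Fix"
      and gen: "\<forall>g\<in>Gs - {id}. \<forall>h\<in>Gs - {id}. \<forall>m n.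
      (frag_cmul n (g c - c) = frag_cmul m (h b - b) \<longrightarrow> n = 0) \<and>
      (frag_cmul n (g (b + c) - (b + c)) = frag_cmul m (h b - b) \<longrightarrow> n = 0)"
      using generic_translate[OF b] by blast
    have bc: "pr (b + c) = b + c" using b c by (simp add: pr_add)
    define t where "t a = to_fract (\<Prod>h\<in>Gs - {id}. 1 - (gmon (h a - a) :: lattice \<Rightarrow>\<^sub>0 'k))" for a
    define \<kappa> where "\<kappa> a = fps_nth (\<Psi> (gmon a)) i" for a
    have den: "t a * \<kappa> a \<in> range to_fract" if "pr a = a" for a
      unfolding t_def \<kappa>_def by (rule derivative_denominator[OF that i less.IH[OF _ that]])
    have t: "t a \<in> range to_fract" for a by (simp add: t_def)
    define low where "low = (\<Sum>j=1..<i. fps_nth (\<Psi> (gmon b)) j * fps_nth (\<Psi> (gmon c)) (i - j))"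
    have low: "low \<in> range to_fract"
      unfolding low_def by (intro S.sum_mem S.mult_mem less.IH) (use b c in auto)
    have "{0..i} = insert 0 (insert i {1..<i})" using i by auto
    then have split: "\<kappa> (b + c) = to_fract (gmon b) * \<kappa> c + \<kappa> b * to_fract (gmon c) + low"
      using i \<Psi>_0[OF gmon_SL[OF b(2)]] \<Psi>_0[OF gmon_SL[OF c(1)]]
      by (simp add: \<kappa>_def \<Psi>_mon_add b c fps_mult_nth low_def)
    \<comment> \<open>Solving the Cauchy product formula for \<open>\<kappa> b\<close>, with
      \<open>gmon (- c)\<close> inverting \<open>gmon c\<close>.\<close>
    have "t c * t (b + c) * \<kappa> b
      = to_fract (gmon (- c)) * (t c * (t (b + c) * \<kappa> (b + c)) - to_fract (gmon b) * t (b + c) * (t c * \<kappa> c) - t c * t (b + c) * low)"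
    proof -
      have "to_fract (gmon (- c)) * to_fract (gmon c) = to_fract (1 :: lattice \<Rightarrow>\<^sub>0 'k)"
        unfolding to_fract_mult[symmetric] by (simp add: mult.commute)
      then have inv: "to_fract (gmon (- c)) * (to_fract (gmon c) * z) = (z :: (lattice \<Rightarrow>\<^sub>0 'k) fract)" for z
        by (simp add: mult.assoc[symmetric])
      have "t c * (t (b + c) * \<kappa> (b + c)) - to_fract (gmon b) * t (b + c) * (t c * \<kappa> c) - t c * t (b + c) * low
        = to_fract (gmon c) * (t c * t (b + c) * \<kappa> b)"
        unfolding split by (simp add: algebra_simps)
      then show ?thesis by (simp only: inv)
    qed
    also have "\<dots> \<in> range to_fract"
      by (intro S.mult_mem S.diff_mem den t low c bc) auto
    finally have 2: "t c * t (b + c) * \<kappa> b \<in> range to_fract" .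
    \<comment> \<open>The Boolean tag tells the exponents of \<open>c\<close> from those of
      \<open>b + c\<close>, so that both products of binomials become one product over a single
      index set.\<close>
    define w where "w x = (if fst x then snd x c - c else snd x (b + c) - (b + c))" for x
    have "(\<Prod>x\<in>{True,False} \<times> (Gs - {id}). 1 - (gmon (w x) :: lattice \<Rightarrow>\<^sub>0 'k))
        = (\<Prod>h\<in>Gs - {id}. 1 - gmon (w (True, h))) * (\<Prod>h\<in>Gs - {id}. 1 - gmon (w (False, h)))"
      using prod.cartesian_product[of "\<lambda>x h. 1 - (gmon (w (x, h)) :: lattice \<Rightarrow>\<^sub>0 'k)" "Gs - {id}" "{True, False}"]
      by (simp add: case_prod_unfold)
    then have "t c * t (b + c) = to_fract (\<Prod>x\<in>{True,False} \<times> (Gs - {id}). 1 - gmon (w x))"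
      by (simp add: t_def w_def)
    then have "to_fract (\<Prod>x\<in>{True,False} \<times> (Gs - {id}). 1 - gmon (w x)) * \<kappa> b \<in> range to_fract"
      using 2 by simp
    moreover have "to_fract (\<Prod>h\<in>Gs - {id}. 1 - gmon (h b - b)) * \<kappa> b \<in> range to_fract"
      using den[OF b(2)] by (simp only: t_def)
    moreover have "h b - b \<noteq> 0" if "h \<in> Gs - {id}" for h
      using fpf[of h b] Fix_zero that b by force
    moreover have "n = 0" if "h \<in> Gs - {id}" "x \<in> {True,False} \<times> (Gs - {id})"
      "frag_cmul n (w x) = frag_cmul m (h b - b)" for h x n m
      using that gen by (auto simp: w_def split: if_splits)
    ultimately have "\<kappa> b \<in> range to_fract"
      using finite_Gs
      by (intro binomial_denominators[of "Gs - {id}" "{True,False} \<times> (Gs - {id})" "\<lambda>h. h b - b" "\<kappa> b" w]) blast+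
    then show ?thesis by (simp add: \<kappa>_def)
  qed
qed

definition \<psi> :: "lattice \<Rightarrow> (lattice \<Rightarrow>\<^sub>0 'k) fps"
  where "\<psi> b = (SOME F. \<iota> F = \<Psi> (gmon b))"

lemma \<iota>_\<psi>: "pr b = b \<Longrightarrow> \<iota> (\<psi> b) = \<Psi> (gmon b)"
proof -
  assume "pr b = b"
  then have "\<Psi> (gmon b) \<in> range \<iota>" unfolding fps_integral_iff by (simp add: \<Psi>_integral_nth)
  then have "\<exists>F. \<iota> F = \<Psi> (gmon b)" by (metis rangeE)
  then show ?thesis unfolding \<psi>_def by (rule someI_ex)
qed

lemma \<psi>_add: "pr b = b \<Longrightarrow> pr c = c \<Longrightarrow> \<psi> (b + c) = \<psi> b * \<psi> c"
proof -
  interpret \<iota>: total_hom \<iota> by (rule \<iota>_hom)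
  assume "pr b = b" "pr c = c"
  then have "\<iota> (\<psi> (b + c)) = \<iota> (\<psi> b * \<psi> c)"
    by (simp add: \<iota>_\<psi> \<iota>.hom_mult \<Psi>_mon_add pr_add)
  then show ?thesis by (simp only: \<iota>_inj)
qed

lemma \<psi>_0: "pr b = b \<Longrightarrow> fps_nth (\<psi> b) 0 = gmon b"
proof -
  assume "pr b = b"
  then have "fps_nth (\<iota> (\<psi> b)) 0 = to_fract (gmon b)" by (simp only: \<iota>_\<psi> \<Psi>_0 gmon_SL)
  then show ?thesis by simp
qed

lemma \<psi>_Fix: "b \<in> Fix \<Longrightarrow> pr b = b \<Longrightarrow> \<psi> b = fps_const (gmon b)"
  using \<iota>_\<psi>[of b] \<Psi>_Fix[of b] by (simp only: \<iota>_inj)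

lemma \<psi>_root:
  assumes b: "pr b = b"
  shows "poly (map_poly \<Phi> (orbit_poly b)) (\<psi> b) = 0"
proof -
  interpret \<iota>: total_hom \<iota> by (rule \<iota>_hom)
  have P: "map_poly \<Phi>K (orbit_poly b) = map_poly \<iota> (map_poly \<Phi> (orbit_poly b))"
    by (rule poly_eqI) (simp add: coeff_map_poly K.hom_zero hom_zero \<iota>.hom_zero \<Phi>K_def)
  have "\<iota> (poly (map_poly \<Phi> (orbit_poly b)) (\<psi> b)) = \<iota> 0"
    unfolding \<iota>.poly_hom P[symmetric] \<iota>_\<psi>[OF b] by (simp only: \<Psi>_root[OF b] \<iota>.hom_zero)
  then show ?thesis by (simp only: \<iota>_inj)
qed

text \<open>Both sides are roots with the same constant term of one polynomial, since
  \<open>\<Phi>\<close> takes invariants to series with invariant coefficients. Outside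
  \<open>Fix\<close> the root is simple, so they agree; on \<open>Fix\<close> both sides are
  constant series.\<close>

lemma \<psi>_act:
  assumes g: "g \<in> Gs" and b: "pr b = b"
  shows "\<psi> (g b) = fps_map (act g) (\<psi> b)"
proof (cases "b \<in> Fix")
  case True
  then have "g b = b" using g unfolding Fix_def by blast
  moreover have "fps_map (act g) (fps_const (gmon b)) = fps_const (gmon b :: lattice \<Rightarrow>\<^sub>0 'k)"
    using \<open>g b = b\<close> by (intro fps_ext) (auto simp: linear_extension_def[of g 0])
  ultimately show ?thesis using \<psi>_Fix[OF True b] by simp
next
  case False
  interpret h: total_hom "fps_map (act g)" by (intro total_hom.fps_map_hom act_hom) (use g in simp)
  let ?P = "map_poly \<Phi> (orbit_poly b)"
  have gb: "pr (g b) = g b" using Gs_pr[OF g, of b] b by simp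
  have coeffs: "poly.coeff (orbit_poly b) i \<in> R" for i using orbit_poly_coeffs[OF b] by blast
  have "map_poly (fps_map (act g)) ?P = ?P"
    by (rule poly_eqI)
       (auto simp: coeff_map_poly hom_zero h.hom_zero fps_eq_iff \<Phi>_act[OF coeffs g])
  then have root: "poly ?P (fps_map (act g) (\<psi> b)) = 0"
    using h.poly_hom[of ?P "\<psi> b"] \<psi>_root[OF b] by (simp add: h.hom_zero)
  have "\<psi> (g b) = fps_map (act g) (\<psi> b)"
  proof (rule fps_root_unique[OF _ root])
    show "poly ?P (\<psi> (g b)) = 0" using \<psi>_root[OF gb] by (simp add: orbit_poly_Gs[OF g])
    show "fps_nth (\<psi> (g b)) 0 = fps_nth (fps_map (act g) (\<psi> b)) 0"
      by (simp add: \<psi>_0 gb b)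
    have "fps_nth (poly (pderiv ?P) (\<psi> (g b))) 0 = poly (pderiv (orbit_poly (g b))) (gmon (g b))"
      by (simp add: poly_pderiv_nth_0 map_poly_\<Phi>_0 orbit_poly_polys b \<psi>_0 gb orbit_poly_Gs[OF g])
    moreover have "g b \<notin> Fix"
    proof
      assume *: "g b \<in> Fix"
      obtain k where k: "k \<in> Gs" "k \<circ> g = id" using Gs_inv[OF g] by blast
      from k(2) have "k (g b) = b" by (metis comp_apply id_apply)
      moreover have "k (g b) = g b" using * k(1) unfolding Fix_def by blast
      ultimately have "g b = b" by (simp only:)
      then show False using * False by simp
    qed
    ultimately show "fps_nth (poly (pderiv ?P) (\<psi> (g b))) 0 \<noteq> 0"
      using pderiv_orbit_poly_neq_0 by simp
  qed
  then show ?thesis .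
qed

text \<open>Invariants lie in \<open>SL\<close>, where the lift can be evaluated monomial by
  monomial.\<close>

lemma \<Phi>_expand:
  assumes r: "r \<in> R"
  shows "\<Phi> r = (\<Sum>x\<in>Poly_Mapping.keys r. fps_const (cst (Poly_Mapping.lookup r x)) * \<psi> x)"
proof -
  interpret \<iota>: total_hom \<iota> by (rule \<iota>_hom)
  note pr = keys_R[OF r]
  have cst: "cst c \<in> SL" "\<Psi> (cst c) = \<iota> (fps_const (cst c))" for c
    using cst_R[of c] by (auto simp: R_SL \<Psi>_R \<Phi>K_def \<Phi>_cst)
  have "\<iota> (\<Phi> r) = \<Psi> r" using r by (simp add: \<Psi>_R \<Phi>K_def)
  also have "\<dots> = \<Psi> (\<Sum>x\<in>Poly_Mapping.keys r. cst (Poly_Mapping.lookup r x) * gmon x)"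
    by (subst pm_expand[of r]) (simp only: single_eq_cst_mon)
  also have "\<dots> = (\<Sum>x\<in>Poly_Mapping.keys r. \<Psi> (cst (Poly_Mapping.lookup r x)) * \<Psi> (gmon x))"
    by (simp add: \<Psi>.hom_sum \<Psi>.hom_mult \<Psi>.mult_mem cst gmon_SL pr)
  also have "\<dots> = (\<Sum>x\<in>Poly_Mapping.keys r. \<iota> (fps_const (cst (Poly_Mapping.lookup r x))) * \<iota> (\<psi> x))"
    by (rule sum.cong) (simp_all add: cst \<iota>_\<psi> pr)
  also have "\<dots> = \<iota> (\<Sum>x\<in>Poly_Mapping.keys r. fps_const (cst (Poly_Mapping.lookup r x)) * \<psi> x)"
    by (simp only: \<iota>.hom_sum \<iota>.hom_mult UNIV_I)
  finally show ?thesis by (simp only: \<iota>_inj)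
qed

end

section \<open>Operators of prime order modulo that prime\<close>

lemma freshman_dream:
  fixes a b :: "'a::comm_ring_1"
  assumes "Factorial_Ring.prime q"
  shows "\<exists>h. (a + b) ^ q = a ^ q + b ^ q + of_nat q * h"
proof -
  have q: "q > 0" using assms prime_gt_0_nat by blast
  have "{..q} = insert 0 (insert q {1..<q})" using q by auto
  then have "(a + b) ^ q = a ^ q + b ^ q + (\<Sum>k=1..<q. of_nat (q choose k) * a ^ k * b ^ (q - k))"
    using q by (simp add: binomial_ring algebra_simps)
  moreover have "(\<Sum>k=1..<q. of_nat (q choose k) * a ^ k * b ^ (q - k))
      = of_nat q * (\<Sum>k=1..<q. of_nat ((q choose k) div q) * a ^ k * b ^ (q - k))"
    unfolding sum_distrib_left
  proof (rule sum.cong[OF refl])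
    fix k assume "k \<in> {1..<q}"
    then have "q choose k = q * ((q choose k) div q)"
      using dvd_choose_prime[of k q] assms by simp
    then have "(of_nat (q choose k) :: 'a) = of_nat q * of_nat ((q choose k) div q)"
      by (metis of_nat_mult)
    then show "of_nat (q choose k) * a ^ k * b ^ (q - k)
        = of_nat q * (of_nat ((q choose k) div q) * a ^ k * b ^ (q - k))"
      by (simp add: mult.assoc)
  qed
  ultimately have "(a + b) ^ q = a ^ q + b ^ q
      + of_nat q * (\<Sum>k=1..<q. of_nat ((q choose k) div q) * a ^ k * b ^ (q - k))" by (simp only:)
  then show ?thesis by (rule exI)
qed

text \<open>Modulo \<open>q\<close>, the \<open>q\<close>-th power of \<open>T - 1\<close> is \<open>T ^^ q - 1\<close>. Polynomials in \<open>T\<close> are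
  elements of the monoid ring \<open>nat \<Rightarrow>\<^sub>0 int\<close>.\<close>

lemma diff_operator_power:
  fixes T :: "lattice \<Rightarrow> lattice"
  assumes T: "\<And>a b. T (a + b) = T a + T b" and q: "Factorial_Ring.prime q" and Tq: "T ^^ q = id"
  shows "\<exists>y. ((\<lambda>a. T a - a) ^^ q) x = frag_cmul (int q) y"
proof -
  \<comment> \<open>\<open>E\<close> evaluates a polynomial in \<open>T\<close> at the vector
    \<open>x\<close>, the key \<open>i\<close> standing for the \<open>i\<close>-th power of
    \<open>T\<close>.\<close>
  define E where "E = frag_extend (\<lambda>i. (T ^^ i) x)"
  have E_add: "E (p + r) = E p + E r" and E_diff: "E (p - r) = E p - E r" for p r
    by (simp_all add: E_def frag_extend_add frag_extend_diff)
  have E_T: "E (frag_of (Suc 0) * p) = T (E p)" for p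
  proof -
    show ?thesis
    proof (rule frag_induction[of p UNIV "\<lambda>p. E (frag_of (Suc 0) * p) = T (E p)"])
      show "E (frag_of (Suc 0) * frag_of i) = T (E (frag_of i))" for i
        by (simp add: mult_single E_def)
      show "E (frag_of (Suc 0) * (a - b)) = T (E (a - b))"
        if "E (frag_of (Suc 0) * a) = T (E a)" "E (frag_of (Suc 0) * b) = T (E b)" for a b
        using that by (simp add: right_diff_distrib E_diff additive_diff[of T, OF T])
    qed (auto simp: E_def additive_zero[of T, OF T])
  qed
  have E_pow: "E ((frag_of (Suc 0) - 1) ^ j) = ((\<lambda>a. T a - a) ^^ j) x" for j
  proof (induction j)
    case 0
    have "E (frag_of 0) = x" by (simp only: E_def frag_extend_of funpow_0)
    then show ?case by simp
  next
    case (Suc j)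
    then show ?case by (simp add: left_diff_distrib E_diff E_T)
  qed
  have E_Tpow: "E (frag_of (Suc 0) ^ j) = (T ^^ j) x" for j
  proof (induction j)
    case 0
    have "E (frag_of 0) = x" by (simp only: E_def frag_extend_of funpow_0)
    then show ?case by simp
  qed (simp add: E_T)
  have E_of_nat: "E (of_nat n * h) = frag_cmul (int n) (E h)" for n h
  proof (induction n)
    case (Suc n)
    have "E (of_nat (Suc n) * h) = E h + E (of_nat n * h)"
      unfolding E_add[symmetric] by (simp add: distrib_right)
    then show ?case unfolding frag_cmul_Suc Suc .
  qed (simp add: E_def)
  obtain h where h: "(frag_of (Suc 0) + (- 1)) ^ q = (frag_of (Suc 0) :: nat \<Rightarrow>\<^sub>0 int) ^ q + (- 1) ^ q + of_nat q * h"
    using freshman_dream[OF q] by blast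
  \<comment> \<open>For \<open>q = 2\<close> the sign is off by 2, which is a multiple of
    \<open>q\<close>.\<close>
  have "\<exists>h'. (- 1 :: nat \<Rightarrow>\<^sub>0 int) ^ q = - 1 + of_nat q * h'"
  proof (cases "even q")
    case True
    then have "q = 2" using primes_dvd_imp_eq[OF two_is_prime_nat q] by simp
    then show ?thesis by (intro exI[of _ 1]) simp
  next
    case False
    then show ?thesis by (intro exI[of _ 0]) simp
  qed
  then obtain h' where h': "(- 1 :: nat \<Rightarrow>\<^sub>0 int) ^ q = - 1 + of_nat q * h'" by blast
  have "(frag_of (Suc 0) - 1) ^ q = (frag_of (Suc 0) ^ q - (frag_of (Suc 0) :: nat \<Rightarrow>\<^sub>0 int) ^ 0) + of_nat q * (h' + h)"
    using h unfolding h' by (simp add: algebra_simps)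
  then have "E ((frag_of (Suc 0) - 1) ^ q) = frag_cmul (int q) (E (h' + h))"
    by (simp only: E_add E_diff E_Tpow E_of_nat Tq) simp
  then show ?thesis unfolding E_pow by blast
qed

section \<open>An element of prime order and the subgroup \<open>B\<close>\<close>

locale prime_action = fpf_action Gs pr type_k
  for Gs pr and type_k :: "'k::field itself" +
  fixes g0 :: "lattice \<Rightarrow> lattice" and q :: nat
  assumes g0: "g0 \<in> Gs" "g0 \<noteq> id" and q: "Factorial_Ring.prime q" and g0_q: "g0 ^^ q = id"
    and q_k: "of_nat q \<noteq> (0 :: 'k)"
begin

definition B :: "lattice set"
  where "B = {f + (g0 b - b) | f b. f \<in> Fix}"

lemma B_diff: "g0 b - b \<in> B"
  unfolding B_def using Fix_zero by force

lemma Fix_B: "f \<in> Fix \<Longrightarrow> f \<in> B"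
  unfolding B_def by (rule CollectI, rule exI[of _ f], rule exI[of _ 0]) (simp add: Gs_zero g0)

sublocale lattice_subgroup B type_k
proof
  show "0 \<in> B" using Fix_B Fix_zero by blast
  show "a + b \<in> B" if a: "a \<in> B" and b: "b \<in> B" for a b
  proof -
    obtain f c f' c' where "a = f + (g0 c - c)" "b = f' + (g0 c' - c')" "f \<in> Fix" "f' \<in> Fix"
      using a b unfolding B_def by blast
    then have "a + b = (f + f') + (g0 (c + c') - (c + c'))" "f + f' \<in> Fix"
      by (simp_all add: Gs_add g0 Fix_add)
    then show ?thesis unfolding B_def by blast
  qed
  show "- a \<in> B" if a: "a \<in> B" for a
  proof -
    obtain f c where "a = f + (g0 c - c)" "f \<in> Fix"
      using a unfolding B_def by blast
    then have "- a = (- f) + (g0 (- c) - (- c))" "- f \<in> Fix"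
      by (simp_all add: Gs_uminus g0 Fix_uminus)
    then show ?thesis unfolding B_def by blast
  qed
qed

text \<open>\<open>g0\<close> moves each monomial within its coset of \<open>B\<close>, so it acts
  trivially on the group algebra of the quotient by \<open>B\<close>.\<close>

lemma act_g0_ker: "act g0 s - s \<in> ker"
proof -
  have "act g0 s - s = (\<Sum>x\<in>Poly_Mapping.keys s. cst (Poly_Mapping.lookup s x) * (gmon (g0 x) - gmon x))"
    using pm_expand[of s]
    by (simp add: linear_extension_def single_eq_cst_mon right_diff_distrib sum_subtractf)
  also have "\<dots> \<in> ker"
    by (intro ker_sum ker_mult) (simp add: gmon_diff_mem_ker B_diff)
  finally show ?thesis .
qed

lemma g0_pow: "g0 ^^ i \<in> Gs"
proof (induction i)
  case 0
  show ?case unfolding funpow.simps by (rule id_Gs)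
next
  case (Suc i)
  then show ?case unfolding funpow.simps by (rule Gs_comp[OF g0(1)])
qed

definition orbit_sum :: "lattice \<Rightarrow> nat \<Rightarrow> lattice"
  where "orbit_sum b n = (\<Sum>i<n. (g0 ^^ i) b)"

text \<open>The difference telescopes, so \<open>g0\<close> fixes the sum; fixed point freeness then
  makes it fixed by the whole group.\<close>

lemma orbit_sum_Fix: "orbit_sum b q \<in> Fix"
proof (rule fpf[OF g0])
  have "g0 (orbit_sum b n) - orbit_sum b n = (g0 ^^ n) b - b" for n
    by (induction n) (auto simp: orbit_sum_def Gs_zero Gs_add g0 algebra_simps)
  then show "g0 (orbit_sum b q) - orbit_sum b q \<in> Fix"
    using g0_q Fix_zero by simp
qed

lemma orbit_sum_diff_B: "frag_cmul (int n) b - orbit_sum b n \<in> B"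
proof (induction n)
  case (Suc n)
  have pow: "b - (g0 ^^ i) b \<in> B" for i
  proof (induction i)
    case (Suc i)
    then show ?case using add_B[OF Suc uminus_B[OF B_diff[of "(g0 ^^ i) b"]]] by simp
  qed (simp add: zero_B)
  show ?case
    using add_B[OF Suc pow[of n]] unfolding frag_cmul_Suc orbit_sum_def by (simp add: algebra_simps)
qed (simp add: orbit_sum_def zero_B)

lemma ker_cancel_q:
  assumes "of_nat q * s \<in> ker"
  shows "s \<in> ker"
proof -
  interpret c: total_hom "cst :: 'k \<Rightarrow> lattice \<Rightarrow>\<^sub>0 'k" by (rule cst_hom)
  have q_cst: "(of_nat q :: lattice \<Rightarrow>\<^sub>0 'k) = cst (of_nat q)" by (simp add: cst_def single_of_nat)
  have "cst (1 / of_nat q) * of_nat q = (1 :: lattice \<Rightarrow>\<^sub>0 'k)"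
    unfolding q_cst c.hom_mult[OF UNIV_I UNIV_I, symmetric] using q_k by (simp add: c.hom_one)
  then have "cst (1 / of_nat q) * (of_nat q * s) = s" by (simp only: mult.assoc[symmetric] mult_1_left)
  then show ?thesis using ker_mult[OF assms, of "cst (1 / of_nat q)"] by (simp only:)
qed

lemma q_multiple_B: "frag_cmul (int q) b \<in> B"
  using add_B[OF orbit_sum_diff_B[of q b] Fix_B[OF orbit_sum_Fix[of b]]] by simp

text \<open>If \<open>B\<close> were everything, \<open>g0 - 1\<close> would be onto modulo
  \<open>Fix\<close>, and so would its \<open>q\<close>-th power. By
  \<open>diff_operator_power\<close> the latter takes values in the multiples of \<open>q\<close>,
  so the quotient by \<open>Fix\<close> would be \<open>q\<close>-divisible, which a nonzero integer
  valued form on it forbids.\<close>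

lemma B_proper: "\<exists>b. b \<notin> B"
proof (rule ccontr)
  assume "\<not> (\<exists>b. b \<notin> B)"
  then have all: "\<exists>f c. f \<in> Fix \<and> b = f + (g0 c - c)" for b unfolding B_def by blast
  define D where "D a = g0 a - a" for a
  have D_add: "D (a + b) = D a + D b" for a b by (simp add: D_def Gs_add g0)
  have Dj_add: "(D ^^ j) (a + b) = (D ^^ j) a + (D ^^ j) b" for j a b
    by (induction j) (auto simp: D_add)
  have D_Fix: "D f \<in> Fix" if "f \<in> Fix" for f
    unfolding D_def using that g0(1) Fix_zero unfolding Fix_def by auto
  have Dj_Fix: "(D ^^ j) f \<in> Fix" if "f \<in> Fix" for j f
    by (induction j) (auto simp: that D_Fix)
  have "\<exists>c. b - (D ^^ j) c \<in> Fix" for b j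
  proof (induction j)
    case 0
    show ?case by (rule exI[of _ b]) (simp add: Fix_zero)
  next
    case (Suc j)
    then obtain c where c: "b - (D ^^ j) c \<in> Fix" by blast
    obtain f c' where f: "f \<in> Fix" "c = f + D c'" using all[of c] unfolding D_def by blast
    have "b - (D ^^ Suc j) c' = (b - (D ^^ j) c) + (D ^^ j) f"
      unfolding f(2) Dj_add by (simp add: funpow_swap1)
    then show ?case using Fix_add[OF c Dj_Fix[OF f(1)]] by metis
  qed
  moreover have "\<exists>y. (D ^^ q) c = frag_cmul (int q) y" for c
    unfolding D_def by (rule diff_operator_power) (auto simp: Gs_add g0 q g0_q)
  ultimately have step: "\<exists>y. b - frag_cmul (int q) y \<in> Fix" for b by metis
  have div: "\<exists>y. b - frag_cmul (int q ^ n) y \<in> Fix" for b n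
  proof (induction n)
    case 0
    show ?case by (rule exI[of _ b]) (simp add: Fix_zero)
  next
    case (Suc n)
    then obtain y where y: "b - frag_cmul (int q ^ n) y \<in> Fix" by blast
    obtain z where z: "y - frag_cmul (int q) z \<in> Fix" using step by blast
    have "frag_cmul (int q ^ n) (y - frag_cmul (int q) z) \<in> Fix"
      using q z by (subst Fix_cmul) (auto simp: prime_gt_0_nat)
    moreover have "b - frag_cmul (int q ^ Suc n) z
        = (b - frag_cmul (int q ^ n) y) + frag_cmul (int q ^ n) (y - frag_cmul (int q) z)"
      by (rule poly_mapping_eqI) (simp add: lookup_minus lookup_add algebra_simps)
    ultimately have "b - frag_cmul (int q ^ Suc n) z \<in> Fix" using y by (simp only: Fix_add)
    then show ?case by blast
  qed
  obtain b where "b \<notin> Fix" using nontrivial by blast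
  then obtain h where h: "h \<in> Gs" "h b \<noteq> b" by (auto simp: Fix_def)
  then obtain i where i: "Poly_Mapping.lookup (h b - b) i \<noteq> 0"
    by (metis eq_iff_diff_eq_0 lookup_zero poly_mapping_eqI)
  \<comment> \<open>The form that sends \<open>a\<close> to coordinate \<open>i\<close> of
    \<open>h a - a\<close> vanishes on \<open>Fix\<close>; \<open>v\<close> is its nonzero value at
    \<open>b\<close>.\<close>
  define v where "v = Poly_Mapping.lookup (h b - b) i"
  have "int q ^ n dvd v" for n
  proof -
    obtain y where "b - frag_cmul (int q ^ n) y \<in> Fix" using div by blast
    then have "h (b - frag_cmul (int q ^ n) y) = b - frag_cmul (int q ^ n) y"
      using h(1) unfolding Fix_def by blast
    then have "h b - b = frag_cmul (int q ^ n) (h y) - frag_cmul (int q ^ n) y"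
      by (simp only: Gs_diff[OF h(1)] Gs_cmul[OF h(1)]) (metis add_diff_cancel_left' diff_add_cancel diff_diff_eq2)
    then have "v = int q ^ n * (Poly_Mapping.lookup (h y) i - Poly_Mapping.lookup y i)"
      unfolding v_def by (simp only: lookup_minus lookup_frag_cmul right_diff_distrib)
    then show ?thesis by simp
  qed
  \<comment> \<open>The exponent is the absolute value of \<open>v\<close> because
    \<open>q ^ n\<close> exceeds \<open>n\<close>.\<close>
  then have "int q ^ nat \<bar>v\<bar> \<le> \<bar>v\<bar>"
    using i v_def by (metis abs_ge_zero dvd_abs_iff zdvd_imp_le zero_less_abs_iff)
  moreover have "int n < int q ^ n" for n
  proof -
    have "n < q ^ n" using prime_gt_Suc_0_nat[OF q] by (rule power_gt_expt)
    then show ?thesis by (metis of_nat_less_iff of_nat_power)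
  qed
  ultimately show False by (metis abs_ge_zero int_nat_eq linorder_not_less)
qed

end

section \<open>The lift modulo \<open>B\<close>\<close>

locale lift_prime = lift_action Gs pr type_k \<Phi> + prime_action Gs pr type_k g0 q
  for Gs pr and type_k :: "'k::field itself" and \<Phi> g0 q
begin

definition U :: "lattice \<Rightarrow> (lattice \<Rightarrow>\<^sub>0 'k) fps"
  where "U b = fps_const (gmon (- b)) * \<psi> b"

lemma U_nth: "fps_nth (U b) i = gmon (- b) * fps_nth (\<psi> b) i"
  by (simp add: U_def)

lemma U_add: "pr b = b \<Longrightarrow> pr c = c \<Longrightarrow> U (b + c) = U b * U c"
proof -
  assume bc: "pr b = b" "pr c = c"
  have "fps_const (gmon (- (b + c))) = fps_const (gmon (- b)) * fps_const (gmon (- c) :: lattice \<Rightarrow>\<^sub>0 'k)"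
    by (simp add: gmon_add[symmetric])
  then show ?thesis unfolding U_def \<psi>_add[OF bc] by (simp only: mult_ac)
qed

lemma U_Fix: "b \<in> Fix \<Longrightarrow> pr b = b \<Longrightarrow> U b = 1"
  by (simp add: U_def \<psi>_Fix mult.commute)

lemma U_0: "pr b = b \<Longrightarrow> fps_nth (U b) 0 = 1"
  by (simp add: U_nth \<psi>_0 mult.commute)

definition cong :: "(lattice \<Rightarrow>\<^sub>0 'k) fps \<Rightarrow> (lattice \<Rightarrow>\<^sub>0 'k) fps \<Rightarrow> bool"
  where "cong F G \<longleftrightarrow> (\<forall>i. fps_nth (F - G) i \<in> ker)"

lemma cong_refl: "cong F F"
  by (simp add: cong_def ker_zero)

lemma cong_trans: "cong F G \<Longrightarrow> cong G H \<Longrightarrow> cong F H"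
proof -
  assume 1: "cong F G" and 2: "cong G H"
  have "fps_nth (F - H) i = fps_nth (F - G) i + fps_nth (G - H) i" for i by simp
  then show ?thesis using 1 2 ker_add unfolding cong_def by metis
qed

lemma cong_mult:
  assumes "cong F F'" "cong G G'"
  shows "cong (F * G) (F' * G')"
proof -
  have "F * G - F' * G' = F * (G - G') + (F - F') * G'" by (simp add: algebra_simps)
  moreover have "fps_nth (F * (G - G') + (F - F') * G') i \<in> ker" for i
    unfolding fps_add_nth fps_mult_nth
    by (intro ker_add ker_sum ker_mult ker_mult') (use assms in \<open>auto simp: cong_def\<close>)
  ultimately show ?thesis by (simp only: cong_def) blast
qed

text \<open>The lift is equivariant, \<open>g0\<close> acts trivially modulo \<open>ker\<close>, and
  the normalizing monomials of \<open>g0 b\<close> and \<open>b\<close> agree modulo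
  \<open>ker\<close>.\<close>

lemma U_g0:
  assumes b: "pr b = b"
  shows "cong (U (g0 b)) (U b)"
  unfolding cong_def
proof
  fix i
  have "fps_nth (\<psi> (g0 b)) i = act g0 (fps_nth (\<psi> b) i)"
    using \<psi>_act[OF g0(1) b] by simp
  then have "fps_nth (U (g0 b) - U b) i = gmon (- g0 b) * (act g0 (fps_nth (\<psi> b) i) - fps_nth (\<psi> b) i)
      + (gmon (- g0 b) - gmon (- b)) * fps_nth (\<psi> b) i"
    by (simp add: U_nth algebra_simps)
  moreover have "- g0 b - (- b) \<in> B"
    using uminus_B[OF B_diff[of b]] by (simp add: algebra_simps)
  ultimately show "fps_nth (U (g0 b) - U b) i \<in> ker"
    by (simp only:) (intro ker_add ker_mult ker_mult' act_g0_ker, simp add: gmon_diff_mem_ker)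
qed

lemma pr_g0_pow: "pr b = b \<Longrightarrow> pr ((g0 ^^ i) b) = (g0 ^^ i) b"
  using Gs_pr[OF g0_pow, of i b] by simp

lemma pr_orbit_sum: "pr b = b \<Longrightarrow> pr (orbit_sum b n) = orbit_sum b n"
  unfolding orbit_sum_def
  by (induction n) (simp_all add: pr_g0_pow pr_add additive_zero[of pr, OF pr_add])

text \<open>\<open>U\<close> is multiplicative, and modulo \<open>ker\<close> each translate of
  \<open>b\<close> contributes the same factor. For \<open>n = q\<close> the left side is 1, since
  the orbit sum is fixed.\<close>

lemma U_orbit_sum:
  assumes b: "pr b = b"
  shows "cong (U (orbit_sum b n)) (U b ^ n)"
proof (induction n)
  case 0
  have "orbit_sum b 0 = 0" by (simp add: orbit_sum_def)
  then show ?case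
    using U_Fix[OF Fix_zero additive_zero[of pr, OF pr_add]] by (simp add: cong_refl)
next
  case (Suc n)
  have *: "cong (U ((g0 ^^ i) b)) (U b)" for i
  proof (induction i)
    case (Suc i)
    then show ?case using cong_trans[OF U_g0[OF pr_g0_pow[OF b, of i]] Suc] by simp
  qed (simp add: cong_refl)
  have "U (orbit_sum b (Suc n)) = U ((g0 ^^ n) b) * U (orbit_sum b n)"
    unfolding U_add[OF pr_g0_pow[OF b] pr_orbit_sum[OF b], symmetric]
    by (simp add: orbit_sum_def add.commute)
  then show ?case using cong_mult[OF *[of n] Suc] by simp
qed

text \<open>With constant term 1 and the intermediate coefficients in \<open>ker\<close>, the
  coefficient of index \<open>n\<close> of the \<open>m\<close>-th power is \<open>m\<close> times
  that of \<open>U b\<close> modulo \<open>ker\<close>. For \<open>m = q\<close> the power is 1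
  modulo \<open>ker\<close>, and \<open>q\<close> can be cancelled.\<close>

lemma U_cong_1:
  assumes b: "pr b = b"
  shows "n > 0 \<Longrightarrow> fps_nth (U b) n \<in> ker"
proof (induction n rule: less_induct)
  case (less n)
  have pow: "fps_nth (U b ^ m) 0 = 1 \<and> (\<forall>j. 0 < j \<and> j < n \<longrightarrow> fps_nth (U b ^ m) j \<in> ker) \<and>
      fps_nth (U b ^ m) n - of_nat m * fps_nth (U b) n \<in> ker" for m
  proof (induction m)
    case 0
    show ?case using less.prems by (auto simp: ker_zero)
  next
    case (Suc m)
    have mid: "(\<Sum>i\<in>{1..<j}. fps_nth (U b) i * fps_nth (U b ^ m) (j - i)) \<in> ker" if "j \<le> n" for j
      by (intro ker_sum ker_mult') (use less.IH that in auto)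
    have split: "fps_nth (U b ^ Suc m) j = fps_nth (U b ^ m) j + fps_nth (U b) j
        + (\<Sum>i\<in>{1..<j}. fps_nth (U b) i * fps_nth (U b ^ m) (j - i))" if "0 < j" for j
    proof -
      have "{0..j} = insert 0 (insert j {1..<j})" using that by auto
      then show ?thesis using that Suc U_0[OF b] by (simp add: fps_mult_nth)
    qed
    have "fps_nth (U b ^ Suc m) j \<in> ker" if "0 < j" "j < n" for j
      unfolding split[OF that(1)] using mid[of j] Suc less.IH[OF that(2,1)] that
      by (intro ker_add) auto
    moreover have "fps_nth (U b ^ Suc m) n - of_nat (Suc m) * fps_nth (U b) n
        = (fps_nth (U b ^ m) n - of_nat m * fps_nth (U b) n)
        + (\<Sum>i\<in>{1..<n}. fps_nth (U b) i * fps_nth (U b ^ m) (n - i))"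
      unfolding split[OF less.prems] by (simp add: algebra_simps)
    moreover have "\<dots> \<in> ker" using Suc mid[of n] by (intro ker_add) auto
    ultimately show ?case using Suc U_0[OF b] by simp
  qed
  have "cong 1 (U b ^ q)"
    using U_orbit_sum[OF b, of q] U_Fix[OF orbit_sum_Fix pr_orbit_sum[OF b]] by simp
  then have "fps_nth (1 - U b ^ q) n \<in> ker" unfolding cong_def by blast
  then have "fps_nth (U b ^ q) n \<in> ker" using less.prems ker_uminus by fastforce
  then have "fps_nth (U b ^ q) n - (fps_nth (U b ^ q) n - of_nat q * fps_nth (U b) n) \<in> ker"
    by (rule ker_diff) (use pow[of q] in blast)
  then have "of_nat q * fps_nth (U b) n \<in> ker" by simp
  then show ?case by (rule ker_cancel_q)
qed

lemma \<Phi>_nth_ker: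
  assumes r: "r \<in> R" and i: "i > 0"
  shows "fps_nth (\<Phi> r) i \<in> ker"
proof -
  have "fps_nth (\<psi> x) i \<in> ker" if "pr x = x" for x
  proof -
    have "gmon x * fps_nth (U x) i = fps_nth (\<psi> x) i"
      by (simp add: U_nth mult.assoc[symmetric])
    then show ?thesis using ker_mult[OF U_cong_1[OF that i], of "gmon x"] by simp
  qed
  then show ?thesis
    unfolding \<Phi>_expand[OF r] fps_sum_nth fps_mult_left_const_nth
    by (intro ker_sum ker_mult) (use keys_R[OF r] in blast)
qed

end

section \<open>The grading defined by a multiplicative basis\<close>

lemma one_plus_X_power_Suc_nth:
  "fps_nth ((1 + fps_X :: 'a::comm_ring_1 fps) ^ Suc n) m =
    fps_nth ((1 + fps_X) ^ n) m + (if m = 0 then 0 else fps_nth ((1 + fps_X) ^ n) (m - 1))"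
  unfolding power_Suc fps_mult_fps_X_plus_1_nth by simp

lemma one_plus_X_power_nth:
  "fps_nth ((1 + fps_X :: 'a::comm_ring_1 fps) ^ n) n = 1 \<and> (\<forall>m>n. fps_nth ((1 + fps_X :: 'a fps) ^ n) m = 0)"
proof (induction n)
  case (Suc n)
  then show ?case by (auto simp: one_plus_X_power_Suc_nth simp del: power_Suc)
qed auto

text \<open>\<open>e\<close> takes a monoid element to the corresponding basis element of the
  invariants, and \<open>\<theta>\<close> takes an invariant to its coordinates in this
  basis.\<close>

locale invariant_basis = prime_action Gs pr type_k g0 q
  for Gs pr and type_k :: "'k::field itself" and g0 q +
  fixes Mc :: "'m set" and mop :: "'m \<Rightarrow> 'm \<Rightarrow> 'm" and mone :: 'm
    and e :: "'m \<Rightarrow> (lattice \<Rightarrow>\<^sub>0 'k)" and \<theta> :: "(lattice \<Rightarrow>\<^sub>0 'k) \<Rightarrow> ('m \<Rightarrow>\<^sub>0 'k)"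
  assumes e_R: "x \<in> Mc \<Longrightarrow> e x \<in> R" and mone_mem: "mone \<in> Mc"
    and mop_mem: "x \<in> Mc \<Longrightarrow> y \<in> Mc \<Longrightarrow> mop x y \<in> Mc"
    and e_mone: "e mone = 1" and e_mop: "x \<in> Mc \<Longrightarrow> y \<in> Mc \<Longrightarrow> e (mop x y) = e x * e y"
    and \<theta>_keys: "r \<in> R \<Longrightarrow> Poly_Mapping.keys (\<theta> r) \<subseteq> Mc"
    and \<theta>_expand: "r \<in> R \<Longrightarrow> r = pm_eval cst e (\<theta> r)"
    and \<theta>_add: "r \<in> R \<Longrightarrow> s \<in> R \<Longrightarrow> \<theta> (r + s) = \<theta> r + \<theta> s"
    and \<theta>_single: "x \<in> Mc \<Longrightarrow> \<theta> (cst c * e x) = Poly_Mapping.single x c"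
begin

sublocale R: subring_hom R "\<lambda>x. x"
  by (rule R_subring)

sublocale c: total_hom "cst :: 'k \<Rightarrow> lattice \<Rightarrow>\<^sub>0 'k"
  by (rule cst_hom)

lemma \<theta>_zero: "\<theta> 0 = 0"
  using \<theta>_add[OF R.zero_mem R.zero_mem] by simp

lemma \<theta>_sum: "(\<And>i. i \<in> I \<Longrightarrow> f i \<in> R) \<Longrightarrow> \<theta> (sum f I) = (\<Sum>i\<in>I. \<theta> (f i))"
  by (induction I rule: infinite_finite_induct) (auto simp: \<theta>_zero \<theta>_add R.sum_mem)

lemma e_neq_0: "x \<in> Mc \<Longrightarrow> e x \<noteq> 0"
proof
  assume x: "x \<in> Mc" "e x = 0"
  then have "Poly_Mapping.single x (1 :: 'k) = 0" using \<theta>_single[OF x(1), of 1] \<theta>_zero by simp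
  then show False by (metis lookup_single_eq lookup_zero zero_neq_one)
qed

lemma keys_R_Gs:
  assumes r: "r \<in> R" and b: "b \<in> Poly_Mapping.keys r" and g: "g \<in> Gs"
  shows "g b \<in> Poly_Mapping.keys r"
proof -
  have "act g r = r" using r g by (simp add: R_def)
  then have "Poly_Mapping.lookup r (g b) = Poly_Mapping.lookup r b"
    using lookup_linear_extension_inj[OF Gs_inj[OF g], of r b] by simp
  then show ?thesis using b by (simp add: in_keys_iff)
qed

context
  fixes w :: "lattice \<Rightarrow> int"
  assumes w_add: "w (a + b) = w a + w b" and w_Fix: "f \<in> Fix \<Longrightarrow> w f = 0"
begin

text \<open>The sum over the orbit is a fixed vector, and \<open>w\<close> vanishes on
  those.\<close>

lemma weight_orbit: "(\<Sum>h\<in>Gs. w (h b)) = 0"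
proof -
  have w_sum: "w (\<Sum>h\<in>H. h b) = (\<Sum>h\<in>H. w (h b))" for H :: "(lattice \<Rightarrow> lattice) set"
    by (induction H rule: infinite_finite_induct) (auto simp: w_add additive_zero[of w, OF w_add])
  have "g (\<Sum>h\<in>Gs. h b) = (\<Sum>h\<in>Gs. h b)" if g: "g \<in> Gs" for g
  proof -
    have "g (\<Sum>h\<in>H. h b) = (\<Sum>h\<in>H. (g \<circ> h) b)" for H :: "(lattice \<Rightarrow> lattice) set"
      by (induction H rule: infinite_finite_induct) (auto simp: Gs_add Gs_zero g)
    then show ?thesis using sum.reindex_bij_betw[OF Gs_comp_bij[OF g], of "\<lambda>h. h b"] by simp
  qed
  then have "(\<Sum>h\<in>Gs. h b) \<in> Fix" by (simp add: Fix_def)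
  then show ?thesis using w_sum[of Gs] w_Fix by simp
qed

text \<open>All translates of \<open>b\<close> are keys of \<open>r\<close>, and their weights add
  up to zero. So the largest weight is not negative, and it is positive unless all of them are
  zero.\<close>

lemma top_deg_pos:
  assumes r: "r \<in> R" and b: "b \<in> Poly_Mapping.keys r"
  shows "0 \<le> top_deg w r" and "w b \<noteq> 0 \<Longrightarrow> 0 < top_deg w r"
proof -
  have le: "w (h b) \<le> top_deg w r" if "h \<in> Gs" for h
    unfolding top_deg_def using keys_R_Gs[OF r b that] by (intro Max_ge) auto
  show "0 \<le> top_deg w r"
  proof (rule ccontr)
    assume "\<not> 0 \<le> top_deg w r"
    then have neg: "w (h b) < 0" if "h \<in> Gs" for h using le[OF that] by simp
    have "(\<Sum>h\<in>Gs. w (h b)) < (\<Sum>h\<in>Gs. 0)"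
      by (rule sum_strict_mono) (use neg finite_Gs id_Gs in auto)
    then show False by (simp add: weight_orbit)
  qed
  assume wb: "w b \<noteq> 0"
  show "0 < top_deg w r"
  proof (rule ccontr)
    assume "\<not> 0 < top_deg w r"
    then have "\<forall>h\<in>Gs. 0 \<le> - w (h b)" using le by force
    then have "\<forall>h\<in>Gs. - w (h b) = 0"
      using sum_nonneg_eq_0_iff[OF finite_Gs, of "\<lambda>h. - w (h b)"] weight_orbit[of b]
      by (simp add: sum_negf)
    then show False using id_Gs wb by force
  qed
qed

text \<open>A basis element need not be homogeneous for \<open>w\<close>; it is declared homogeneous
  of the degree of its top term. This is compatible with products because top degrees add in a
  domain.\<close>

definition \<mu> :: "'m \<Rightarrow> nat"
  where "\<mu> x = nat (top_deg w (e x))"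

lemma \<mu>_mop:
  assumes x: "x \<in> Mc" and y: "y \<in> Mc"
  shows "\<mu> (mop x y) = \<mu> x + \<mu> y"
proof -
  have pos: "0 \<le> top_deg w (e x)" if x: "x \<in> Mc" for x
  proof -
    obtain b where "b \<in> Poly_Mapping.keys (e x)" using e_neq_0[OF x] keys_eq_empty by blast
    then show ?thesis by (rule top_deg_pos(1)[OF e_R[OF x]])
  qed
  show ?thesis
    using top_deg_mult[OF w_add e_neq_0[OF x] e_neq_0[OF y]] pos[OF x] pos[OF y]
    by (simp add: \<mu>_def e_mop x y nat_add_distrib)
qed

lemma \<mu>_mone: "\<mu> mone = 0"
  by (simp add: \<mu>_def e_mone top_deg_def additive_zero[of w, OF w_add])

text \<open>The coefficient in degree d is the component of \<open>r\<close> of degree d for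
  \<open>\<mu>\<close>, so the value at 1 is \<open>r\<close> again.\<close>

definition graded :: "(lattice \<Rightarrow>\<^sub>0 'k) \<Rightarrow> (lattice \<Rightarrow>\<^sub>0 'k) poly"
  where "graded r = pm_eval (\<lambda>c. [:cst c:]) (\<lambda>x. Polynomial.monom (e x) (\<mu> x)) (\<theta> r)"

lemma const_cst_hom: "total_hom (\<lambda>c. [:cst c :: lattice \<Rightarrow>\<^sub>0 'k:])"
  by (rule total_homI) (auto simp: c.hom_one c.hom_add c.hom_mult)

lemma graded_single: "x \<in> Mc \<Longrightarrow> graded (cst c * e x) = Polynomial.monom (cst c * e x) (\<mu> x)"
  by (simp add: graded_def \<theta>_single pm_eval_single[OF const_cst_hom] smult_monom)

lemma graded_e: "x \<in> Mc \<Longrightarrow> graded (e x) = Polynomial.monom (e x) (\<mu> x)"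
  using graded_single[of x 1] by (simp add: c.hom_one)

lemma graded_add: "r \<in> R \<Longrightarrow> s \<in> R \<Longrightarrow> graded (r + s) = graded r + graded s"
  by (simp add: graded_def \<theta>_add pm_eval_add[OF const_cst_hom])

lemma graded_zero: "graded 0 = 0"
  by (simp add: graded_def \<theta>_zero pm_eval_def)

lemma graded_sum: "(\<And>i. i \<in> I \<Longrightarrow> f i \<in> R) \<Longrightarrow> graded (sum f I) = (\<Sum>i\<in>I. graded (f i))"
  by (induction I rule: infinite_finite_induct) (auto simp: graded_zero graded_add R.sum_mem)

lemma graded_mult:
  assumes r: "r \<in> R" and s: "s \<in> R"
  shows "graded (r * s) = graded r * graded s"
proof -
  let ?K = "\<lambda>r. Poly_Mapping.keys (\<theta> r)" and ?c = "\<lambda>r x. Poly_Mapping.lookup (\<theta> r) x"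
  have exp: "r = (\<Sum>x\<in>?K r. cst (?c r x) * e x)" if "r \<in> R" for r
    using \<theta>_expand[OF that] by (simp add: pm_eval_def)
  have mem: "cst c * e x \<in> R" if "x \<in> Mc" for c x by (intro R.mult_mem cst_R e_R that)
  have gr: "graded r = (\<Sum>x\<in>?K r. Polynomial.monom (cst (?c r x) * e x) (\<mu> x))" if "r \<in> R" for r
  proof -
    have "graded r = graded (\<Sum>x\<in>?K r. cst (?c r x) * e x)" using exp[OF that] by simp
    also have "\<dots> = (\<Sum>x\<in>?K r. graded (cst (?c r x) * e x))"
      by (rule graded_sum) (use \<theta>_keys[OF that] mem in blast)
    also have "\<dots> = (\<Sum>x\<in>?K r. Polynomial.monom (cst (?c r x) * e x) (\<mu> x))"
      by (rule sum.cong[OF refl]) (use \<theta>_keys[OF that] in \<open>auto simp: graded_single\<close>)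
    finally show ?thesis .
  qed
  have "r * s = (\<Sum>x\<in>?K r. \<Sum>y\<in>?K s. (cst (?c r x) * e x) * (cst (?c s y) * e y))"
    unfolding sum_product[symmetric] using exp[OF r] exp[OF s] by simp
  also have "\<dots> = (\<Sum>x\<in>?K r. \<Sum>y\<in>?K s. cst (?c r x * ?c s y) * e (mop x y))"
  proof (intro sum.cong refl)
    fix x y assume "x \<in> ?K r" "y \<in> ?K s"
    then have "x \<in> Mc" "y \<in> Mc" using \<theta>_keys[OF r] \<theta>_keys[OF s] by auto
    then show "(cst (?c r x) * e x) * (cst (?c s y) * e y) = cst (?c r x * ?c s y) * e (mop x y)"
      by (simp add: e_mop c.hom_mult mult_ac)
  qed
  finally have "graded (r * s) = graded (\<Sum>x\<in>?K r. \<Sum>y\<in>?K s. cst (?c r x * ?c s y) * e (mop x y))"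
    by simp
  also have "\<dots> = (\<Sum>x\<in>?K r. graded (\<Sum>y\<in>?K s. cst (?c r x * ?c s y) * e (mop x y)))"
    by (intro graded_sum R.sum_mem mem mop_mem) (use \<theta>_keys[OF r] \<theta>_keys[OF s] in auto)
  also have "\<dots> = (\<Sum>x\<in>?K r. \<Sum>y\<in>?K s. graded (cst (?c r x * ?c s y) * e (mop x y)))"
    by (intro sum.cong refl graded_sum mem mop_mem) (use \<theta>_keys[OF r] \<theta>_keys[OF s] in auto)
  also have "\<dots> = (\<Sum>x\<in>?K r. \<Sum>y\<in>?K s. Polynomial.monom (cst (?c r x) * e x) (\<mu> x)
      * Polynomial.monom (cst (?c s y) * e y) (\<mu> y))"
  proof (intro sum.cong refl)
    fix x y assume "x \<in> ?K r" "y \<in> ?K s"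
    then have xy: "x \<in> Mc" "y \<in> Mc" using \<theta>_keys[OF r] \<theta>_keys[OF s] by auto
    show "graded (cst (?c r x * ?c s y) * e (mop x y)) = Polynomial.monom (cst (?c r x) * e x) (\<mu> x)
      * Polynomial.monom (cst (?c s y) * e y) (\<mu> y)"
      unfolding graded_single[OF mop_mem[OF xy]] mult_monom
      by (simp add: \<mu>_mop xy e_mop c.hom_mult mult_ac)
  qed
  also have "\<dots> = graded r * graded s"
    unfolding gr[OF r] gr[OF s] sum_product ..
  finally show ?thesis .
qed

lemma graded_one: "graded 1 = 1"
  using graded_e[OF mone_mem] by (simp add: e_mone \<mu>_mone)

lemma graded_at_1: "r \<in> R \<Longrightarrow> poly (graded r) 1 = r"
  using \<theta>_expand[of r] by (simp add: graded_def pm_eval_def poly_sum poly_monom)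

lemma coeff_graded_R:
  assumes r: "r \<in> R"
  shows "poly.coeff (graded r) i \<in> R"
proof -
  have "poly.coeff (graded r) i = (\<Sum>x\<in>Poly_Mapping.keys (\<theta> r).
      if \<mu> x = i then cst (Poly_Mapping.lookup (\<theta> r) x) * e x else 0)"
    by (simp add: graded_def pm_eval_def coeff_sum smult_monom if_distrib cong: if_cong)
  also have "\<dots> \<in> R"
    by (intro R.sum_mem) (use \<theta>_keys[OF r] e_R in \<open>auto intro!: R.mult_mem cst_R R.zero_mem\<close>)
  finally show ?thesis .
qed

text \<open>The monomial need not be a basis element, but it is a unit of \<open>R\<close>. Its
  image is a unit of a polynomial ring over a domain, hence constant, and evaluation at 1 identifies
  the constant.\<close>

lemma graded_Fix:
  assumes f: "f \<in> Fix" "pr f = f"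
  shows "graded (gmon f) = [:gmon f:]"
proof -
  have mem: "gmon f \<in> R" "gmon (- f) \<in> R"
    using f Fix_uminus[OF f(1)] by (auto simp: R_def Fix_def additive_uminus[of pr, OF pr_add])
  have "graded (gmon f) * graded (gmon (- f)) = 1"
    using graded_mult[OF mem] graded_one by simp
  then have "graded (gmon f) dvd 1" by (metis dvd_triv_left)
  then obtain z where z: "graded (gmon f) = [:z:]" by (auto simp: is_unit_poly_iff)
  then show ?thesis using graded_at_1[OF mem(1)] by simp
qed

definition \<Phi> :: "(lattice \<Rightarrow>\<^sub>0 'k) \<Rightarrow> (lattice \<Rightarrow>\<^sub>0 'k) fps"
  where "\<Phi> r = poly (map_poly fps_const (graded r)) (1 + fps_X)"

lemma \<Phi>_lift: "lift_prime Gs pr \<Phi> g0 q"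
proof -
  interpret f: total_hom "map_poly (fps_const :: (lattice \<Rightarrow>\<^sub>0 'k) \<Rightarrow> _)"
    by (rule total_hom.map_poly_hom[OF fps_const_hom])
  have "lift_action Gs pr \<Phi>"
  proof unfold_locales
    show "\<Phi> 1 = 1" by (simp add: \<Phi>_def graded_one f.hom_one)
    show "\<Phi> (x + y) = \<Phi> x + \<Phi> y" if "x \<in> R" "y \<in> R" for x y
      using that by (simp add: \<Phi>_def graded_add f.hom_add)
    show "\<Phi> (x * y) = \<Phi> x * \<Phi> y" if "x \<in> R" "y \<in> R" for x y
      using that by (simp add: \<Phi>_def graded_mult f.hom_mult)
    have coeff0: "map_poly (\<lambda>F. fps_nth F 0) (map_poly fps_const P) = P" for P :: "(lattice \<Rightarrow>\<^sub>0 'k) poly"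
      by (rule poly_eqI) (simp add: coeff_map_poly)
    show "fps_nth (\<Phi> r) 0 = r" if "r \<in> R" for r
      using that by (simp add: \<Phi>_def poly_nth_0 coeff0 graded_at_1)
    show "act g (fps_nth (\<Phi> r) i) = fps_nth (\<Phi> r) i" if r: "r \<in> R" and g: "g \<in> Gs" for r g i
    proof -
      have X: "fps_nth ((1 + fps_X :: (lattice \<Rightarrow>\<^sub>0 'k) fps) ^ n) i \<in> R" for n i
      proof (induction n arbitrary: i)
        case 0
        show ?case by (simp add: R.zero_mem R.one_mem)
      next
        case (Suc n)
        show ?case unfolding one_plus_X_power_Suc_nth
          using Suc by (auto intro!: R.add_mem R.zero_mem)
      qed
      have "fps_nth (\<Phi> r) i \<in> R"
        unfolding \<Phi>_def poly_altdef fps_sum_nth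
        by (intro R.sum_mem) (simp add: coeff_map_poly R.mult_mem coeff_graded_R r X)
      then show ?thesis using g by (simp add: R_def)
    qed
    show "\<Phi> (gmon f) = fps_const (gmon f)" if "f \<in> Fix" "pr f = f" for f
      using that by (simp add: \<Phi>_def graded_Fix map_poly_pCons)
    show "\<Phi> (cst x) = fps_const (cst x)" for x
      using graded_single[OF mone_mem, of x] by (simp add: \<Phi>_def e_mone \<mu>_mone monom_0 map_poly_pCons)
  qed (auto intro: R.one_mem R.add_mem R.mult_mem R.uminus_mem)
  then show ?thesis
    by (simp add: lift_prime_def prime_action_axioms)
qed

text \<open>The image of \<open>e x\<close> is \<open>e x\<close> times a power of 1 + X with
  exponent \<open>\<mu> x\<close>, whose top coefficient is 1. So \<open>e x\<close> is a
  coefficient of positive index of its image.\<close>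

lemma e_ker:
  assumes x: "x \<in> Mc" and pos: "\<mu> x > 0"
  shows "e x \<in> ker"
proof -
  interpret lift_prime Gs pr _ \<Phi> g0 q by (rule \<Phi>_lift)
  have "map_poly fps_const (Polynomial.monom (e x) (\<mu> x)) = Polynomial.monom (fps_const (e x)) (\<mu> x)"
    by (rule poly_eqI) (simp add: coeff_map_poly)
  then have "fps_nth (\<Phi> (e x)) (\<mu> x) = e x"
    using one_plus_X_power_nth[of "\<mu> x", where 'a = "lattice \<Rightarrow>\<^sub>0 'k"]
    by (simp add: \<Phi>_def graded_e x poly_monom)
  then show ?thesis using \<Phi>_nth_ker[OF e_R[OF x] pos] by simp
qed

end

text \<open>Monomials with fixed exponent become 1 modulo \<open>ker\<close>. If some exponent is
  not fixed, a weight that detects it gives \<open>e x\<close> positive degree, and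
  \<open>e x\<close> lies in \<open>ker\<close>.\<close>

lemma e_const_mod_ker:
  assumes x: "x \<in> Mc"
  shows "\<exists>c. e x - cst c \<in> ker"
proof (cases "Poly_Mapping.keys (e x) \<subseteq> Fix")
  case True
  have "e x - cst (\<Sum>b\<in>Poly_Mapping.keys (e x). Poly_Mapping.lookup (e x) b)
      = (\<Sum>b\<in>Poly_Mapping.keys (e x). cst (Poly_Mapping.lookup (e x) b) * (gmon b - gmon 0))"
    using pm_expand[of "e x"]
    by (simp add: c.hom_sum single_eq_cst_mon right_diff_distrib sum_subtractf)
  also have "\<dots> \<in> ker"
    by (intro ker_sum ker_mult) (use True Fix_B in \<open>auto simp: gmon_diff_mem_ker simp del: gmon_zero\<close>)
  finally show ?thesis by blast
next
  case False
  then obtain b where b: "b \<in> Poly_Mapping.keys (e x)" "b \<notin> Fix" by blast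
  then obtain h where h: "h \<in> Gs" "h b \<noteq> b" by (auto simp: Fix_def)
  then obtain i where i: "Poly_Mapping.lookup (h b - b) i \<noteq> 0"
    by (metis eq_iff_diff_eq_0 lookup_zero poly_mapping_eqI)
  \<comment> \<open>A linear form that vanishes on \<open>Fix\<close> because \<open>h\<close> does
    not move fixed vectors, and that is nonzero at \<open>b\<close> by the choice of
    \<open>i\<close>.\<close>
  define w where "w a = Poly_Mapping.lookup (h a - a) i" for a
  have w_add: "w (a + b) = w a + w b" for a b
    by (simp add: w_def Gs_add[OF h(1)] lookup_minus lookup_add)
  have w_Fix: "w f = 0" if "f \<in> Fix" for f
  proof -
    have "h f = f" using that h(1) unfolding Fix_def by blast
    then show ?thesis by (simp add: w_def)
  qed
  have "w b \<noteq> 0" using i by (simp add: w_def)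
  then have "\<mu> w x > 0"
    using top_deg_pos(2)[of w, OF w_add w_Fix e_R[OF x] b(1)] by (simp add: \<mu>_def[OF w_add w_Fix])
  then have "e x \<in> ker" using e_ker[OF w_add w_Fix x] by blast
  then show ?thesis by (intro exI[of _ 0]) (simp add: c.hom_zero)
qed

text \<open>Expanding in the basis gives some constant; as the augmentation vanishes on
  \<open>ker\<close>, it identifies that constant.\<close>

lemma R_const_mod_ker:
  assumes r: "r \<in> R"
  shows "r - cst (augmentation r) \<in> ker"
proof -
  interpret aug: total_hom "augmentation :: (lattice \<Rightarrow>\<^sub>0 'k) \<Rightarrow> 'k" by (rule augmentation_hom)
  obtain \<kappa> where \<kappa>: "\<And>x. x \<in> Mc \<Longrightarrow> e x - cst (\<kappa> x) \<in> ker" using e_const_mod_ker by metis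
  let ?K = "Poly_Mapping.keys (\<theta> r)" and ?c = "Poly_Mapping.lookup (\<theta> r)"
  define C where "C = (\<Sum>x\<in>?K. ?c x * \<kappa> x)"
  have "r = (\<Sum>x\<in>?K. cst (?c x) * e x)" using \<theta>_expand[OF r] by (simp add: pm_eval_def)
  then have "r - cst C = (\<Sum>x\<in>?K. cst (?c x) * (e x - cst (\<kappa> x)))"
    by (simp add: C_def c.hom_sum c.hom_mult right_diff_distrib sum_subtractf)
  also have "\<dots> \<in> ker" by (intro ker_sum ker_mult \<kappa>) (use \<theta>_keys[OF r] in blast)
  finally have C: "r - cst C \<in> ker" .
  have "augmentation (cst C :: lattice \<Rightarrow>\<^sub>0 'k) = C"
    by (cases "C = 0") (simp_all add: cst_def augmentation_def pm_eval_def)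
  then have "augmentation r = C" using augmentation_ker[OF C] by (simp add: aug.hom_diff)
  then show ?thesis using C by simp
qed

text \<open>Modulo \<open>ker\<close> the coefficients of \<open>orbit_poly b\<close> are their
  augmentations, so the polynomial becomes a power of T - 1 and its root makes
  \<open>gmon b - 1\<close> nilpotent. Since \<open>gmon b ^ q\<close> is 1 modulo
  \<open>ker\<close> and \<open>q\<close> is invertible, \<open>gmon b - 1\<close> already lies in
  \<open>ker\<close>, although \<open>b\<close> was taken outside \<open>B\<close>.\<close>

theorem contradiction: False
proof -
  interpret aug: total_hom "augmentation :: (lattice \<Rightarrow>\<^sub>0 'k) \<Rightarrow> 'k" by (rule augmentation_hom)
  interpret augp: total_hom "map_poly (augmentation :: (lattice \<Rightarrow>\<^sub>0 'k) \<Rightarrow> 'k)" by (rule aug.map_poly_hom)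
  interpret cp: total_hom "map_poly (cst :: 'k \<Rightarrow> lattice \<Rightarrow>\<^sub>0 'k)" by (rule c.map_poly_hom)
  obtain b0 where b0: "b0 \<notin> B" using B_proper by blast
  \<comment> \<open>The orbit polynomial has coefficients in \<open>R\<close> for vectors in the
    image of \<open>pr\<close>; the part removed from \<open>b0\<close> is fixed, hence in
    \<open>B\<close>.\<close>
  define b where "b = pr b0"
  have b: "pr b = b" "b \<notin> B"
    using b0 add_B[OF _ Fix_B[OF pr_diff_Fix[of b0]], of b] by (auto simp: b_def pr_pr)
  define N where "N = card Gs"
  let ?f = "orbit_poly b"
  have "map_poly augmentation [:- gmon c, 1 :: lattice \<Rightarrow>\<^sub>0 'k:] = [:- 1, 1:]" for c :: lattice
    by (simp add: map_poly_pCons aug.hom_zero aug.hom_uminus aug.hom_one)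
  then have "map_poly augmentation ?f = [:- 1, 1:] ^ N"
    by (simp add: orbit_poly_def augp.hom_prod N_def)
  then have "map_poly cst (map_poly augmentation ?f) = ([:- 1, 1:] ^ N :: (lattice \<Rightarrow>\<^sub>0 'k) poly)"
    by (simp only: cp.hom_power[OF UNIV_I]) (simp add: map_poly_pCons c.hom_zero c.hom_uminus c.hom_one)
  then have pow: "poly (map_poly cst (map_poly augmentation ?f)) (gmon b) = (gmon b - 1) ^ N"
    by simp
  have "poly (?f - map_poly cst (map_poly augmentation ?f)) (gmon b) \<in> ker"
    unfolding poly_altdef
  proof (intro ker_sum ker_mult')
    fix i
    have "poly.coeff ?f i \<in> R" using orbit_poly_coeffs[OF b(1)] by blast
    then show "poly.coeff (?f - map_poly cst (map_poly augmentation ?f)) i \<in> ker"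
      using R_const_mod_ker by (simp add: coeff_map_poly c.hom_zero aug.hom_zero)
  qed
  then have "- ((gmon b - 1) ^ N) \<in> ker" using pow orbit_poly_root[of b] by simp
  from ker_uminus[OF this] have nilp: "(gmon b - 1) ^ N \<in> ker" by simp
  have root: "gmon b ^ q - 1 \<in> ker"
    using q_multiple_B[of b] gmon_diff_mem_ker[of "frag_cmul (int q) b" 0] by (simp add: gmon_multiple)
  \<comment> \<open>Modulo \<open>gmon b - 1\<close> this geometric sum is the invertible constant
    \<open>q\<close>, which lets \<open>down\<close> lower the exponent of the nilpotent by
    one.\<close>
  define s where "s = (\<Sum>i<q. gmon b ^ i :: lattice \<Rightarrow>\<^sub>0 'k)"
  have s: "gmon b ^ q - 1 = (gmon b - 1) * s"
    by (simp add: s_def power_diff_1_eq)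
  have "\<exists>v. s = of_nat q + (gmon b - 1) * v"
  proof -
    have "gmon b - 1 dvd (gmon b ^ i - 1 :: lattice \<Rightarrow>\<^sub>0 'k)" for i
      by (simp add: power_diff_1_eq)
    then have "gmon b - 1 dvd (\<Sum>i<q. gmon b ^ i - 1 :: lattice \<Rightarrow>\<^sub>0 'k)" by (rule dvd_sum)
    then obtain v where "(\<Sum>i<q. gmon b ^ i - 1 :: lattice \<Rightarrow>\<^sub>0 'k) = (gmon b - 1) * v" by (auto simp: dvd_def)
    then have "s = of_nat q + (gmon b - 1) * v" by (simp add: s_def sum_subtractf algebra_simps)
    then show ?thesis by blast
  qed
  then obtain v where v: "s = of_nat q + (gmon b - 1) * v" by blast
  have down: "(gmon b - 1) ^ Suc j \<in> ker" if "(gmon b - 1) ^ Suc (Suc j) \<in> ker" for j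
  proof -
    have 1: "(gmon b - 1) ^ j * ((gmon b - 1) * s) \<in> ker" using ker_mult[OF root] unfolding s .
    have "of_nat q * (gmon b - 1) ^ Suc j
      = (gmon b - 1) ^ j * ((gmon b - 1) * s) - v * (gmon b - 1) ^ Suc (Suc j)"
      unfolding v by (simp add: algebra_simps)
    also have "\<dots> \<in> ker" by (intro ker_diff 1 ker_mult that)
    finally show ?thesis by (rule ker_cancel_q)
  qed
  have "(gmon b - 1) ^ Suc j \<in> ker \<Longrightarrow> gmon b - 1 \<in> ker" for j
    by (induction j) (use down in auto)
  moreover have "N > 0" using finite_Gs id_Gs by (auto simp: N_def card_gt_0_iff)
  ultimately have "gmon b - gmon 0 \<in> ker" using nilp by (metis Suc_pred gmon_zero)
  then show False using b by (simp add: gmon_diff_mem_ker del: gmon_zero)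
qed

end

section \<open>From the abstract action to an action on the lattice\<close>

lemma restrict_keys_add:
  "restrict_keys S (f + h) = restrict_keys S f + restrict_keys S (h :: 'v \<Rightarrow>\<^sub>0 'k::comm_monoid_add)"
  by (rule poly_mapping_eqI) (simp add: lookup_add when_def)

lemma keys_restrict_keys: "Poly_Mapping.keys (restrict_keys S f) = Poly_Mapping.keys f \<inter> S"
  by (auto simp: in_keys_iff when_def split: if_splits)

lemma restrict_keys_id: "Poly_Mapping.keys f \<subseteq> S \<Longrightarrow> restrict_keys S f = f"
  by (rule poly_mapping_eqI) (auto simp: when_def in_keys_iff)

lemma int_subgroup_generator:
  fixes W :: "int set"
  assumes x: "x \<in> W" "x \<noteq> 0" and diff: "\<And>a b. a \<in> W \<Longrightarrow> b \<in> W \<Longrightarrow> a - b \<in> W"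
  shows "\<exists>d\<in>W. d \<noteq> 0 \<and> (\<forall>a\<in>W. d dvd a)"
proof -
  have zero: "0 \<in> W" using diff[OF x(1) x(1)] by simp
  have neg: "- a \<in> W" if "a \<in> W" for a using diff[OF zero that] by simp
  have sub_mult: "b - int k * a \<in> W" if "a \<in> W" "b \<in> W" for k a b
  proof (induction k)
    case 0
    show ?case using that by simp
  next
    case (Suc k)
    have "b - int (Suc k) * a = (b - int k * a) - a" by (simp add: algebra_simps)
    then show ?case using diff[OF Suc that(1)] by (simp only:)
  qed
  have mod_mem: "b mod a \<in> W" if "a \<in> W" "b \<in> W" for a b
  proof (cases "b div a \<ge> 0")
    case True
    then have "b mod a = b - int (nat (b div a)) * a" by (simp add: minus_div_mult_eq_mod)
    then show ?thesis using sub_mult[OF that] by (simp only:)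
  next
    case False
    then have "b mod a = b - int (nat (- (b div a))) * (- a)" by (simp add: minus_div_mult_eq_mod)
    then show ?thesis using sub_mult[OF neg[OF that(1)] that(2)] by (simp only:)
  qed
  have "\<bar>x\<bar> \<in> W" using x(1) neg[OF x(1)] by (cases "x \<ge> 0") (simp_all add: abs_if)
  then have ex: "\<exists>m. int m \<in> W \<and> m > 0" using x(2) by (intro exI[of _ "nat \<bar>x\<bar>"]) simp
  define d where "d = (LEAST m. int m \<in> W \<and> m > 0)"
  have d: "int d \<in> W" "d > 0" using LeastI_ex[OF ex] by (simp_all add: d_def)
  have "int d dvd a" if a: "a \<in> W" for a
  proof -
    define m where "m = nat (a mod int d)"
    have m: "int m = a mod int d" using d(2) by (simp add: m_def)
    have "m < d" using d(2) m by (metis of_nat_less_iff of_nat_0_less_iff pos_mod_bound)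
    moreover have "int m \<in> W" unfolding m by (rule mod_mem[OF d(1) a])
    ultimately have "\<not> m > 0" using not_less_Least[of m "\<lambda>m. int m \<in> W \<and> m > 0"] by (simp add: d_def)
    then have "a mod int d = 0" using m by linarith
    then show ?thesis by (rule mod_0_imp_dvd)
  qed
  then show ?thesis using d by (intro bexI[of _ "int d"]) auto
qed

locale multiplicative_action = A: comm_group A + G: group G
  for A :: "('a, 'b) monoid_scheme" and G :: "('g, 'c) monoid_scheme" +
  fixes \<phi> :: "'g \<Rightarrow> 'a \<Rightarrow> 'a" and n :: nat and f :: "'a \<Rightarrow> lattice" and type_k :: "'k::field itself"
  assumes f_iso: "f \<in> iso A (free_Abelian_group {..<n})"
    and finite_G: "finite (carrier G)"
    and \<phi>_hom: "\<phi> \<in> hom G (AutoGroup A)" and \<phi>_inj: "inj_on \<phi> (carrier G)"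
    and char: "\<not> CHAR('k) dvd Coset.order G"
    and fpf: "fixed_point_free G (A Mod fixed_subgroup G A \<phi>) (coset_action \<phi>)"
    and rank: "free_rank (A Mod fixed_subgroup G A \<phi>) \<ge> 2"
begin

definition pr :: "lattice \<Rightarrow> lattice"
  where "pr c = restrict_keys {..<n} c"

definition f' :: "lattice \<Rightarrow> 'a"
  where "f' = inv_into (carrier A) f"

definition gt :: "'g \<Rightarrow> lattice \<Rightarrow> lattice"
  where "gt g c = f (\<phi> g (f' (pr c))) + (c - pr c)"

abbreviation FA :: "'a set"
  where "FA \<equiv> fixed_subgroup G A \<phi>"

lemma pr_add: "pr (a + b) = pr a + pr b"
  by (simp add: pr_def restrict_keys_add)

lemma pr_iff: "pr c = c \<longleftrightarrow> Poly_Mapping.keys c \<subseteq> {..<n}"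
proof
  assume "pr c = c"
  then have "Poly_Mapping.keys c = Poly_Mapping.keys c \<inter> {..<n}"
    using keys_restrict_keys[of "{..<n}" c] by (simp only: pr_def)
  then show "Poly_Mapping.keys c \<subseteq> {..<n}" by blast
next
  assume "Poly_Mapping.keys c \<subseteq> {..<n}"
  then show "pr c = c" unfolding pr_def by (rule restrict_keys_id)
qed

lemma pr_pr: "pr (pr a) = pr a"
  by (rule poly_mapping_eqI) (simp add: pr_def when_def)

lemma f_bij: "bij_betw f (carrier A) {c. pr c = c}"
  using f_iso by (simp add: iso_def free_Abelian_group_def pr_iff)

lemma f_mult: "a \<in> carrier A \<Longrightarrow> b \<in> carrier A \<Longrightarrow> f (a \<otimes>\<^bsub>A\<^esub> b) = f a + f b"
  using f_iso by (simp add: iso_def hom_def free_Abelian_group_def)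

lemma pr_f: "a \<in> carrier A \<Longrightarrow> pr (f a) = f a"
  using f_bij by (auto simp: bij_betw_def)

lemma f'_mem: "pr c = c \<Longrightarrow> f' c \<in> carrier A"
  using f_bij unfolding f'_def bij_betw_def by (intro inv_into_into) auto

lemma f_f': "pr c = c \<Longrightarrow> f (f' c) = c"
  using f_bij unfolding f'_def bij_betw_def by (intro f_inv_into_f) auto

lemma f'_f: "a \<in> carrier A \<Longrightarrow> f' (f a) = a"
  using f_bij unfolding f'_def bij_betw_def by (simp add: inv_into_f_f)

lemma f_inj: "a \<in> carrier A \<Longrightarrow> b \<in> carrier A \<Longrightarrow> f a = f b \<longleftrightarrow> a = b"
  by (rule inj_on_eq_iff[OF bij_betw_imp_inj_on[OF f_bij]])

lemma f_one: "f \<one>\<^bsub>A\<^esub> = 0"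
  using f_mult[OF A.one_closed A.one_closed]
  by (simp only: A.r_one[OF A.one_closed] add_cancel_right_right)

lemma f_inv: "a \<in> carrier A \<Longrightarrow> f (inv\<^bsub>A\<^esub> a) = - f a"
proof -
  assume a: "a \<in> carrier A"
  have "f a + f (inv\<^bsub>A\<^esub> a) = 0"
    using f_mult[OF a A.inv_closed[OF a]] by (simp only: A.r_inv[OF a] f_one)
  then show ?thesis by (rule minus_unique[symmetric])
qed

lemma \<phi>_auto: "g \<in> carrier G \<Longrightarrow> \<phi> g \<in> hom A A \<and> \<phi> g \<in> Bij (carrier A)"
  using \<phi>_hom by (auto simp: hom_def AutoGroup_def auto_def)

lemma \<phi>_mem: "g \<in> carrier G \<Longrightarrow> a \<in> carrier A \<Longrightarrow> \<phi> g a \<in> carrier A"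
  using \<phi>_auto by (auto simp: hom_def)

lemma \<phi>_mult: "g \<in> carrier G \<Longrightarrow> a \<in> carrier A \<Longrightarrow> b \<in> carrier A \<Longrightarrow> \<phi> g (a \<otimes>\<^bsub>A\<^esub> b) = \<phi> g a \<otimes>\<^bsub>A\<^esub> \<phi> g b"
  using \<phi>_auto by (auto simp: hom_def)

lemma \<phi>_comp:
  assumes "g \<in> carrier G" "h \<in> carrier G" "a \<in> carrier A"
  shows "\<phi> (g \<otimes>\<^bsub>G\<^esub> h) a = \<phi> g (\<phi> h a)"
proof -
  have "\<phi> (g \<otimes>\<^bsub>G\<^esub> h) = \<phi> g \<otimes>\<^bsub>AutoGroup A\<^esub> \<phi> h" using \<phi>_hom assms by (simp add: hom_def)
  also have "\<dots> = compose (carrier A) (\<phi> g) (\<phi> h)"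
    using \<phi>_auto assms by (simp add: AutoGroup_def BijGroup_def)
  finally show ?thesis using assms by (simp add: compose_def)
qed

lemma \<phi>_one: "a \<in> carrier A \<Longrightarrow> \<phi> \<one>\<^bsub>G\<^esub> a = a"
proof -
  have "group_hom G (AutoGroup A) \<phi>"
    by (simp add: group_hom_def group_hom_axioms_def \<phi>_hom A.AutoGroup G.is_group)
  then have "\<phi> \<one>\<^bsub>G\<^esub> = \<one>\<^bsub>AutoGroup A\<^esub>" by (rule group_hom.hom_one)
  moreover assume "a \<in> carrier A"
  ultimately show ?thesis by (simp add: AutoGroup_def BijGroup_def)
qed

lemma \<phi>_extensional: "g \<in> carrier G \<Longrightarrow> \<phi> g \<in> extensional (carrier A)"
  using \<phi>_auto by (auto simp: Bij_def)

lemma gt_f: "a \<in> carrier A \<Longrightarrow> gt g (f a) = f (\<phi> g a)"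
  by (simp add: gt_def pr_f f'_f)

lemma pr_gt: "g \<in> carrier G \<Longrightarrow> pr (gt g c) = f (\<phi> g (f' (pr c)))"
  using pr_f[OF \<phi>_mem[OF _ f'_mem[OF pr_pr[of c]]]]
  by (simp add: gt_def pr_add additive_diff[of pr, OF pr_add] pr_pr)

lemma gt_pr: "g \<in> carrier G \<Longrightarrow> gt g (pr c) = pr (gt g c)"
  by (simp add: pr_gt) (simp add: gt_def pr_pr)

lemma gt_split: "gt g c = gt g (pr c) + (c - pr c)"
  by (simp add: gt_def pr_pr)

lemma f'_add: "pr a = a \<Longrightarrow> pr b = b \<Longrightarrow> f' (a + b) = f' a \<otimes>\<^bsub>A\<^esub> f' b"
proof -
  assume ab: "pr a = a" "pr b = b"
  have "f (f' a \<otimes>\<^bsub>A\<^esub> f' b) = a + b" using ab by (simp add: f_mult f'_mem f_f')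
  then show ?thesis using f'_f[OF A.m_closed[OF f'_mem[OF ab(1)] f'_mem[OF ab(2)]]] by simp
qed

lemma gt_add: "g \<in> carrier G \<Longrightarrow> gt g (a + b) = gt g a + gt g b"
  by (simp add: gt_def pr_add f'_add pr_pr \<phi>_mult f'_mem f_mult \<phi>_mem algebra_simps)

lemma gt_comp: "g \<in> carrier G \<Longrightarrow> h \<in> carrier G \<Longrightarrow> gt (g \<otimes>\<^bsub>G\<^esub> h) = gt g \<circ> gt h"
proof
  fix c
  assume gh: "g \<in> carrier G" "h \<in> carrier G"
  have "gt g (gt h c) = gt g (f (\<phi> h (f' (pr c)))) + (gt h c - pr (gt h c))"
    by (subst gt_split) (simp only: pr_gt gh)
  also have "\<dots> = f (\<phi> g (\<phi> h (f' (pr c)))) + (c - pr c)"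
    using gh by (simp add: gt_f \<phi>_mem f'_mem pr_pr pr_gt) (simp add: gt_def)
  finally show "gt (g \<otimes>\<^bsub>G\<^esub> h) c = (gt g \<circ> gt h) c"
    using gh by (simp add: gt_def[of "g \<otimes>\<^bsub>G\<^esub> h"] \<phi>_comp f'_mem pr_pr)
qed

lemma gt_one: "gt \<one>\<^bsub>G\<^esub> = id"
  by (rule ext) (simp add: gt_def \<phi>_one f'_mem pr_pr f_f')

lemma gt_inj: "inj_on gt (carrier G)"
proof (rule inj_onI)
  fix g h assume gh: "g \<in> carrier G" "h \<in> carrier G" "gt g = gt h"
  have "\<phi> g a = \<phi> h a" if "a \<in> carrier A" for a
    using gt_f[OF that, of g] gt_f[OF that, of h] gh f_inj[OF \<phi>_mem \<phi>_mem] that by simp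
  then have "\<phi> g = \<phi> h" using \<phi>_extensional gh by (meson extensionalityI)
  then show "g = h" using \<phi>_inj gh by (auto dest: inj_onD)
qed

definition Gs :: "(lattice \<Rightarrow> lattice) set"
  where "Gs = gt ` carrier G"

sublocale act: lattice_action Gs pr type_k
proof
  show "finite Gs" by (simp add: Gs_def finite_G)
  show "id \<in> Gs"
    unfolding Gs_def using imageI[OF G.one_closed, of gt] by (simp only: gt_one)
  show "pr (a + b) = pr a + pr b" "pr (pr a) = pr a" for a b by (rule pr_add pr_pr)+
  show "g (a + b) = g a + g b" if "g \<in> Gs" for g a b using that by (auto simp: Gs_def gt_add)
  show "g \<circ> h \<in> Gs" if "g \<in> Gs" "h \<in> Gs" for g h
    using that unfolding Gs_def by (auto simp: gt_comp[symmetric])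
  show "\<exists>h\<in>Gs. h \<circ> g = id \<and> g \<circ> h = id" if gGs: "g \<in> Gs" for g
  proof -
    obtain x where x: "x \<in> carrier G" "g = gt x" using gGs by (auto simp: Gs_def)
    have "gt (inv\<^bsub>G\<^esub> x) \<circ> g = id" "g \<circ> gt (inv\<^bsub>G\<^esub> x) = id"
      using x by (simp_all add: gt_comp[symmetric] gt_one)
    then show ?thesis using x by (auto simp: Gs_def)
  qed
  show "g (pr a) = pr (g a)" if "g \<in> Gs" for g a using that by (auto simp: Gs_def gt_pr)
  show "g (a - pr a) = a - pr a" if gGs: "g \<in> Gs" for g a
  proof -
    obtain x where x: "x \<in> carrier G" "g = gt x" using gGs by (auto simp: Gs_def)
    have "pr (a - pr a) = 0" by (simp add: additive_diff[of pr, OF pr_add] pr_pr)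
    then have "gt x (a - pr a) = gt x 0 + (a - pr a)" using gt_split[of x "a - pr a"] by simp
    moreover have "gt x 0 = 0" by (rule additive_zero) (rule gt_add[OF x(1)])
    ultimately show ?thesis using x by simp
  qed
qed

lemma Fix_f: "a \<in> carrier A \<Longrightarrow> f a \<in> act.Fix \<longleftrightarrow> a \<in> FA"
  unfolding act.Fix_def unfolding Gs_def fixed_subgroup_def by (auto simp: gt_f f_inj \<phi>_mem)

lemma FA_subgroup: "subgroup FA A"
proof
  show "FA \<subseteq> carrier A" by (auto simp: fixed_subgroup_def)
  show "\<one>\<^bsub>A\<^esub> \<in> FA" using Fix_f[of "\<one>\<^bsub>A\<^esub>"] act.Fix_zero by (simp add: f_one)
  fix x y assume x: "x \<in> FA"
  then have xA: "x \<in> carrier A" by (auto simp: fixed_subgroup_def)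
  show "inv\<^bsub>A\<^esub> x \<in> FA"
    using Fix_f[of "inv\<^bsub>A\<^esub> x"] Fix_f[of x] act.Fix_uminus x xA by (simp add: f_inv)
  assume y: "y \<in> FA"
  then have yA: "y \<in> carrier A" by (auto simp: fixed_subgroup_def)
  show "x \<otimes>\<^bsub>A\<^esub> y \<in> FA"
    using Fix_f[of "x \<otimes>\<^bsub>A\<^esub> y"] Fix_f[of x] Fix_f[of y] act.Fix_add x y xA yA by (simp add: f_mult)
qed

sublocale FA: normal FA A
  by (rule A.subgroup_imp_normal[OF FA_subgroup])

text \<open>The first isomorphism theorem; used with \<open>m\<close> equal to 0 and 1 to contradict
  the rank hypothesis.\<close>

lemma free_rank_quotient:
  assumes H: "H \<in> hom A (free_Abelian_group {..<m})" and onto: "H ` carrier A = carrier (free_Abelian_group {..<m})"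
    and ker: "\<And>a. a \<in> carrier A \<Longrightarrow> H a = 0 \<longleftrightarrow> a \<in> FA"
  shows "free_rank (A Mod FA) = m"
proof (rule free_rank_eq)
  show "Group.group (A Mod FA)" by (rule FA.factorgroup_is_group)
  interpret group_hom A "free_Abelian_group {..<m}" H
    by (simp add: group_hom_def group_hom_axioms_def H A.is_group)
  have "kernel A (free_Abelian_group {..<m}) H = FA"
    using ker FA.subset by (auto simp: kernel_def free_Abelian_group_def)
  then show "free_abelian_of_rank (A Mod FA) m"
    using FactGroup_iso[OF onto] by (simp add: free_abelian_of_rank_def)
qed

lemma nontrivial: "\<exists>b. b \<notin> act.Fix"
proof (rule ccontr)
  assume "\<not> (\<exists>b. b \<notin> act.Fix)"
  then have "a \<in> FA" if "a \<in> carrier A" for a using Fix_f[OF that] by blast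
  then have "free_rank (A Mod FA) = 0"
    by (intro free_rank_quotient[of "\<lambda>_. 0"])
       (auto simp: hom_def free_Abelian_group_def intro!: image_eqI[of _ _ "\<one>\<^bsub>A\<^esub>"])
  then show False using rank by simp
qed

text \<open>If \<open>g c - c\<close> is fixed, then the corresponding group element stabilizes the
  coset of \<open>a\<close>. That coset is then trivial, so \<open>a\<close> is fixed.\<close>

lemma action_fpf:
  assumes g: "g \<in> Gs" "g \<noteq> id" and c: "g c - c \<in> act.Fix"
  shows "c \<in> act.Fix"
proof -
  obtain x where x: "x \<in> carrier G" "g = gt x" using g by (auto simp: Gs_def)
  then have x1: "x \<noteq> \<one>\<^bsub>G\<^esub>" using g gt_one by auto
  define a where "a = f' (pr c)"
  have a: "a \<in> carrier A" "f a = pr c" by (simp_all add: a_def f'_mem f_f' pr_pr)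
  have "g c - c = f (\<phi> x a) - f a"
    using a by (simp add: x gt_def a_def[symmetric])
  also have "\<dots> = f (\<phi> x a \<otimes>\<^bsub>A\<^esub> inv\<^bsub>A\<^esub> a)"
    using a x by (simp add: f_mult f_inv \<phi>_mem)
  finally have eq: "g c - c = f (\<phi> x a \<otimes>\<^bsub>A\<^esub> inv\<^bsub>A\<^esub> a)" .
  have "\<phi> x a \<otimes>\<^bsub>A\<^esub> inv\<^bsub>A\<^esub> a \<in> carrier A" using a(1) x(1) by (simp add: \<phi>_mem)
  then have mem: "\<phi> x a \<otimes>\<^bsub>A\<^esub> inv\<^bsub>A\<^esub> a \<in> FA"
    using c unfolding eq by (simp only: Fix_f)
  have FA_fixed: "\<phi> x y = y" if "y \<in> FA" for y using that x(1) unfolding fixed_subgroup_def by blast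
  have "\<phi> x ` (FA #>\<^bsub>A\<^esub> a) = FA #>\<^bsub>A\<^esub> \<phi> x a"
  proof -
    have coset: "FA #>\<^bsub>A\<^esub> b = (\<lambda>y. y \<otimes>\<^bsub>A\<^esub> b) ` FA" for b unfolding r_coset_def by blast
    show ?thesis unfolding coset image_image
    proof (rule image_cong[OF refl])
      fix y assume y: "y \<in> FA"
      then have "y \<in> carrier A" using FA.subset by blast
      then show "\<phi> x (y \<otimes>\<^bsub>A\<^esub> a) = y \<otimes>\<^bsub>A\<^esub> \<phi> x a"
        by (simp only: \<phi>_mult[OF x(1) _ a(1)] FA_fixed[OF y])
    qed
  qed
  also have "\<dots> = FA #>\<^bsub>A\<^esub> a"
  proof -
    have "\<phi> x a = (\<phi> x a \<otimes>\<^bsub>A\<^esub> inv\<^bsub>A\<^esub> a) \<otimes>\<^bsub>A\<^esub> a"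
      using a x by (simp add: A.m_assoc \<phi>_mem)
    then have "\<phi> x a \<in> FA #>\<^bsub>A\<^esub> a" using mem unfolding r_coset_def by blast
    from A.repr_independence[OF this a(1) FA_subgroup] show ?thesis by (rule sym)
  qed
  finally have "coset_action \<phi> x (FA #>\<^bsub>A\<^esub> a) = FA #>\<^bsub>A\<^esub> a" by (simp add: coset_action_def)
  moreover have "FA #>\<^bsub>A\<^esub> a \<in> carrier (A Mod FA)"
    using a by (auto simp: FactGroup_def RCOSETS_def)
  ultimately have "FA #>\<^bsub>A\<^esub> a \<in> {C \<in> carrier (A Mod FA). coset_action \<phi> x C = C}" by blast
  also have "\<dots> = {\<one>\<^bsub>A Mod FA\<^esub>}"
    using fpf x(1) x1 unfolding fixed_point_free_def by blast
  finally have "FA #>\<^bsub>A\<^esub> a = FA" by (simp add: FactGroup_def)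
  then have "a \<in> FA" using A.rcos_self[OF a(1) FA_subgroup] by simp
  then have "pr c \<in> act.Fix" using Fix_f[OF a(1)] unfolding a(2) by blast
  then show ?thesis by (simp only: act.Fix_pr)
qed

text \<open>Without such a \<open>c\<close>, each vector in the image of \<open>pr\<close> satisfies
  a nontrivial relation with \<open>b\<close> modulo \<open>Fix\<close>. A form that vanishes on
  \<open>Fix\<close> but not at \<open>b\<close> then has no kernel beyond \<open>Fix\<close> there,
  and embeds the quotient into the integers.\<close>

lemma action_indep:
  assumes b: "b \<notin> act.Fix"
  shows "\<exists>c. pr c = c \<and> (\<forall>i j. frag_cmul i c + frag_cmul j b \<in> act.Fix \<longrightarrow> i = 0 \<and> j = 0)"
proof (rule ccontr)
  assume neg: "\<not> ?thesis"
  obtain h where h: "h \<in> Gs" "h b \<noteq> b" using b unfolding act.Fix_def by blast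
  then have "\<exists>i. Poly_Mapping.lookup (h b - b) i \<noteq> 0"
    by (metis eq_iff_diff_eq_0 lookup_zero poly_mapping_eqI)
  then obtain i where i: "Poly_Mapping.lookup (h b - b) i \<noteq> 0" by blast
  define w where "w a = Poly_Mapping.lookup (h a - a) i" for a
  have w_add: "w (a + c) = w a + w c" for a c
    by (simp add: w_def act.Gs_add[OF h(1)] lookup_minus lookup_add)
  have w_cmul: "w (frag_cmul k a) = k * w a" for k a
    by (simp add: w_def act.Gs_cmul[OF h(1)] lookup_minus algebra_simps)
  have w_Fix: "w c = 0" if "c \<in> act.Fix" for c
  proof -
    have "h c = c" using that h(1) unfolding act.Fix_def by blast
    then show ?thesis by (simp add: w_def)
  qed
  have wb: "w b \<noteq> 0" using i by (simp add: w_def)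
  have w_ker: "c \<in> act.Fix" if c: "pr c = c" and "w c = 0" for c
  proof -
    obtain k j where kj: "frag_cmul k c + frag_cmul j b \<in> act.Fix" "\<not> (k = 0 \<and> j = 0)"
      using neg c by blast
    then have "k * w c + j * w b = 0" using w_Fix[OF kj(1)] by (simp only: w_add w_cmul)
    then have j: "j = 0" using \<open>w c = 0\<close> wb by simp
    then have "k \<noteq> 0" "frag_cmul k c \<in> act.Fix" using kj by simp_all
    then show ?thesis using act.Fix_cmul by blast
  qed
  define W where "W = w ` {c. pr c = c}"
  have "w (pr b) = w b"
    using w_add[of "b - pr b" "pr b"] w_Fix[OF act.pr_diff_Fix[of b]] by simp
  then have "w b \<in> W" unfolding W_def using pr_pr[of b] by (intro image_eqI[of _ _ "pr b"]) auto
  moreover have "x - y \<in> W" if xy: "x \<in> W" "y \<in> W" for x y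
  proof -
    obtain a c where "x = w a" "y = w c" "pr a = a" "pr c = c" using xy by (auto simp: W_def)
    then have "x - y = w (a - c)" "pr (a - c) = a - c"
      by (simp_all add: additive_diff[of w, OF w_add] additive_diff[of pr, OF pr_add])
    then show ?thesis unfolding W_def by blast
  qed
  ultimately obtain d where d: "d \<in> W" "d \<noteq> 0" "\<forall>a\<in>W. d dvd a"
    using int_subgroup_generator[of "w b" W] wb by blast
  \<comment> \<open>Dividing by the generator \<open>d\<close> of the value group makes the form
    onto the integers, written as the free abelian group on the one generator 0.\<close>
  define H where "H a = frag_cmul (w (f a) div d) (frag_of (0::nat))" for a
  have fW: "d dvd w (f a)" if "a \<in> carrier A" for a
    using d(3) pr_f[OF that] unfolding W_def by blast
  have "free_rank (A Mod FA) = 1"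
  proof (rule free_rank_quotient[of H])
    have keys: "Poly_Mapping.keys (frag_cmul k (frag_of (0::nat))) \<subseteq> {..<1}" for k
      using keys_cmul[of k "frag_of (0::nat)"] by (auto simp: keys_frag_of)
    show "H \<in> hom A (free_Abelian_group {..<1})"
      using keys by (auto simp: hom_def free_Abelian_group_def H_def f_mult w_add div_plus_div_distrib_dvd_left[OF fW] frag_cmul_distrib)
    show "H ` carrier A = carrier (free_Abelian_group {..<1})"
    proof
      show "H ` carrier A \<subseteq> carrier (free_Abelian_group {..<1})"
        using keys by (auto simp: free_Abelian_group_def H_def)
      show "carrier (free_Abelian_group {..<1}) \<subseteq> H ` carrier A"
      proof
        fix z assume "z \<in> carrier (free_Abelian_group {..<1::nat})"
        then have z: "Poly_Mapping.keys z \<subseteq> {0}" by (auto simp: free_Abelian_group_def)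
        have zeq: "z = frag_cmul (Poly_Mapping.lookup z 0) (frag_of 0)"
        proof (rule poly_mapping_eqI)
          fix k
          have "Poly_Mapping.lookup z k = 0" if "k \<noteq> 0"
            using z that unfolding in_keys_iff[symmetric] not_in_keys_iff_lookup_eq_zero[symmetric] by blast
          then show "Poly_Mapping.lookup z k = Poly_Mapping.lookup (frag_cmul (Poly_Mapping.lookup z 0) (frag_of 0)) k"
            by (cases "k = 0") (simp_all add: lookup_one)
        qed
        obtain c where c: "d = w c" "pr c = c" using d(1) by (auto simp: W_def)
        let ?c = "frag_cmul (Poly_Mapping.lookup z 0) c"
        have prc: "pr ?c = ?c" using c additive_frag_cmul[of pr, OF pr_add] by simp
        have "H (f' ?c) = z"
          unfolding H_def f_f'[OF prc] w_cmul c(1)[symmetric] using d(2) zeq by simp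
        then show "z \<in> H ` carrier A" using imageI[OF f'_mem[OF prc], of H] by (simp only:)
      qed
    qed
    show "H a = 0 \<longleftrightarrow> a \<in> FA" if a: "a \<in> carrier A" for a
    proof -
      have "H a = 0 \<longleftrightarrow> w (f a) div d = 0"
        by (simp add: H_def)
      also have "\<dots> \<longleftrightarrow> w (f a) = 0" using fW[OF a] d(2) by (simp add: dvd_div_eq_0_iff)
      also have "\<dots> \<longleftrightarrow> f a \<in> act.Fix" using w_ker[OF pr_f[OF a]] w_Fix by blast
      finally show ?thesis using Fix_f[OF a] by simp
    qed
  qed
  then show False using rank by simp
qed

sublocale act: fpf_action Gs pr type_k
proof unfold_locales
  show "a \<in> act.Fix" if "g \<in> Gs" "g \<noteq> id" "g a - a \<in> act.Fix" for g a
    using that by (rule action_fpf)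
  show "\<exists>c. pr c = c \<and> (\<forall>m n. frag_cmul m c + frag_cmul n b \<in> act.Fix \<longrightarrow> m = 0 \<and> n = 0)"
    if "b \<notin> act.Fix" for b
    using that by (rule action_indep)
  show "\<exists>b. b \<notin> act.Fix" by (rule nontrivial)
qed

lemma gt_pow: "x \<in> carrier G \<Longrightarrow> gt (x [^]\<^bsub>G\<^esub> (m::nat)) = gt x ^^ m"
  by (induction m) (simp_all add: gt_one gt_comp funpow_swap1 fun_eq_iff)

text \<open>Some power of a nontrivial group element has prime order \<open>q\<close>. As
  \<open>q\<close> divides the group order, it is nonzero in the field.\<close>

lemma prime_order_element:
  "\<exists>g0 q. g0 \<in> Gs \<and> g0 \<noteq> id \<and> Factorial_Ring.prime q \<and> g0 ^^ q = id \<and> of_nat q \<noteq> (0 :: 'k)"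
proof -
  obtain b where "b \<notin> act.Fix" using nontrivial by blast
  then obtain h where h: "h \<in> Gs" "h b \<noteq> b" unfolding act.Fix_def by blast
  then obtain x where x: "x \<in> carrier G" "h = gt x" unfolding Gs_def by blast
  have "x \<noteq> \<one>\<^bsub>G\<^esub>"
  proof
    assume "x = \<one>\<^bsub>G\<^esub>"
    then show False using h(2) unfolding x(2) by (simp add: gt_one)
  qed
  then have "G.ord x \<noteq> 1" using G.ord_eq_1[OF x(1)] by simp
  then obtain q where q: "Factorial_Ring.prime q" "q dvd G.ord x" using prime_factor_nat by blast
  have ord_pos: "G.ord x > 0" using G.ord_ge_1[OF finite_G x(1)] by simp
  define k where "k = G.ord x div q"
  have k: "G.ord x = q * k" "k > 0" using q ord_pos by (auto simp: k_def)
  have yk: "(x [^]\<^bsub>G\<^esub> k) [^]\<^bsub>G\<^esub> q = \<one>\<^bsub>G\<^esub>"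
    using G.pow_ord_eq_1[OF x(1)] unfolding k(1) G.nat_pow_pow[OF x(1)] by (simp only: mult.commute)
  have y1: "x [^]\<^bsub>G\<^esub> k \<noteq> \<one>\<^bsub>G\<^esub>"
  proof
    assume "x [^]\<^bsub>G\<^esub> k = \<one>\<^bsub>G\<^esub>"
    then have "G.ord x dvd k" using G.pow_eq_id[OF x(1)] by simp
    then have "q * k \<le> k" unfolding k(1) by (rule dvd_imp_le) (rule k(2))
    then show False using k(2) prime_gt_1_nat[OF q(1)] by simp
  qed
  let ?g = "gt (x [^]\<^bsub>G\<^esub> k)"
  have mem: "x [^]\<^bsub>G\<^esub> k \<in> carrier G" using x by simp
  have "?g \<in> Gs" using mem by (simp add: Gs_def)
  moreover have "?g \<noteq> id"
    unfolding gt_one[symmetric] using inj_onD[OF gt_inj _ mem G.one_closed] y1 by blast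
  moreover have "?g ^^ q = id" unfolding gt_pow[OF mem, symmetric] yk by (rule gt_one)
  moreover have "of_nat q \<noteq> (0 :: 'k)"
  proof
    assume "of_nat q = (0 :: 'k)"
    then have "CHAR('k) dvd q" by (simp add: of_nat_eq_0_iff_char_dvd)
    then show False
      using q(2) G.ord_dvd_group_order[OF x(1)] char dvd_trans by blast
  qed
  ultimately show ?thesis using q(1) by blast
qed

end

section \<open>Transport of the invariant algebra to the lattice\<close>

definition push :: "('a \<Rightarrow> 'b) \<Rightarrow> ('a \<Rightarrow>\<^sub>0 'k) \<Rightarrow> ('b \<Rightarrow>\<^sub>0 'k::field)"
  where "push s p = (\<Sum>a\<in>Poly_Mapping.keys p. Poly_Mapping.single (s a) (Poly_Mapping.lookup p a))"

text \<open>\<open>push\<close> allows source and target of different types, as needed to pass from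
  the type of \<open>A\<close> to the lattice; on a common type it is the linear extension.\<close>

lemma linear_extension_eq_push: "linear_extension s = push s"
  by (rule ext) (simp add: linear_extension_def push_def)

lemma push_superset:
  assumes "finite S" "Poly_Mapping.keys p \<subseteq> S"
  shows "push s p = (\<Sum>a\<in>S. Poly_Mapping.single (s a) (Poly_Mapping.lookup p a))"
  unfolding push_def
  by (rule sum.mono_neutral_left) (use assms in \<open>auto simp: in_keys_iff\<close>)

lemma push_zero: "push s 0 = 0"
  by (simp add: push_def)

lemma push_add: "push s (p + q) = push s p + push s q"
proof -
  let ?S = "Poly_Mapping.keys p \<union> Poly_Mapping.keys q"
  have "push s (p + q) = (\<Sum>a\<in>?S. Poly_Mapping.single (s a) (Poly_Mapping.lookup (p + q) a))"
    by (rule push_superset) (use keys_add[of p q] in auto)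
  moreover have "push s p = (\<Sum>a\<in>?S. Poly_Mapping.single (s a) (Poly_Mapping.lookup p a))"
    by (rule push_superset) auto
  moreover have "push s q = (\<Sum>a\<in>?S. Poly_Mapping.single (s a) (Poly_Mapping.lookup q a))"
    by (rule push_superset) auto
  ultimately show ?thesis by (simp add: lookup_add single_add sum.distrib)
qed

lemma push_sum: "push s (sum p I) = (\<Sum>i\<in>I. push s (p i))"
  by (induction I rule: infinite_finite_induct) (auto simp: push_zero push_add)

lemma push_single: "push s (Poly_Mapping.single a c) = Poly_Mapping.single (s a) c"
  by (subst push_superset[of "{a}"]) (auto split: if_splits)

lemma push_push: "push s (push t p) = push (\<lambda>a. s (t a)) p"
  unfolding push_def[of t] push_sum push_single by (simp add: push_def)

lemma push_cong: "(\<And>a. a \<in> Poly_Mapping.keys p \<Longrightarrow> s a = t a) \<Longrightarrow> push s p = push t p"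
  unfolding push_def by (rule sum.cong) auto

lemma push_id: "push (\<lambda>a. a) p = p"
  unfolding push_def by (rule pm_expand[symmetric])

lemma keys_push: "Poly_Mapping.keys (push s p) \<subseteq> s ` Poly_Mapping.keys p"
proof
  fix x assume x: "x \<in> Poly_Mapping.keys (push s p)"
  show "x \<in> s ` Poly_Mapping.keys p"
  proof (rule ccontr)
    assume "x \<notin> s ` Poly_Mapping.keys p"
    then have "Poly_Mapping.lookup (push s p) x = 0"
      unfolding push_def lookup_sum by (intro sum.neutral) (auto simp: lookup_single when_def)
    then show False using x by (simp add: in_keys_iff)
  qed
qed

lemma push_smult:
  fixes p :: "'a \<Rightarrow>\<^sub>0 'k::field"
  shows "push s (Poly_Mapping.map ((*) c) p) = (cst c * push s p :: lattice \<Rightarrow>\<^sub>0 'k)"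
proof -
  have look: "Poly_Mapping.lookup (Poly_Mapping.map ((*) c) p) a = c * Poly_Mapping.lookup p a" for a
    by transfer (auto simp: when_def)
  then have "Poly_Mapping.keys (Poly_Mapping.map ((*) c) p) \<subseteq> Poly_Mapping.keys p"
    by (auto simp: in_keys_iff)
  then have "push s (Poly_Mapping.map ((*) c) p)
      = (\<Sum>a\<in>Poly_Mapping.keys p. Poly_Mapping.single (s a) (c * Poly_Mapping.lookup p a))"
    by (subst push_superset[of "Poly_Mapping.keys p"]) (auto simp: look)
  also have "\<dots> = cst c * push s p"
    by (simp add: push_def sum_distrib_left cst_def mult_single)
  finally show ?thesis .
qed

context multiplicative_action
begin

abbreviation RA :: "('k, 'a \<Rightarrow>\<^sub>0 'k) module"
  where "RA \<equiv> invariant_algebra G A \<phi>"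

lemma carrier_RA:
  "p \<in> carrier RA \<longleftrightarrow> Poly_Mapping.keys p \<subseteq> carrier A \<and> (\<forall>g\<in>carrier G. push (\<phi> g) p = p)"
  by (simp add: invariant_algebra_def monoid_algebra_def linear_extension_eq_push)

lemma push_f'_f: "Poly_Mapping.keys p \<subseteq> carrier A \<Longrightarrow> push f' (push f p) = p"
proof -
  assume "Poly_Mapping.keys p \<subseteq> carrier A"
  then have "push (\<lambda>a. f' (f a)) p = push (\<lambda>a. a) p"
    by (intro push_cong) (use f'_f in blast)
  then show ?thesis by (simp only: push_push push_id)
qed

text \<open>\<open>f\<close> intertwines \<open>\<phi> g\<close> with \<open>gt g\<close>, and
  \<open>push f\<close> is injective on elements supported in the carrier.\<close>

lemma push_f_R:
  fixes p :: "'a \<Rightarrow>\<^sub>0 'k"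
  assumes p: "Poly_Mapping.keys p \<subseteq> carrier A"
  shows "push f p \<in> act.R \<longleftrightarrow> p \<in> carrier RA"
proof -
  have pr: "push pr (push f p) = push f p"
    unfolding push_push by (rule push_cong) (use p pr_f in blast)
  have "push (gt g) (push f p) = push f p \<longleftrightarrow> push (\<phi> g) p = p" if g: "g \<in> carrier G" for g
  proof -
    have "push (gt g) (push f p) = push f (push (\<phi> g) p)"
      unfolding push_push by (rule push_cong) (use p gt_f in blast)
    moreover have "Poly_Mapping.keys (push (\<phi> g) p) \<subseteq> carrier A"
      using keys_push[of "\<phi> g" p] p \<phi>_mem[OF g] by blast
    ultimately show ?thesis using push_f'_f[OF p] push_f'_f by metis
  qed
  then show ?thesis
    unfolding act.R_def unfolding carrier_RA linear_extension_eq_push Gs_def using p pr by simp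
qed

lemma R_push:
  fixes r :: "lattice \<Rightarrow>\<^sub>0 'k"
  assumes r: "r \<in> act.R"
  shows "push f' r \<in> carrier RA" and "push f (push f' r) = r"
proof -
  have pr: "pr c = c" if "c \<in> Poly_Mapping.keys r" for c using act.keys_R[OF r that] .
  have "push (\<lambda>c. f (f' c)) r = push (\<lambda>c. c) r" by (rule push_cong) (rule f_f'[OF pr])
  then show eq: "push f (push f' r) = r" by (simp only: push_push push_id)
  have "Poly_Mapping.keys (push f' r) \<subseteq> carrier A"
    using keys_push[of f' r] f'_mem[OF pr] by blast
  then show "push f' r \<in> carrier RA" using push_f_R eq r by metis
qed

lemma push_mult:
  assumes p: "p \<in> carrier RA" and q: "q \<in> carrier RA"
  shows "push f (p \<otimes>\<^bsub>RA\<^esub> q) = push f p * push f q"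
    and "Poly_Mapping.keys (p \<otimes>\<^bsub>RA\<^esub> q) \<subseteq> carrier A"
proof -
  have pA: "Poly_Mapping.keys p \<subseteq> carrier A" "Poly_Mapping.keys q \<subseteq> carrier A"
    using p q carrier_RA by blast+
  have mult: "p \<otimes>\<^bsub>RA\<^esub> q = (\<Sum>x\<in>Poly_Mapping.keys p. \<Sum>y\<in>Poly_Mapping.keys q.
       Poly_Mapping.single (x \<otimes>\<^bsub>A\<^esub> y) (Poly_Mapping.lookup p x * Poly_Mapping.lookup q y))"
    by (simp add: invariant_algebra_def monoid_algebra_def)
  have "push f (p \<otimes>\<^bsub>RA\<^esub> q) = (\<Sum>x\<in>Poly_Mapping.keys p. \<Sum>y\<in>Poly_Mapping.keys q.
       Poly_Mapping.single (f (x \<otimes>\<^bsub>A\<^esub> y)) (Poly_Mapping.lookup p x * Poly_Mapping.lookup q y))"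
    unfolding mult push_sum push_single ..
  also have "\<dots> = (\<Sum>x\<in>Poly_Mapping.keys p. \<Sum>y\<in>Poly_Mapping.keys q.
       Poly_Mapping.single (f x) (Poly_Mapping.lookup p x) * Poly_Mapping.single (f y) (Poly_Mapping.lookup q y))"
  proof (intro sum.cong refl)
    fix x y assume "x \<in> Poly_Mapping.keys p" "y \<in> Poly_Mapping.keys q"
    then have "x \<in> carrier A" "y \<in> carrier A" using pA by blast+
    then show "Poly_Mapping.single (f (x \<otimes>\<^bsub>A\<^esub> y)) (Poly_Mapping.lookup p x * Poly_Mapping.lookup q y)
      = Poly_Mapping.single (f x) (Poly_Mapping.lookup p x) * Poly_Mapping.single (f y) (Poly_Mapping.lookup q y)"
      by (simp only: f_mult mult_single)
  qed
  also have "\<dots> = push f p * push f q" unfolding push_def sum_product ..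
  finally show "push f (p \<otimes>\<^bsub>RA\<^esub> q) = push f p * push f q" .
  show "Poly_Mapping.keys (p \<otimes>\<^bsub>RA\<^esub> q) \<subseteq> carrier A"
  proof
    fix z assume z: "z \<in> Poly_Mapping.keys (p \<otimes>\<^bsub>RA\<^esub> q)"
    show "z \<in> carrier A"
    proof (rule ccontr)
      assume "z \<notin> carrier A"
      then have "Poly_Mapping.lookup (p \<otimes>\<^bsub>RA\<^esub> q) z = 0"
        unfolding mult lookup_sum
        by (intro sum.neutral ballI) (use pA in \<open>auto simp: lookup_single when_def subset_iff\<close>)
      then show False using z by (simp add: in_keys_iff)
    qed
  qed
qed

lemma RA_add: "p \<oplus>\<^bsub>RA\<^esub> q = p + q"
  by (simp add: invariant_algebra_def monoid_algebra_def)

lemma RA_smult: "c \<odot>\<^bsub>RA\<^esub> p = Poly_Mapping.map ((*) c) p"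
  by (simp add: invariant_algebra_def monoid_algebra_def)

lemma RA_one: "\<one>\<^bsub>RA\<^esub> = Poly_Mapping.single \<one>\<^bsub>A\<^esub> 1"
  by (simp add: invariant_algebra_def monoid_algebra_def)

text \<open>The monomials of the monoid algebra, pulled back along \<open>h\<close> and pushed to
  the lattice, form the multiplicative basis that \<open>invariant_basis\<close> refutes.\<close>

lemma not_monoid_algebra:
  fixes M :: "'m monoid"
  assumes M: "comm_monoid M" and h: "h \<in> algebra_iso RA (monoid_algebra M)"
  shows False
proof -
  interpret M: comm_monoid M by (rule M)
  interpret R: subring_hom act.R "\<lambda>x :: lattice \<Rightarrow>\<^sub>0 'k. x" by (rule act.R_subring)
  obtain g0 q where g0: "g0 \<in> Gs" "g0 \<noteq> id" "Factorial_Ring.prime q" "g0 ^^ q = id" "of_nat q \<noteq> (0 :: 'k)"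
    using prime_order_element by blast
  have h_iso: "h \<in> ring_iso RA (monoid_algebra M)" and h_smult: "\<And>c x. x \<in> carrier RA \<Longrightarrow> h (c \<odot>\<^bsub>RA\<^esub> x) = c \<odot>\<^bsub>monoid_algebra M\<^esub> h x"
    using h by (auto simp: algebra_iso_def)
  note h_hom = ring_iso_memE[OF h_iso]
  have h_bij: "bij_betw h (carrier RA) (carrier (monoid_algebra M))" using h_hom(5) .
  define h' where "h' = inv_into (carrier RA) h"
  define e where "e x = push f (h' (Poly_Mapping.single x (1 :: 'k)))" for x
  define \<theta> where "\<theta> r = h (push f' r)" for r :: "lattice \<Rightarrow>\<^sub>0 'k"
  have sM: "Poly_Mapping.single x (1 :: 'k) \<in> carrier (monoid_algebra M)" if "x \<in> carrier M" for x
    using that by (simp add: monoid_algebra_def)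
  have h'_mem: "h' (Poly_Mapping.single x 1) \<in> carrier RA"
    and h_h': "h (h' (Poly_Mapping.single x 1)) = Poly_Mapping.single x 1" if "x \<in> carrier M" for x
    using h_bij sM[OF that] unfolding h'_def bij_betw_def by (auto intro!: inv_into_into f_inv_into_f)
  have h_inj: "p = p'" if "p \<in> carrier RA" "p' \<in> carrier RA" "h p = h p'" for p p'
    using that bij_betw_imp_inj_on[OF h_bij] by (auto dest: inj_onD)
  have keysA: "Poly_Mapping.keys p \<subseteq> carrier A" if "p \<in> carrier RA" for p
    using that carrier_RA by blast
  have e_R: "e x \<in> act.R" if x: "x \<in> carrier M" for x
    unfolding e_def using push_f_R[OF keysA[OF h'_mem[OF x]]] h'_mem[OF x] by blast
  have one_RA: "\<one>\<^bsub>RA\<^esub> \<in> carrier RA"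
  proof -
    have "push f (Poly_Mapping.single \<one>\<^bsub>A\<^esub> (1 :: 'k)) \<in> act.R"
      unfolding push_single f_one using R.one_mem by simp
    then show ?thesis unfolding RA_one by (subst push_f_R[symmetric]) auto
  qed
  have \<theta>_add: "\<theta> (r + s) = \<theta> r + \<theta> s" if "r \<in> act.R" "s \<in> act.R" for r s
  proof -
    have "h (push f' r \<oplus>\<^bsub>RA\<^esub> push f' s) = h (push f' r) \<oplus>\<^bsub>monoid_algebra M\<^esub> h (push f' s)"
      by (rule h_hom(3)[OF R_push(1)[OF that(1)] R_push(1)[OF that(2)]])
    then show ?thesis by (simp add: \<theta>_def push_add RA_add monoid_algebra_def)
  qed
  have \<theta>_single: "\<theta> (cst c * e x) = Poly_Mapping.single x c" if x: "x \<in> carrier M" for x c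
  proof -
    let ?p = "h' (Poly_Mapping.single x 1)"
    have mem: "Poly_Mapping.keys (Poly_Mapping.map ((*) c) ?p) \<subseteq> carrier A"
    proof -
      have "Poly_Mapping.keys (Poly_Mapping.map ((*) c) ?p) \<subseteq> Poly_Mapping.keys ?p"
        by transfer (auto simp: when_def)
      then show ?thesis using keysA[OF h'_mem[OF x]] by blast
    qed
    have "push f' (cst c * e x) = c \<odot>\<^bsub>RA\<^esub> ?p"
      unfolding e_def push_smult[symmetric] RA_smult by (rule push_f'_f[OF mem])
    then have "\<theta> (cst c * e x) = c \<odot>\<^bsub>monoid_algebra M\<^esub> h ?p"
      by (simp only: \<theta>_def h_smult[OF h'_mem[OF x]])
    also have "\<dots> = Poly_Mapping.single x c"
      unfolding h_h'[OF x] by (simp add: monoid_algebra_def)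
    finally show ?thesis .
  qed
  have \<theta>_keys: "Poly_Mapping.keys (\<theta> r) \<subseteq> carrier M" if "r \<in> act.R" for r
    using h_hom(1)[OF R_push(1)[OF that]] by (simp add: \<theta>_def monoid_algebra_def)
  have \<theta>_zero: "\<theta> 0 = 0" using \<theta>_add[OF R.zero_mem R.zero_mem] by simp
  have \<theta>_sum: "\<theta> (sum F I) = (\<Sum>i\<in>I. \<theta> (F i))" if "\<And>i. i \<in> I \<Longrightarrow> F i \<in> act.R" for F :: "'m \<Rightarrow> _" and I
    using that by (induction I rule: infinite_finite_induct) (auto simp: \<theta>_zero \<theta>_add R.sum_mem)
  have \<theta>_expand: "r = pm_eval cst e (\<theta> r)" if r: "r \<in> act.R" for r
  proof -
    let ?s = "pm_eval cst e (\<theta> r)"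
    have mem: "cst c * e x \<in> act.R" if "x \<in> Poly_Mapping.keys (\<theta> r)" for c x
      using \<theta>_keys[OF r] that by (intro R.mult_mem act.cst_R e_R) blast
    have s: "?s \<in> act.R" unfolding pm_eval_def by (intro R.sum_mem mem)
    have "\<theta> ?s = (\<Sum>x\<in>Poly_Mapping.keys (\<theta> r). \<theta> (cst (Poly_Mapping.lookup (\<theta> r) x) * e x))"
      unfolding pm_eval_def by (rule \<theta>_sum) (rule mem)
    also have "\<dots> = (\<Sum>x\<in>Poly_Mapping.keys (\<theta> r). Poly_Mapping.single x (Poly_Mapping.lookup (\<theta> r) x))"
      by (rule sum.cong[OF refl]) (use \<theta>_keys[OF r] \<theta>_single in blast)
    also have "\<dots> = \<theta> r" by (rule pm_expand[symmetric])
    \<comment> \<open>\<open>r\<close> and its expansion have the same coordinates, and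
      \<open>h\<close> is injective.\<close>
    finally have "push f' ?s = push f' r"
      unfolding \<theta>_def by (rule h_inj[OF R_push(1)[OF s[unfolded \<theta>_def]] R_push(1)[OF r]])
    then show ?thesis using R_push(2)[OF s] R_push(2)[OF r] by (simp only:)
  qed
  have e_one: "e \<one>\<^bsub>M\<^esub> = 1"
  proof -
    have "h \<one>\<^bsub>RA\<^esub> = Poly_Mapping.single \<one>\<^bsub>M\<^esub> 1"
      using h_hom(4) by (simp add: monoid_algebra_def)
    then have "h' (Poly_Mapping.single \<one>\<^bsub>M\<^esub> 1) = \<one>\<^bsub>RA\<^esub>"
      by (intro h_inj h'_mem one_RA M.one_closed) (simp only: h_h'[OF M.one_closed])
    then show ?thesis by (simp only: e_def RA_one push_single f_one) simp
  qed
  have e_mult: "e (x \<otimes>\<^bsub>M\<^esub> y) = e x * e y" if x: "x \<in> carrier M" and y: "y \<in> carrier M" for x y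
  proof -
    let ?p = "h' (Poly_Mapping.single x 1)" and ?q = "h' (Poly_Mapping.single y 1)"
    note pq = h'_mem[OF x] h'_mem[OF y]
    have prod: "push f (?p \<otimes>\<^bsub>RA\<^esub> ?q) = e x * e y" unfolding push_mult(1)[OF pq] e_def ..
    have mem: "?p \<otimes>\<^bsub>RA\<^esub> ?q \<in> carrier RA"
      unfolding push_f_R[OF push_mult(2)[OF pq], symmetric] prod by (intro R.mult_mem e_R x y)
    have "h (?p \<otimes>\<^bsub>RA\<^esub> ?q) = Poly_Mapping.single (x \<otimes>\<^bsub>M\<^esub> y) 1"
      unfolding h_hom(2)[OF pq] h_h'[OF x] h_h'[OF y] by (simp add: monoid_algebra_def)
    then have "h' (Poly_Mapping.single (x \<otimes>\<^bsub>M\<^esub> y) 1) = ?p \<otimes>\<^bsub>RA\<^esub> ?q"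
      by (intro h_inj h'_mem mem M.m_closed x y) (simp only: h_h'[OF M.m_closed[OF x y]])
    then show ?thesis unfolding e_def[of "x \<otimes>\<^bsub>M\<^esub> y"] using prod by (simp only:)
  qed
  interpret prime_action Gs pr type_k g0 q
    by unfold_locales (use g0 in auto)
  interpret invariant_basis Gs pr type_k g0 q "carrier M" "\<lambda>x y. x \<otimes>\<^bsub>M\<^esub> y" "\<one>\<^bsub>M\<^esub>" e \<theta>
  proof unfold_locales
    show "e x \<in> act.R" if "x \<in> carrier M" for x using that by (rule e_R)
    show "\<one>\<^bsub>M\<^esub> \<in> carrier M" by (rule M.one_closed)
    show "x \<otimes>\<^bsub>M\<^esub> y \<in> carrier M" if "x \<in> carrier M" "y \<in> carrier M" for x y
      using that by (rule M.m_closed)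
    show "e \<one>\<^bsub>M\<^esub> = 1" by (rule e_one)
    show "e (x \<otimes>\<^bsub>M\<^esub> y) = e x * e y" if "x \<in> carrier M" "y \<in> carrier M" for x y
      using that by (rule e_mult)
    show "Poly_Mapping.keys (\<theta> r) \<subseteq> carrier M" if "r \<in> act.R" for r
      using that by (rule \<theta>_keys)
    show "r = pm_eval cst e (\<theta> r)" if "r \<in> act.R" for r
      using that by (rule \<theta>_expand)
    show "\<theta> (r + s) = \<theta> r + \<theta> s" if "r \<in> act.R" "s \<in> act.R" for r s
      using that by (rule \<theta>_add)
    show "\<theta> (cst c * e x) = Poly_Mapping.single x c" if "x \<in> carrier M" for x c
      using that by (rule \<theta>_single)
  qed
  show False by (rule contradiction)
qed

end

theorem mainTheorem2:
  fixes A :: "('a, 'b) monoid_scheme" and G :: "('g, 'c) monoid_scheme"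
    and \<phi> :: "'g \<Rightarrow> 'a \<Rightarrow> 'a"
  assumes "comm_group A" and "\<exists>n. free_abelian_of_rank A n"
    and "group G" and "finite (carrier G)"
    and "\<phi> \<in> hom G (AutoGroup A)" and "inj_on \<phi> (carrier G)"
    and "\<not> CHAR('k::field) dvd order G"
    and "fixed_point_free G (A Mod fixed_subgroup G A \<phi>) (coset_action \<phi>)"
    and "free_rank (A Mod fixed_subgroup G A \<phi>) \<ge> 2"
  shows "\<not> semigroup_algebra TYPE('m) (invariant_algebra G A \<phi> :: ('k, 'a \<Rightarrow>\<^sub>0 'k) module)"
proof
  obtain n :: nat where "A \<cong> free_Abelian_group {..<n}"
    using assms(2) unfolding free_abelian_of_rank_def by blast
  then obtain f where f: "f \<in> iso A (free_Abelian_group {..<n})"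
    unfolding is_iso_def by blast
  interpret multiplicative_action A G \<phi> n f "TYPE('k)"
    by (intro multiplicative_action.intro multiplicative_action_axioms.intro assms f)
  assume "semigroup_algebra TYPE('m) (invariant_algebra G A \<phi> :: ('k, 'a \<Rightarrow>\<^sub>0 'k) module)"
  then obtain M :: "'m monoid" and h where "comm_monoid M" "h \<in> algebra_iso RA (monoid_algebra M)"
    unfolding semigroup_algebra_def by blast
  then show False by (rule not_monoid_algebra)
qed

end
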